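(* Let $\theta>2$, $\kappa=1-2\alpha>0$, let $(u,m)$ be a constructed solution of (P) (as defined in the context), and let $\mu(\tau,\eta)=t^\alpha m(t,t^\alpha\eta)$ with $t=e^\tau$. There exists a constant $C>0$ such that, for all $\tau\in(-\infty,\ln T)$, $$\mathbf{d}_2(\mu(\tau),\phi)\le Ce^{\kappa\tau},$$ where $\mathbf{d}_2$ is the 2-Wasserstein distance between probability measures on $\mathbb{R}$.
   Context: Let $T>0$, $\theta>0$, $\alpha=\frac{2}{2+\theta}\in(0,1)$, and $\phi(r)=\left(\frac12\alpha(1-\alpha)(R_\alpha^2-r^2)\right)_+^{1/\theta}$, where $R_\alpha>0$ is chosen such that $\int_{\mathbb{R}}\phi=1$. The terminal density $m_T:\mathbb{R}\to[0,\infty)$ is a probability density supported in an interval $[a,b]$, smooth in $(a,b)$, with $m_T^\theta\in C^{1,\sigma}(a,b)$ for some $\sigma>0$, and for some $C_0>1$ $$C_0^{-1}\,\mathrm{dist}(x,\{a,b\})^{1/\theta}\le m_T(x)\le C_0\,\mathrm{dist}(x,\{a,b\})^{1/\theta},\qquad x\in[a,b].$$ The planning problem (P) is $$-u_t+\tfrac12|u_x|^2=m^\theta,\qquad m_t-(mu_x)_x=0\quad\text{in }(0,T)\times\mathbb{R},\qquad m(0)=\delta_0,\quad m(T)=m_T.$$ A solution of (P) is a pair $(u,m)\in C^1((0,T)\times\mathbb{R})\times\big(C([0,T];\mathcal{P}(\mathbb{R}))\cap C((0,T)\times\mathbb{R})\big)$ ($\mathcal{P}(\mathbb{R})$: Borel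 probability measures with the weak topology) such that the first equation holds classically, the second in the distributional sense, and $m(0,\cdot)=\delta_0$, $m(T,\cdot)=m_T$. Approximation: for $\varepsilon\in(0,1)$ let $m_0^{(\varepsilon)}(x)=\varepsilon^{-\alpha}\phi(\varepsilon^{-\alpha}x)$ and let $(u^{(\varepsilon)},m^{(\varepsilon)})$ be the solution of the same system with $m^{(\varepsilon)}(0)=m_0^{(\varepsilon)}$, $m^{(\varepsilon)}(T)=m_T$. It is known that such a solution exists, with $u^{(\varepsilon)}$ of class $C^1$ and globally Lipschitz, $m^{(\varepsilon)}$ globally Hölder continuous, both smooth in $\{m^{(\varepsilon)}>0\}$; $m^{(\varepsilon)}$ is unique and $u^{(\varepsilon)}$ is unique up to an additive constant in $\{m^{(\varepsilon)}>0\}$. The function $u^{(\varepsilon)}$ is normalized by $\int_{\mathbb{R}}u^{(\varepsilon)}(T)m_T=0$ and is chosen outside $\{m^{(\varepsilon)}>0\}$ so that $\|u_x^{(\varepsilon)}(t)\|_{L^\infty(\{m^{(\varepsilon)}(t)=0\})}\le C(t+\varepsilon)^{\alpha-1}$ for $t\in[0,T]$, with $C$ independent of $\varepsilon$ (such a choice is possible). A constructed solution of (P) is a solution $(u,m)$ of (P) that is the locally uniform limit in $(0,T)\times\mathbb{R}$ of $(u^{(\varepsilon_k)},m^{(\varepsilon_k)})$ along some sequence $\varepsilon_k\to0^+$ (such limits exist). *)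

theory Defs
  imports "HOL-Probability.Probability"
begin

section \<open>The self-similar profile\<close>

definition alpha :: "real \<Rightarrow> real" where
  "alpha \<theta> = 2 / (2 + \<theta>)"

definition profile :: "real \<Rightarrow> real \<Rightarrow> real \<Rightarrow> real" where
  "profile \<theta> R r =
     (max 0 (1/2 * alpha \<theta> * (1 - alpha \<theta>) * (R\<^sup>2 - r\<^sup>2))) powr (1 / \<theta>)"

text \<open>The description below is proper for every positive \<open>\<theta>\<close>, see \<open>R_alpha_ex1\<close>.\<close>

definition R_alpha :: "real \<Rightarrow> real" where
  "R_alpha \<theta> = (THE R. R > 0 \<and> (\<integral>r. profile \<theta> R r \<partial>lborel) = 1)"

definition phi :: "real \<Rightarrow> real \<Rightarrow> real" where
  "phi \<theta> = profile \<theta> (R_alpha \<theta>)"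

lemma alpha_bounds: "\<theta> > 0 \<Longrightarrow> 0 < alpha \<theta> \<and> alpha \<theta> < 1"
  by (simp add: alpha_def)

lemma continuous_on_profile: "\<theta> > 0 \<Longrightarrow> continuous_on A (profile \<theta> R)"
  unfolding profile_def by (intro continuous_intros continuous_on_powr') auto

lemma profile_eq_0: "\<theta> > 0 \<Longrightarrow> R > 0 \<Longrightarrow> \<bar>r\<bar> \<ge> R \<Longrightarrow> profile \<theta> R r = 0"
proof -
  assume *: "\<theta> > 0" "R > 0" "\<bar>r\<bar> \<ge> R"
  then have "R\<^sup>2 \<le> r\<^sup>2" by (metis abs_le_square_iff abs_of_pos)
  moreover have "1/2 * alpha \<theta> * (1 - alpha \<theta>) \<ge> 0" using alpha_bounds[OF *(1)] by simp
  ultimately have "1/2 * alpha \<theta> * (1 - alpha \<theta>) * (R\<^sup>2 - r\<^sup>2) \<le> 0"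
    by (intro mult_nonneg_nonpos) auto
  then show ?thesis unfolding profile_def by (simp add: max_def)
qed

lemma integrable_profile:
  assumes "\<theta> > 0" "R > 0" shows "integrable lborel (profile \<theta> R)"
proof -
  have "set_integrable lborel {-R..R} (profile \<theta> R)"
    unfolding set_integrable_def
    by (rule borel_integrable_compact) (auto intro: continuous_on_profile assms)
  moreover have "(\<lambda>x. indicat_real {-R..R} x *\<^sub>R profile \<theta> R x) = profile \<theta> R"
  proof
    fix x show "indicat_real {-R..R} x *\<^sub>R profile \<theta> R x = profile \<theta> R x"
      using profile_eq_0[OF assms, of x] by (cases "x \<in> {-R..R}") (auto simp: abs_if)
  qed
  ultimately show ?thesis by (simp add: set_integrable_def)
qed

lemma integral_profile_1_pos:
  assumes "\<theta> > 0" shows "(\<integral>r. profile \<theta> 1 r \<partial>lborel) > 0"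
proof -
  define c where "c = profile \<theta> 1 (1/2)"
  have k: "1/2 * alpha \<theta> * (1 - alpha \<theta>) > 0" using alpha_bounds[OF assms] by simp
  have c: "c > 0" unfolding c_def profile_def using k alpha_bounds[OF assms] by (simp add: max_def power2_eq_square)
  have le: "c * indicat_real {-1/2..1/2::real} r \<le> profile \<theta> 1 r" for r
  proof (cases "r \<in> {-1/2..1/2::real}")
    case True
    then have "r\<^sup>2 \<le> (1/2)\<^sup>2" by (intro abs_le_square_iff[THEN iffD1]) auto
    then have "1/2 * alpha \<theta> * (1 - alpha \<theta>) * (1\<^sup>2 - (1/2)\<^sup>2)
        \<le> 1/2 * alpha \<theta> * (1 - alpha \<theta>) * (1\<^sup>2 - r\<^sup>2)"
      using k by (intro mult_left_mono) auto
    then have "c \<le> profile \<theta> 1 r" unfolding c_def profile_def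
      using assms by (intro powr_mono2) (auto simp del: one_power2)
    then show ?thesis using True by simp
  qed (simp add: profile_def)
  have i: "integrable lborel (\<lambda>r. c * indicat_real {-1/2..1/2::real} r)"
    by (intro integrable_mult_right integrable_real_indicator) auto
  have "(\<integral>r. c * indicat_real {-1/2..1/2::real} r \<partial>lborel) \<le> (\<integral>r. profile \<theta> 1 r \<partial>lborel)"
    by (rule integral_mono[OF i integrable_profile[OF assms zero_less_one] le])
  moreover have "(\<integral>r. c * indicat_real {-1/2..1/2::real} r \<partial>lborel) = c" by simp
  ultimately show ?thesis using c by simp
qed

lemma integral_profile_scale:
  assumes "\<theta> > 0" "R > 0"
  shows "(\<integral>r. profile \<theta> R r \<partial>lborel) = R powr (2 / \<theta> + 1) * (\<integral>r. profile \<theta> 1 r \<partial>lborel)"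
proof -
  have eq: "profile \<theta> R (0 + R * r) = R powr (2 / \<theta>) * profile \<theta> 1 r" for r
  proof -
    have "max 0 (1/2 * alpha \<theta> * (1 - alpha \<theta>) * (R\<^sup>2 - (0 + R * r)\<^sup>2))
        = R\<^sup>2 * max 0 (1/2 * alpha \<theta> * (1 - alpha \<theta>) * (1\<^sup>2 - r\<^sup>2))"
      using assms by (subst max_mult_distrib_left) (auto simp: algebra_simps power2_eq_square)
    moreover have "(R\<^sup>2) powr (1 / \<theta>) = R powr (2 / \<theta>)"
      using assms by (simp add: powr_powr flip: powr_numeral)
    ultimately show ?thesis unfolding profile_def by (simp add: powr_mult del: one_power2)
  qed
  have "(\<integral>r. profile \<theta> R r \<partial>lborel) = \<bar>R\<bar> *\<^sub>R (\<integral>r. profile \<theta> R (0 + R * r) \<partial>lborel)"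
    using assms by (intro lborel_integral_real_affine) auto
  also have "\<dots> = R * (R powr (2 / \<theta>) * (\<integral>r. profile \<theta> 1 r \<partial>lborel))"
    unfolding eq using assms by simp
  finally show ?thesis using assms by (simp add: powr_add)
qed

lemma R_alpha_ex1:
  assumes "\<theta> > 0" shows "\<exists>!R. R > 0 \<and> (\<integral>r. profile \<theta> R r \<partial>lborel) = 1"
proof -
  define c where "c = (\<integral>r. profile \<theta> 1 r \<partial>lborel)"
  have c: "c > 0" unfolding c_def by (rule integral_profile_1_pos[OF assms])
  define p where "p = 2 / \<theta> + 1"
  have p: "p > 0" unfolding p_def using assms by (simp add: add_pos_pos)
  have iff: "(\<integral>r. profile \<theta> R r \<partial>lborel) = 1 \<longleftrightarrow> R = (1 / c) powr (1 / p)" if "R > 0" for R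
  proof -
    have "(\<integral>r. profile \<theta> R r \<partial>lborel) = 1 \<longleftrightarrow> R powr p = 1 / c"
      using integral_profile_scale[OF assms that] c unfolding c_def p_def by (simp add: field_simps)
    also have "\<dots> \<longleftrightarrow> R = (1 / c) powr (1 / p)"
    proof
      assume "R powr p = 1 / c"
      then have "(1 / c) powr (1 / p) = (R powr p) powr (1 / p)" by simp
      then show "R = (1 / c) powr (1 / p)" using p that by (simp only: powr_powr) simp
    next
      assume "R = (1 / c) powr (1 / p)"
      then show "R powr p = 1 / c" using p c by (simp only: powr_powr) simp
    qed
    finally show ?thesis .
  qed
  show ?thesis by (rule ex1I[of _ "(1 / c) powr (1 / p)"]) (use iff c in auto)
qed

lemma R_alpha:
  assumes "\<theta> > 0" shows "R_alpha \<theta> > 0" "(\<integral>r. phi \<theta> r \<partial>lborel) = 1"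
  using theI'[OF R_alpha_ex1[OF assms]] unfolding R_alpha_def phi_def by auto


section \<open>Regularity of functions of time and space\<close>

definition d_time :: "(real \<Rightarrow> real \<Rightarrow> real) \<Rightarrow> real \<Rightarrow> real \<Rightarrow> real" where
  "d_time f t x = deriv (\<lambda>s. f s x) t"

definition d_space :: "(real \<Rightarrow> real \<Rightarrow> real) \<Rightarrow> real \<Rightarrow> real \<Rightarrow> real" where
  "d_space f t x = deriv (f t) x"

text \<open>Meaningful for open \<open>S\<close>: all partial derivatives up to the given order exist and are
  continuous.\<close>

primrec Ck_on :: "nat \<Rightarrow> (real \<times> real) set \<Rightarrow> (real \<Rightarrow> real \<Rightarrow> real) \<Rightarrow> bool" where
  "Ck_on 0 S f \<longleftrightarrow> continuous_on S (\<lambda>(t, x). f t x)"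
| "Ck_on (Suc n) S f \<longleftrightarrow>
     continuous_on S (\<lambda>(t, x). f t x) \<and>
     (\<forall>(t, x)\<in>S. (\<lambda>s. f s x) field_differentiable at t \<and> f t field_differentiable at x) \<and>
     Ck_on n S (d_time f) \<and> Ck_on n S (d_space f)"

definition smooth_on2 :: "(real \<times> real) set \<Rightarrow> (real \<Rightarrow> real \<Rightarrow> real) \<Rightarrow> bool" where
  "smooth_on2 S f \<longleftrightarrow> (\<forall>n. Ck_on n S f)"

definition hoelder_on :: "real \<Rightarrow> ('a::metric_space) set \<Rightarrow> ('a \<Rightarrow> real) \<Rightarrow> bool" where
  "hoelder_on \<gamma> S f \<longleftrightarrow> (\<exists>L. \<forall>p\<in>S. \<forall>q\<in>S. \<bar>f p - f q\<bar> \<le> L * dist p q powr \<gamma>)"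

definition test_function :: "(real \<times> real) set \<Rightarrow> (real \<Rightarrow> real \<Rightarrow> real) \<Rightarrow> bool" where
  "test_function S \<psi> \<longleftrightarrow>
     smooth_on2 UNIV \<psi> \<and> (\<exists>K. compact K \<and> K \<subseteq> S \<and> (\<forall>(t, x)\<in>-K. \<psi> t x = 0))"


section \<open>The planning problem\<close>

definition terminal_density :: "real \<Rightarrow> (real \<Rightarrow> real) \<Rightarrow> bool" where
  "terminal_density \<theta> mT \<longleftrightarrow>
     (\<forall>x. mT x \<ge> 0) \<and> has_bochner_integral lborel mT 1 \<and>
     (\<exists>a b. a < b \<and> (\<forall>x. x \<notin> {a..b} \<longrightarrow> mT x = 0) \<and>
       (\<forall>n. \<forall>x\<in>{a<..<b}. (deriv ^^ n) mT field_differentiable at x) \<and>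
       (\<exists>\<sigma>>0. (\<forall>x\<in>{a<..<b}. (\<lambda>y. mT y powr \<theta>) field_differentiable at x) \<and>
          hoelder_on \<sigma> {a<..<b} (deriv (\<lambda>y. mT y powr \<theta>))) \<and>
       (\<exists>C0>1. \<forall>x\<in>{a..b}.
          inverse C0 * infdist x {a, b} powr (1 / \<theta>) \<le> mT x \<and>
          mT x \<le> C0 * infdist x {a, b} powr (1 / \<theta>)))"

text \<open>Continuity in time for the weak topology on the Borel probability measures, which is the
  initial topology of the integrals of bounded continuous functions.\<close>

definition weakly_continuous_curve :: "real set \<Rightarrow> (real \<Rightarrow> real measure) \<Rightarrow> bool" where
  "weakly_continuous_curve I \<mu> \<longleftrightarrow>
     (\<forall>t\<in>I. real_distribution (\<mu> t)) \<and>
     (\<forall>f :: real \<Rightarrow> real. continuous_on UNIV f \<and> bounded (range f) \<longrightarrow>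
        continuous_on I (\<lambda>t. \<integral>x. f x \<partial>\<mu> t))"

abbreviation density_measure :: "(real \<Rightarrow> real) \<Rightarrow> real measure" where
  "density_measure f \<equiv> density lborel (\<lambda>x. ennreal (f x))"

text \<open>Here \<open>m t x\<close> is the density of the curve of measures at times \<open>0 < t < T\<close>; the endpoint
  values of the curve are the prescribed measures \<open>\<mu>0\<close> and \<open>\<mu>T\<close>, which may be singular.\<close>

definition planning_solution ::
    "real \<Rightarrow> real \<Rightarrow> real measure \<Rightarrow> real measure \<Rightarrow>
     (real \<Rightarrow> real \<Rightarrow> real) \<Rightarrow> (real \<Rightarrow> real \<Rightarrow> real) \<Rightarrow> bool" where
  "planning_solution \<theta> T \<mu>0 \<mu>T u m \<longleftrightarrow>
     Ck_on 1 ({0<..<T} \<times> UNIV) u \<and>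
     continuous_on ({0<..<T} \<times> UNIV) (\<lambda>(t, x). m t x) \<and>
     (\<forall>t\<in>{0<..<T}. \<forall>x. m t x \<ge> 0) \<and>
     (\<exists>\<mu>. weakly_continuous_curve {0..T} \<mu> \<and> \<mu> 0 = \<mu>0 \<and> \<mu> T = \<mu>T \<and>
          (\<forall>t\<in>{0<..<T}. \<mu> t = density_measure (m t))) \<and>
     (\<forall>t\<in>{0<..<T}. \<forall>x. - d_time u t x + 1/2 * \<bar>d_space u t x\<bar>\<^sup>2 = m t x powr \<theta>) \<and>
     (\<forall>\<psi>. test_function ({0<..<T} \<times> UNIV) \<psi> \<longrightarrow>
        (\<integral>(t, x). m t x * (d_time \<psi> t x - d_space u t x * d_space \<psi> t x) \<partial>lborel) = 0)"

definition initial_approx :: "real \<Rightarrow> real \<Rightarrow> real \<Rightarrow> real" where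
  "initial_approx \<theta> \<epsilon> x =
     \<epsilon> powr (- alpha \<theta>) * phi \<theta> (\<epsilon> powr (- alpha \<theta>) * x)"

text \<open>The \<open>L\<^sup>\<infinity>\<close> bound on \<open>u\<^sub>x\<close> over \<open>{m(t) = 0}\<close> is an almost-everywhere bound; at \<open>t = 0\<close> and
  \<open>t = T\<close> it concerns the Lipschitz traces of \<open>u\<close>.  Smoothness and the \<open>C\<^sup>1\<close> property are only
  required at interior times.\<close>

definition approx_solution ::
    "real \<Rightarrow> real \<Rightarrow> (real \<Rightarrow> real) \<Rightarrow> real \<Rightarrow> real \<Rightarrow>
     (real \<Rightarrow> real \<Rightarrow> real) \<Rightarrow> (real \<Rightarrow> real \<Rightarrow> real) \<Rightarrow> bool" where
  "approx_solution \<theta> T mT C \<epsilon> u m \<longleftrightarrow>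
     planning_solution \<theta> T (density_measure (initial_approx \<theta> \<epsilon>)) (density_measure mT) u m \<and>
     m 0 = initial_approx \<theta> \<epsilon> \<and> m T = mT \<and>
     (\<exists>L. L-lipschitz_on ({0..T} \<times> UNIV) (\<lambda>(t, x). u t x)) \<and>
     (\<exists>\<gamma>>0. hoelder_on \<gamma> ({0..T} \<times> UNIV) (\<lambda>(t, x). m t x)) \<and>
     smooth_on2 {(t, x). 0 < t \<and> t < T \<and> m t x > 0} u \<and>
     smooth_on2 {(t, x). 0 < t \<and> t < T \<and> m t x > 0} m \<and>
     (\<integral>x. u T x * mT x \<partial>lborel) = 0 \<and>
     (\<forall>t\<in>{0..T}. AE x in lborel. m t x = 0 \<longrightarrow>
        (\<exists>d. (u t has_real_derivative d) (at x) \<and>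
             \<bar>d\<bar> \<le> C * (t + \<epsilon>) powr (alpha \<theta> - 1)))"

definition constructed_solution ::
    "real \<Rightarrow> real \<Rightarrow> (real \<Rightarrow> real) \<Rightarrow>
     (real \<Rightarrow> real \<Rightarrow> real) \<Rightarrow> (real \<Rightarrow> real \<Rightarrow> real) \<Rightarrow> bool" where
  "constructed_solution \<theta> T mT u m \<longleftrightarrow>
     planning_solution \<theta> T (return borel 0) (density_measure mT) u m \<and>
     (\<exists>U M C. (\<forall>\<epsilon>\<in>{0<..<1}. approx_solution \<theta> T mT C \<epsilon> (U \<epsilon>) (M \<epsilon>)) \<and>
       (\<exists>\<epsilon>. (\<forall>k. \<epsilon> k \<in> {0<..<1}) \<and> \<epsilon> \<longlonglongrightarrow> 0 \<and>
         (\<forall>K. compact K \<and> K \<subseteq> {0<..<T} \<times> UNIV \<longrightarrow>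
            uniform_limit K (\<lambda>k (t, x). U (\<epsilon> k) t x) (\<lambda>(t, x). u t x) sequentially \<and>
            uniform_limit K (\<lambda>k (t, x). M (\<epsilon> k) t x) (\<lambda>(t, x). m t x) sequentially)))"


section \<open>Rescaling and the Wasserstein distance\<close>

definition rescaled :: "real \<Rightarrow> (real \<Rightarrow> real \<Rightarrow> real) \<Rightarrow> real \<Rightarrow> real \<Rightarrow> real" where
  "rescaled \<theta> m \<tau> \<eta> =
     (let t = exp \<tau> in t powr alpha \<theta> * m t (t powr alpha \<theta> * \<eta>))"

definition couplings :: "real measure \<Rightarrow> real measure \<Rightarrow> (real \<times> real) measure set" where
  "couplings \<mu> \<nu> =
     {\<pi>. sets \<pi> = sets borel \<and> distr \<pi> borel fst = \<mu> \<and> distr \<pi> borel snd = \<nu>}"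

definition ennreal_sqrt :: "ennreal \<Rightarrow> ennreal" where
  "ennreal_sqrt x = (if x = \<top> then \<top> else ennreal (sqrt (enn2real x)))"

text \<open>Extended-valued: no finiteness of second moments is presupposed.\<close>

definition wasserstein2 :: "real measure \<Rightarrow> real measure \<Rightarrow> ennreal" where
  "wasserstein2 \<mu> \<nu> =
     ennreal_sqrt (INF \<pi>\<in>couplings \<mu> \<nu>. \<integral>\<^sup>+(x, y). ennreal (\<bar>x - y\<bar>\<^sup>2) \<partial>\<pi>)"

end

theory Submission
  imports Defs
begin

text \<open>Let \<open>X(t, s)\<close> be the quantile function of \<open>m\<^bsup>(\<epsilon>)\<^esup>(t)\<close> and \<open>Z(t, s) = (t + \<epsilon>)\<^bsup>\<alpha>\<^esup> q(s)\<close>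
  that of the self-similar solution with the same initial density. Both are critical points of
  the action \<open>\<integral>\<integral> X\<^sub>t\<^sup>2 / 2 + e(X\<^sub>s)\<close>, which is convex because \<open>e(p) = p\<^bsup>-\<theta>\<^esup> / (\<theta> + 1)\<close> is. Hence
  the distance \<open>D(t)\<close> of \<open>X\<close> and \<open>Z\<close> in \<open>L\<^sup>2(ds)\<close>, which is the Wasserstein distance of the two
  solutions, is a convex function of time that vanishes at \<open>t = 0\<close>, and
  \<open>D(t) / (t + \<epsilon>) \<le> D(T) / (T + \<epsilon>)\<close>. In the limit \<open>\<epsilon> \<rightarrow> 0\<close> the distance of \<open>m(t)\<close> to the
  self-similar solution is at most \<open>C t\<close>. After rescaling this is the rate \<open>e\<^bsup>(1 - \<alpha>) \<tau>\<^esup>\<close>,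
  which is stronger than \<open>e\<^bsup>\<kappa> \<tau>\<^esup>\<close> for \<open>\<tau> < ln T\<close>.

  Second time derivatives of \<open>X\<close> are avoided: the potential \<open>u\<close> calibrates the action and so
  bounds from below the action of the competitors \<open>X - \<nu>(t) (X - Z)\<close>; dividing by the size of
  \<open>\<nu>\<close> and letting it tend to zero yields the convexity. As \<open>m\<^bsup>(\<epsilon>)\<^esup>\<close> might vanish inside its
  support, all this is done for \<open>m\<^bsup>(\<epsilon>)\<^esup>\<close> mixed with a small multiple \<open>\<eta>\<close> of the uniform density.\<close>


section \<open>Smooth bumps and the lemma of du Bois-Reymond\<close>

text \<open>At times 0 and T the potential \<open>u\<close> is only Lipschitz, so velocities there
  are out of reach. Hence convexity is used in integrated form, against weights: the functional
  \<open>Lam\<close> contains \<open>u\<close> through difference quotients, which make sense at the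
  end points, and its weight \<zeta> must be a combination of 1 and 1 / (t + \<epsilon>) for the
  terms in W and W_t to form a square. A constant up to time t, followed by 1 / (s + \<epsilon>) - 1
  / (T + \<epsilon>), is a kind of Green function: it vanishes at T, and its kink at t releases the
  squared distance at time t. Two errors compete. A competitor of size \<delta> costs O(\<delta>)
  and the mixture costs O(\<eta> / \<delta>), so \<eta> has to be small compared with \<delta>. Both
  limits are taken with \<epsilon> fixed; the Lipschitz constant of \<open>u\<close>, the bound of
  \<open>m\<close> and the radius \<open>K\<close>, all uncontrolled as \<epsilon> tends to 0, occur
  only in vanishing terms. What is left depends on the supports at time T. The continuity equation
  is given weakly. The lemma of du Bois-Reymond turns it into a mass balance on rectangles, from
  which the distribution function becomes differentiable in time and in space.\<close>

definition bump :: "real \<Rightarrow> nat \<Rightarrow> real poly \<Rightarrow> real \<Rightarrow> real" where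
  "bump h k p x =
     (if \<bar>x\<bar> < h then poly p x / (h\<^sup>2 - x\<^sup>2) ^ k * exp (- 1 / (h\<^sup>2 - x\<^sup>2)) else 0)"

text \<open>Numerator of the derivative over the common denominator
  \<open>(h\<^sup>2 - x\<^sup>2) ^ (k + 2)\<close>. The family \<open>bump\<close> is thus closed
  under differentiation, and smoothness is an induction on the order.\<close>

definition bump_step :: "real \<Rightarrow> nat \<Rightarrow> real poly \<Rightarrow> real poly" where
  "bump_step h k p =
     pderiv p * [:h\<^sup>2, 0, - 1:] ^ 2 + smult (2 * real k) ([:0, 1:] * p * [:h\<^sup>2, 0, - 1:])
       - smult 2 ([:0, 1:] * p)"

text \<open>A single term of the series of exp (1 / y) is a lower bound for it; taking inverses
  shows that exp (- 1 / y) beats any power of y.\<close>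

lemma exp_neg_inverse_le:
  fixes y :: real
  assumes "y > 0"
  shows "exp (- 1 / y) \<le> fact n * y ^ n"
proof -
  have "(1 / y) ^ n / fact n \<le> exp (1 / y)"
  proof -
    have s: "(\<lambda>i. (1 / y) ^ i / fact i) sums exp (1 / y)"
      using exp_converges[of "1 / y"] by (simp add: divide_inverse mult.commute)
    have "(1 / y) ^ n / fact n = (\<Sum>i\<in>{n}. (1 / y) ^ i / fact i)" by simp
    also have "\<dots> \<le> (\<Sum>i. (1 / y) ^ i / fact i)"
      using assms by (intro sum_le_suminf sums_summable[OF s]) auto
    also have "\<dots> = exp (1 / y)" by (rule sums_unique[OF s, symmetric])
    finally show ?thesis .
  qed
  then have "inverse (exp (1 / y)) \<le> inverse ((1 / y) ^ n / fact n)"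
    using assms by (intro le_imp_inverse_le) auto
  then show ?thesis using assms by (simp add: exp_minus field_simps)
qed

text \<open>The exponential absorbs k + 2 powers of h^2 - x^2, which leaves second-order vanishing
  at the ends of the support. This is what makes the derivative zero there.\<close>

lemma bump_quadratic:
  assumes "h > 0"
  obtains C where "\<And>x. \<bar>bump h k p x\<bar> \<le> C * (h\<^sup>2 - x\<^sup>2)\<^sup>2"
proof -
  have "compact (poly p ` {-h..h})"
    by (intro compact_continuous_image continuous_intros) auto
  then obtain B where B: "\<And>x. x \<in> {-h..h} \<Longrightarrow> \<bar>poly p x\<bar> \<le> B"
    using compact_imp_bounded by (force simp: bounded_iff)
  have B0: "B \<ge> 0" using B[of 0] assms by fastforce
  have "\<bar>bump h k p x\<bar> \<le> B * fact (k + 2) * (h\<^sup>2 - x\<^sup>2)\<^sup>2" for x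
  proof (cases "\<bar>x\<bar> < h")
    case True
    define y where "y = h\<^sup>2 - x\<^sup>2"
    have y: "y > 0" using True unfolding y_def
      by (metis abs_le_square_iff abs_of_pos assms diff_gt_0_iff_gt not_le)
    have "\<bar>bump h k p x\<bar> = \<bar>poly p x\<bar> * (exp (- 1 / y) / y ^ k)"
      using True y by (simp add: bump_def y_def abs_mult)
    also have "\<dots> \<le> B * (fact (k + 2) * y ^ (k + 2) / y ^ k)"
      using B0 y B[of x] exp_neg_inverse_le[OF y, of "k + 2"] True
      by (intro mult_mono divide_right_mono) (auto simp: abs_less_iff)
    also have "\<dots> = B * fact (k + 2) * y\<^sup>2"
      using y by (simp add: power_add power2_eq_square)
    finally show ?thesis by (simp add: y_def)
  qed (use B0 in \<open>simp add: bump_def\<close>)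
  then show thesis by (rule that)
qed

lemma has_derivative_bump:
  assumes "h > 0"
  shows "(bump h k p has_real_derivative bump h (k + 2) (bump_step h k p) x) (at x)"
proof -
  consider "\<bar>x\<bar> < h" | "\<bar>x\<bar> > h" | "\<bar>x\<bar> = h" by linarith
  then show ?thesis
  proof cases
    case 1
    define y where "y = h\<^sup>2 - x\<^sup>2"
    have y: "y > 0" using 1 unfolding y_def
      by (metis abs_le_square_iff abs_of_pos assms diff_gt_0_iff_gt not_le)
    have d: "((\<lambda>x. poly p x / (h\<^sup>2 - x\<^sup>2) ^ k * exp (- 1 / (h\<^sup>2 - x\<^sup>2))) has_real_derivative
        (poly (pderiv p) x / y ^ k + poly p x * (2 * k * x) / y ^ (k + 1)) * exp (- 1 / y)
        + poly p x / y ^ k * (exp (- 1 / y) * (- 2 * x / y\<^sup>2))) (at x)"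
    proof -
      have e: "((\<lambda>x. (h\<^sup>2 - x\<^sup>2) ^ k) has_real_derivative real k * (y ^ (k - 1) * (- 2 * x))) (at x)"
        unfolding y_def by (auto intro!: derivative_eq_intros)
      have q: "(poly (pderiv p) x * y ^ k - poly p x * (real k * (y ^ (k - 1) * (- 2 * x)))) / (y ^ k * y ^ k)
         = poly (pderiv p) x / y ^ k + poly p x * (2 * k * x) / y ^ (k + 1)"
        using y by (cases k) (auto simp: field_simps)
      have "((\<lambda>x. poly p x / (h\<^sup>2 - x\<^sup>2) ^ k) has_real_derivative
          (poly (pderiv p) x * y ^ k - poly p x * (real k * (y ^ (k - 1) * (- 2 * x)))) / (y ^ k * y ^ k)) (at x)"
        using DERIV_divide[OF poly_DERIV e] y by (simp add: y_def)
      note d1 = this[unfolded q]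
      have "((\<lambda>x. exp (- 1 / (h\<^sup>2 - x\<^sup>2))) has_real_derivative exp (- 1 / y) * (- 2 * x / y\<^sup>2)) (at x)"
        unfolding y_def using y[unfolded y_def]
        by (auto intro!: derivative_eq_intros simp: power2_eq_square)
      from DERIV_mult[OF d1 this] show ?thesis by (simp add: y_def algebra_simps)
    qed
    have "poly (bump_step h k p) x = poly (pderiv p) x * y\<^sup>2 + 2 * k * x * poly p x * y - 2 * x * poly p x"
      unfolding bump_step_def y_def by (simp add: power2_eq_square algebra_simps)
    then have "bump h (k + 2) (bump_step h k p) x =
        (poly (pderiv p) x * y\<^sup>2 + 2 * k * x * poly p x * y - 2 * x * poly p x) / y ^ (k + 2) * exp (- 1 / y)"
      using 1 by (simp add: bump_def y_def)
    also have "\<dots> = (poly (pderiv p) x / y ^ k + poly p x * (2 * k * x) / y ^ (k + 1)) * exp (- 1 / y)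
        + poly p x / y ^ k * (exp (- 1 / y) * (- 2 * x / y\<^sup>2))"
      using y by (simp add: power_add power2_eq_square field_simps)
    finally have eq: "bump h (k + 2) (bump_step h k p) x = \<dots>" .
    show ?thesis unfolding eq
    proof (rule has_field_derivative_transform_within_open[OF d, of "{-h<..<h}"])
      show "\<And>x. x \<in> {-h<..<h} \<Longrightarrow> poly p x / (h\<^sup>2 - x\<^sup>2) ^ k * exp (- 1 / (h\<^sup>2 - x\<^sup>2)) = bump h k p x"
        by (auto simp: bump_def abs_less_iff)
    qed (use 1 in auto)
  next
    case 2
    have "open {x::real. h < \<bar>x\<bar>}" by (intro open_Collect_less continuous_intros)
    then have "(bump h k p has_real_derivative 0) (at x)"
      using 2 by (intro has_field_derivative_transform_within_open[OF DERIV_const, of "{x. h < \<bar>x\<bar>}"])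
        (auto simp: bump_def)
    then show ?thesis using 2 by (simp add: bump_def)
  next
    case 3
    obtain C where C: "\<And>x. \<bar>bump h k p x\<bar> \<le> C * (h\<^sup>2 - x\<^sup>2)\<^sup>2"
      using bump_quadratic[OF assms] by blast
    have h2: "h\<^sup>2 = x\<^sup>2" using 3 by (metis power2_abs)
    have "((\<lambda>y. (bump h k p y - bump h k p x) / (y - x)) \<longlongrightarrow> 0) (at x)"
    proof (rule Lim_null_comparison)
      \<comment> \<open>As h^2 = x^2, the quadratic bound is C (y - x)^2 (x + y)^2, and one factor
        |y - x| survives the division.\<close>
      show "\<forall>\<^sub>F y in at x. norm ((bump h k p y - bump h k p x) / (y - x)) \<le> C * (\<bar>y - x\<bar> * (x + y)\<^sup>2)"
        unfolding eventually_at_filter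
      proof (intro always_eventually allI impI)
        fix y assume "y \<noteq> x"
        have "\<bar>bump h k p y\<bar> \<le> C * ((y - x)\<^sup>2 * (x + y)\<^sup>2)"
          using C[of y] unfolding h2 by (simp add: power2_eq_square algebra_simps)
        then show "norm ((bump h k p y - bump h k p x) / (y - x)) \<le> C * (\<bar>y - x\<bar> * (x + y)\<^sup>2)"
          using \<open>y \<noteq> x\<close> 3 by (simp add: bump_def field_simps power2_eq_square abs_mult)
      qed
      show "((\<lambda>y. C * (\<bar>y - x\<bar> * (x + y)\<^sup>2)) \<longlongrightarrow> 0) (at x)"
        by (auto intro!: tendsto_eq_intros)
    qed
    then show ?thesis using 3 by (simp add: has_field_derivative_iff bump_def)
  qed
qed

definition smooth_fun :: "(real \<Rightarrow> real) \<Rightarrow> bool" where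
  "smooth_fun f \<longleftrightarrow> (\<forall>n x. (deriv ^^ n) f field_differentiable at x)"

lemma smooth_fun_deriv: "smooth_fun f \<Longrightarrow> smooth_fun (deriv f)"
  unfolding smooth_fun_def
proof (intro allI)
  fix n x assume "\<forall>n x. (deriv ^^ n) f field_differentiable at x"
  then have "(deriv ^^ Suc n) f field_differentiable at x" by blast
  then show "(deriv ^^ n) (deriv f) field_differentiable at x"
    by (simp only: funpow_Suc_right o_apply)
qed

lemma smooth_fun_antiderivative:
  assumes "\<And>x. (f has_real_derivative g x) (at x)" "smooth_fun g"
  shows "smooth_fun f"
proof -
  have "deriv f = g" using assms(1) by (intro ext DERIV_imp_deriv)
  have "(deriv ^^ n) f field_differentiable at x" for n x
  proof (cases n)
    case 0
    then show ?thesis using assms(1) by (auto simp: field_differentiable_def)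
  next
    case (Suc j)
    have "(deriv ^^ Suc j) f = (deriv ^^ j) (deriv f)" by (simp only: funpow_Suc_right o_apply)
    with Suc \<open>deriv f = g\<close> assms(2) show ?thesis by (simp only: smooth_fun_def)
  qed
  then show ?thesis by (simp add: smooth_fun_def)
qed

lemma smooth_fun_differentiable: "smooth_fun f \<Longrightarrow> f field_differentiable at x"
  unfolding smooth_fun_def by (drule spec[of _ 0]) simp

lemma smooth_fun_has_derivative:
  "smooth_fun f \<Longrightarrow> (f has_real_derivative deriv f x) (at x)"
  using smooth_fun_differentiable field_differentiable_derivI by blast

lemma smooth_fun_continuous_on: "smooth_fun f \<Longrightarrow> continuous_on A f"
  by (intro continuous_at_imp_continuous_on ballI DERIV_isCont[OF smooth_fun_has_derivative])

text \<open>A difference of two translates, so that its primitive can be compactly supported.\<close>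

definition bump_diff :: "real \<Rightarrow> nat \<Rightarrow> real poly \<Rightarrow> real \<Rightarrow> real \<Rightarrow> real \<Rightarrow> real" where
  "bump_diff h k p a b x = bump h k p (x - a) - bump h k p (x - b)"

lemma has_derivative_bump_diff:
  assumes "h > 0"
  shows "(bump_diff h k p a b has_real_derivative
           bump_diff h (k + 2) (bump_step h k p) a b x) (at x)"
  unfolding bump_diff_def
proof -
  have "((\<lambda>x. bump h k p (x - y)) has_real_derivative bump h (k + 2) (bump_step h k p) (x - y)) (at x)" for y
    using DERIV_chain2[OF has_derivative_bump[OF assms], where g="\<lambda>x. x - y" and Db=1 and x=x]
    by (simp add: DERIV_diff[OF DERIV_ident DERIV_const, simplified])
  then show "((\<lambda>x. bump h k p (x - a) - bump h k p (x - b)) has_real_derivative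
      bump h (k + 2) (bump_step h k p) (x - a) - bump h (k + 2) (bump_step h k p) (x - b)) (at x)"
    by (intro DERIV_diff)
qed

lemma smooth_fun_bump_diff:
  assumes "h > 0"
  shows "smooth_fun (bump_diff h k p a b)"
proof -
  have "\<exists>k' p'. (deriv ^^ n) (bump_diff h k p a b) = bump_diff h k' p' a b" for n
  proof (induction n)
    case (Suc n)
    then obtain k' p' where "(deriv ^^ n) (bump_diff h k p a b) = bump_diff h k' p' a b" by blast
    then have "(deriv ^^ Suc n) (bump_diff h k p a b) = deriv (bump_diff h k' p' a b)" by simp
    also have "\<dots> = bump_diff h (k' + 2) (bump_step h k' p') a b"
      by (intro ext DERIV_imp_deriv has_derivative_bump_diff assms)
    finally show ?case by blast
  qed (simp only: funpow_0, blast)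
  then have "(deriv ^^ n) (bump_diff h k p a b) field_differentiable at x" for n x
    using has_derivative_bump_diff[OF assms] unfolding field_differentiable_def by metis
  then show ?thesis by (simp add: smooth_fun_def)
qed

section \<open>Averages against bumps and the recovery of a primitive\<close>

lemma integral_zero_extend:
  fixes f :: "real \<Rightarrow> real"
  assumes "continuous_on {c..d} f" "{a..b} \<subseteq> {c..d}" "\<And>x. x \<notin> {a..b} \<Longrightarrow> f x = 0"
  shows "integral {c..d} f = integral {a..b} f"
proof -
  have "(f has_integral integral {a..b} f) {a..b}"
    using assms by (intro integrable_integral integrable_continuous_interval continuous_on_subset[OF assms(1)])
  then have "(f has_integral integral {a..b} f) {c..d}"
    by (rule has_integral_on_superset) (use assms in auto)
  then show ?thesis by (rule integral_unique)
qed

lemma bump_one: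
  assumes "h > 0"
  shows "bump h 0 1 x \<ge> 0" "\<bar>x\<bar> \<ge> h \<Longrightarrow> bump h 0 1 x = 0" "\<bar>x\<bar> < h \<Longrightarrow> bump h 0 1 x > 0"
    "continuous_on A (bump h 0 1)"
proof -
  show "continuous_on A (bump h 0 1)"
    using has_derivative_bump[OF assms] by (meson DERIV_isCont continuous_at_imp_continuous_on)
qed (simp_all add: bump_def)

text \<open>Only the oscillation of \<open>k\<close> on the support of the bump enters. After
  division by its mass, the bump acts as an approximate identity at \<open>p\<close>.\<close>

lemma bump_mean_value:
  fixes k :: "real \<Rightarrow> real"
  assumes h: "h > 0" and k: "continuous_on {c..d} k" and sub: "{p - h..p + h} \<subseteq> {c..d}"
    and e: "\<And>x. x \<in> {p - h..p + h} \<Longrightarrow> \<bar>k x - k p\<bar> \<le> e"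
  shows "\<bar>integral {c..d} (\<lambda>x. bump h 0 1 (x - p) * k x) - k p * integral {-h..h} (bump h 0 1)\<bar>
           \<le> e * integral {-h..h} (bump h 0 1)"
proof -
  let ?b = "\<lambda>x. bump h 0 1 (x - p)"
  let ?I = "{p - h..p + h}"
  have cb: "continuous_on A ?b" for A
    using bump_one(4)[OF h, of UNIV] by (rule continuous_on_compose2) (auto intro!: continuous_intros)
  have kI: "continuous_on ?I k" using k sub continuous_on_subset by blast
  have "integral {c..d} (\<lambda>x. ?b x * k x) = integral ?I (\<lambda>x. ?b x * k x)"
    using bump_one(2)[OF h] sub by (intro integral_zero_extend continuous_intros cb k) (auto simp: abs_if)
  moreover have Z: "integral {-h..h} (bump h 0 1) = integral ?I ?b"
    using integral_shift_real_ivl[of "-h" "-p" h "bump h 0 1"] by (simp add: algebra_simps)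
  ultimately have "integral {c..d} (\<lambda>x. ?b x * k x) - k p * integral {-h..h} (bump h 0 1)
      = integral ?I (\<lambda>x. ?b x * k x - k p * ?b x)"
    by (subst integral_diff) (auto intro!: integrable_continuous_interval continuous_intros cb kI)
  also have "\<bar>\<dots>\<bar> \<le> integral ?I (\<lambda>x. e * ?b x)"
    unfolding real_norm_def[symmetric]
  proof (rule integral_norm_bound_integral)
    fix x assume "x \<in> ?I"
    then have "\<bar>k x - k p\<bar> * ?b x \<le> e * ?b x"
      using e bump_one(1)[OF h] by (intro mult_right_mono) auto
    moreover have "norm (?b x * k x - k p * ?b x) = \<bar>(k x - k p) * ?b x\<bar>"
      by (simp add: algebra_simps)
    ultimately show "norm (?b x * k x - k p * ?b x) \<le> e * ?b x"
      using bump_one(1)[OF h, of "x - p"] by (simp add: abs_mult)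
  qed (auto intro!: integrable_continuous_interval continuous_intros cb kI)
  also have "\<dots> = e * integral {-h..h} (bump h 0 1)" by (simp add: Z)
  finally show ?thesis .
qed

lemma bump_integral_pos:
  assumes "h > 0" shows "integral {-h..h} (bump h 0 1) > 0"
proof -
  have "integral {-h..h} (bump h 0 1) \<noteq> 0"
  proof
    assume "integral {-h..h} (bump h 0 1) = 0"
    then have "(bump h 0 1 has_integral 0) (cbox (-h) h)"
      using integrable_integral[OF integrable_continuous_interval[OF bump_one(4)[OF assms]]]
      by (metis box_real(2))
    then have "bump h 0 1 0 = 0"
      by (intro has_integral_0_cbox_imp_0[OF bump_one(4)[OF assms] bump_one(1)[OF assms]])
        (use assms in auto)
    then show False using bump_one(3)[OF assms, of 0] assms by simp
  qed
  moreover have "integral {-h..h} (bump h 0 1) \<ge> 0"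
    using bump_one(1)[OF assms] by (intro integral_nonneg integrable_continuous_interval bump_one(4) assms) auto
  ultimately show ?thesis by linarith
qed

text \<open>With a primitive \<open>G\<close> of \<open>g\<close>, integration by parts turns the
  hypothesis into the vanishing of the integral of \<psi>' (f - G). Taking for \<psi>' a narrow bump
  at \<open>p\<close> minus the same bump at \<open>r\<close> shows that f - G has equal values at
  both points.\<close>

lemma du_bois_reymond:
  fixes f g :: "real \<Rightarrow> real"
  assumes f: "continuous_on {a<..<b} f" and g: "continuous_on {a<..<b} g"
    and weak: "\<And>\<psi> c d. \<lbrakk>smooth_fun \<psi>; a < c; c < d; d < b; \<And>x. x \<notin> {c..d} \<Longrightarrow> \<psi> x = 0\<rbrakk>
      \<Longrightarrow> integral {c..d} (\<lambda>x. deriv \<psi> x * f x + \<psi> x * g x) = 0"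
    and pr: "a < p" "p \<le> r" "r < b"
  shows "f r - f p = integral {p..r} g"
proof -
  define l where "l = (a + p) / 2"
  define l' where "l' = (r + b) / 2"
  have l: "a < l" "l < p" "r < l'" "l' < b" using pr by (auto simp: l_def l'_def)
  have gl: "continuous_on {l..l'} g" and fl: "continuous_on {l..l'} f"
    using f g l by (auto intro: continuous_on_subset)
  define G where "G x = integral {l..x} g" for x
  have G: "(G has_real_derivative g x) (at x within {l..l'})" if "x \<in> {l..l'}" for x
    unfolding G_def using integral_has_real_derivative[OF gl that] .
  have Gc: "continuous_on {l..l'} G"
    using G by (rule DERIV_continuous_on)
  define k where "k x = f x - G x" for x
  have kc: "continuous_on {l..l'} k" unfolding k_def by (intro continuous_intros fl Gc)
  have "\<bar>k p - k r\<bar> \<le> 2 * e" if "e > 0" for e :: real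
  proof -
    have "\<exists>d>0. \<forall>x\<in>{l..l'}. dist x y < d \<longrightarrow> dist (k x) (k y) < e" if "y \<in> {l..l'}" for y
      using kc[unfolded continuous_on_iff, rule_format, OF that \<open>e > 0\<close>] by blast
    note this[of p] this[of r]
    then obtain d1 d2 where d: "d1 > 0" "\<And>x. x \<in> {l..l'} \<Longrightarrow> dist x p < d1 \<Longrightarrow> dist (k x) (k p) < e"
      "d2 > 0" "\<And>x. x \<in> {l..l'} \<Longrightarrow> dist x r < d2 \<Longrightarrow> dist (k x) (k r) < e"
      using l pr by auto
    \<comment> \<open>The bumps must stay inside \<open>{l..l'}\<close> and see an oscillation of
      \<open>k\<close> of at most \<open>e\<close>.\<close>
    define h where "h = Min {d1 / 2, d2 / 2, p - l, l' - r}"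
    have h: "h > 0" "h < d1" "h < d2" "l \<le> p - h" "r + h \<le> l'"
      using d l unfolding h_def by (auto simp: min_def)
    define \<psi>' where "\<psi>' = bump_diff h 0 1 p r"
    have \<psi>'c: "continuous_on A \<psi>'" for A
      unfolding \<psi>'_def using smooth_fun_continuous_on smooth_fun_bump_diff[OF h(1)] by blast
    have \<psi>'0: "\<psi>' x = 0" if "x \<notin> {p - h..r + h}" for x
      using that pr bump_one(2)[OF h(1), of "x - p"] bump_one(2)[OF h(1), of "x - r"]
      by (auto simp: \<psi>'_def bump_diff_def)
    define Z where "Z = integral {-h..h} (bump h 0 1)"
    have Z: "Z > 0" unfolding Z_def by (rule bump_integral_pos[OF h(1)])
    have bc: "continuous_on A (\<lambda>x. bump h 0 1 (x - y))" for A y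
      using bump_one(4)[OF h(1), of UNIV] by (rule continuous_on_compose2) (auto intro!: continuous_intros)
    have mv: "\<bar>integral {l..l'} (\<lambda>x. bump h 0 1 (x - y) * j x) - j y * Z\<bar> \<le> E * Z"
      if "y = p \<or> y = r" "continuous_on {l..l'} j" "\<And>x. x \<in> {y - h..y + h} \<Longrightarrow> \<bar>j x - j y\<bar> \<le> E" for y j E
      unfolding Z_def using that h l pr by (intro bump_mean_value) auto
    have I1: "integral {l..l'} (\<lambda>x. bump h 0 1 (x - y)) = Z" if "y = p \<or> y = r" for y
      using mv[OF that, of "\<lambda>_. 1" 0] by auto
    \<comment> \<open>The lower limit lies strictly to the left of the support. The region where the
      fundamental theorem applies and the one where \<psi> is locally zero then overlap and cover
      the line.\<close>
    define \<psi> where "\<psi> x = integral {l - 1..x} \<psi>'" for x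
    have \<psi>d: "(\<psi> has_real_derivative \<psi>' x) (at x)" if "x > l - 1" for x
    proof -
      have "(\<psi> has_real_derivative \<psi>' x) (at x within {l - 1..x + 1})"
        unfolding \<psi>_def using that by (intro integral_has_real_derivative \<psi>'c) auto
      then show ?thesis using that by (metis at_within_Icc_at less_add_one)
    qed
    have \<psi>0: "\<psi> x = 0" if "x < p - h" for x
      unfolding \<psi>_def using that by (intro integral_unique has_integral_is_0) (auto intro!: \<psi>'0)
    \<comment> \<open>Beyond the support \<psi> is the total integral of the difference of two bumps
      of equal mass \<open>Z\<close>.\<close>
    have \<psi>1: "\<psi> x = 0" if "x > r + h" for x
    proof -
      have "\<psi> x = integral {p - h..r + h} \<psi>'"
        unfolding \<psi>_def using that h pr l by (intro integral_zero_extend \<psi>'c) (auto intro!: \<psi>'0)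
      also have "\<dots> = integral {l..l'} \<psi>'"
        using that h pr l by (intro integral_zero_extend[symmetric] \<psi>'c) (auto intro!: \<psi>'0)
      also have "\<dots> = 0"
        unfolding \<psi>'_def bump_diff_def
        by (subst integral_diff) (auto intro!: integrable_continuous_interval bc simp: I1)
      finally show ?thesis .
    qed
    have \<psi>D: "(\<psi> has_real_derivative \<psi>' x) (at x)" for x
    proof (cases "x > l - 1")
      case False
      have "(\<psi> has_real_derivative 0) (at x)"
        using False h
        by (intro has_field_derivative_transform_within_open[OF DERIV_const, of "{..<p - h}"]) (auto simp: \<psi>0)
      then show ?thesis using False h \<psi>'0[of x] by auto
    qed (rule \<psi>d)
    have sm: "smooth_fun \<psi>"
      by (rule smooth_fun_antiderivative[OF \<psi>D]) (simp add: \<psi>'_def smooth_fun_bump_diff h)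
    have der: "deriv \<psi> = \<psi>'" using \<psi>D by (intro ext DERIV_imp_deriv)
    have \<psi>c: "continuous_on A \<psi>" for A by (rule smooth_fun_continuous_on[OF sm])
    have 1: "integral {l..l'} (\<lambda>x. \<psi>' x * f x + \<psi> x * g x) = 0"
    proof -
      have "\<psi> x = 0" if "x \<notin> {l..l'}" for x
        using that h \<psi>0[of x] \<psi>1[of x] by (cases "x < l") auto
      then show ?thesis using weak[OF sm, of l l'] l pr der by simp
    qed
    \<comment> \<open>The choice of \<open>h\<close> allows \<open>p - h = l\<close> and
      \<open>r + h = l'\<close>, so the zeros at the end points come from continuity.\<close>
    have \<psi>ll: "\<psi> l = 0" "\<psi> l' = 0"
    proof -
      have *: "\<psi> \<midarrow>y\<rightarrow> \<psi> y" for y using \<psi>D DERIV_isCont isContD by blast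
      have "\<psi> (p - h) = 0"
      proof (rule tendsto_unique[of "at_left (p - h)"])
        show "(\<psi> \<longlongrightarrow> \<psi> (p - h)) (at_left (p - h))" using *[of "p - h"] by (rule tendsto_within_subset) auto
        show "(\<psi> \<longlongrightarrow> 0) (at_left (p - h))"
          by (rule tendsto_eventually) (auto simp: eventually_at_filter \<psi>0)
      qed simp
      moreover have "\<psi> (r + h) = 0"
      proof (rule tendsto_unique[of "at_right (r + h)"])
        show "(\<psi> \<longlongrightarrow> \<psi> (r + h)) (at_right (r + h))" using *[of "r + h"] by (rule tendsto_within_subset) auto
        show "(\<psi> \<longlongrightarrow> 0) (at_right (r + h))"
          by (rule tendsto_eventually) (auto simp: eventually_at_filter \<psi>1)
      qed simp
      ultimately show "\<psi> l = 0" "\<psi> l' = 0"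
        using \<psi>0[of l] \<psi>1[of l'] h(4,5) by (cases "l = p - h"; cases "l' = r + h"; simp)+
    qed
    have "((\<lambda>x. \<psi>' x * G x + \<psi> x * g x) has_integral (\<psi> l' * G l' - \<psi> l * G l)) {l..l'}"
    proof (rule fundamental_theorem_of_calculus)
      fix x assume x: "x \<in> {l..l'}"
      show "((\<lambda>x. \<psi> x * G x) has_vector_derivative \<psi>' x * G x + \<psi> x * g x) (at x within {l..l'})"
        using DERIV_mult[OF has_field_derivative_at_within[OF \<psi>D] G[OF x]]
        by (simp add: has_real_derivative_iff_has_vector_derivative algebra_simps)
    qed (use l pr in auto)
    then have 2: "integral {l..l'} (\<lambda>x. \<psi>' x * G x + \<psi> x * g x) = 0"
      using \<psi>ll by (simp add: integral_unique)
    have "integral {l..l'} (\<lambda>x. (\<psi>' x * f x + \<psi> x * g x) - (\<psi>' x * G x + \<psi> x * g x)) = 0"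
      using 1 2 by (subst integral_diff)
        (auto intro!: integrable_continuous_interval continuous_intros \<psi>c \<psi>'c fl Gc gl)
    also have "(\<lambda>x. (\<psi>' x * f x + \<psi> x * g x) - (\<psi>' x * G x + \<psi> x * g x))
        = (\<lambda>x. bump h 0 1 (x - p) * k x - bump h 0 1 (x - r) * k x)"
      by (auto simp: k_def \<psi>'_def bump_diff_def algebra_simps)
    also have "integral {l..l'} \<dots> = integral {l..l'} (\<lambda>x. bump h 0 1 (x - p) * k x)
        - integral {l..l'} (\<lambda>x. bump h 0 1 (x - r) * k x)"
      by (subst integral_diff) (auto intro!: integrable_continuous_interval continuous_intros bc kc)
    finally have 3: "integral {l..l'} (\<lambda>x. bump h 0 1 (x - p) * k x)
        = integral {l..l'} (\<lambda>x. bump h 0 1 (x - r) * k x)" by simp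
    have "\<bar>k x - k p\<bar> \<le> e" if "x \<in> {p - h..p + h}" for x
      using d(2)[of x] that h l pr by (auto simp: dist_real_def abs_le_iff abs_less_iff)
    note m1 = mv[of p k e, OF _ kc this]
    have "\<bar>k x - k r\<bar> \<le> e" if "x \<in> {r - h..r + h}" for x
      using d(4)[of x] that h l pr by (auto simp: dist_real_def abs_le_iff abs_less_iff)
    note m2 = mv[of r k e, OF _ kc this]
    have "\<bar>(k p - k r) * Z\<bar> \<le> (2 * e) * Z"
      using m1 m2 3 by (simp add: algebra_simps abs_le_iff)
    then show ?thesis using Z by (simp add: abs_mult)
  qed
  from this[of "\<bar>k p - k r\<bar> / 4"] have "k p = k r" by (cases "k p = k r") auto
  then have "f r - f p = G r - G p" by (simp add: k_def)
  also have "\<dots> = integral {p..r} g"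
    unfolding G_def using Henstock_Kurzweil_Integration.integral_combine[of l p r g] l pr gl
    by (simp add: integrable_continuous_interval continuous_on_subset[OF gl])
  finally show ?thesis .
qed


section \<open>The weak continuity equation\<close>

lemma d_time_mult_left: "a field_differentiable at t \<Longrightarrow> d_time (\<lambda>t x. a t * b x) t x = deriv a t * b x"
  unfolding d_time_def
  by (intro DERIV_imp_deriv DERIV_cmult_right) (simp add: field_differentiable_derivI)

lemma d_space_mult_right: "b field_differentiable at x \<Longrightarrow> d_space (\<lambda>t x. a t * b x) t x = a t * deriv b x"
  unfolding d_space_def
  by (intro DERIV_imp_deriv DERIV_cmult) (simp add: field_differentiable_derivI)

lemma continuous_on_snd_fun:
  assumes "\<And>A. continuous_on A (b :: real \<Rightarrow> real)"
  shows "continuous_on S (\<lambda>z::real \<times> real. b (snd z))" "continuous_on S (\<lambda>z::real \<times> real. b (fst z))"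
  by (rule continuous_on_compose2[OF assms[of UNIV] continuous_on_snd[OF continuous_on_id]], simp)
    (rule continuous_on_compose2[OF assms[of UNIV] continuous_on_fst[OF continuous_on_id]], simp)

lemma continuous_on_smooth_product:
  assumes "smooth_fun a" "smooth_fun b"
  shows "continuous_on S (\<lambda>(t, x). a t * b x)"
proof -
  have ac: "continuous_on A a" and bc: "continuous_on A b" for A
    by (intro smooth_fun_continuous_on assms)+
  show ?thesis
    unfolding split_beta' by (intro continuous_on_mult continuous_on_snd_fun ac bc)
qed

lemma Ck_on_product:
  assumes "smooth_fun a" "smooth_fun b"
  shows "Ck_on n UNIV (\<lambda>t x. a t * b x)"
  using assms
proof (induction n arbitrary: a b)
  case 0
  then show ?case
    by (simp add: continuous_on_smooth_product)
next
  case (Suc n)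
  note d = smooth_fun_differentiable[OF Suc.prems(1)] smooth_fun_differentiable[OF Suc.prems(2)]
  have "d_time (\<lambda>t x. a t * b x) = (\<lambda>t x. deriv a t * b x)"
    "d_space (\<lambda>t x. a t * b x) = (\<lambda>t x. a t * deriv b x)"
    by (auto intro!: ext d_time_mult_left d_space_mult_right d)
  moreover have "continuous_on UNIV (\<lambda>(t, x). a t * b x)"
    using Suc.prems by (rule continuous_on_smooth_product)
  moreover have "(\<lambda>s. a s * b x) field_differentiable at t" "(\<lambda>x. a t * b x) field_differentiable at x" for t x
    by (intro field_differentiable_mult field_differentiable_const d)+
  ultimately show ?case using Suc by (simp add: smooth_fun_deriv)
qed

lemma test_function_product:
  assumes "smooth_fun a" "smooth_fun b" "0 < c" "d < T"
    "\<And>t. t \<notin> {c..d} \<Longrightarrow> a t = 0" "\<And>x. x \<notin> {p..q} \<Longrightarrow> b x = 0"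
  shows "test_function ({0<..<T} \<times> UNIV) (\<lambda>t x. a t * b x)"
  unfolding test_function_def smooth_on2_def
proof (intro conjI allI exI[of _ "{c..d} \<times> {p..q}"])
  show "\<forall>(t, x)\<in>- ({c..d} \<times> {p..q}). a t * b x = 0"
    using assms(5,6) by (clarsimp, metis atLeastAtMost_iff)
qed (use assms in \<open>auto intro: Ck_on_product compact_Times\<close>)

lemma lborel_integral_box:
  fixes f :: "real \<times> real \<Rightarrow> real"
  assumes f: "continuous_on (cbox (c, p) (d, q)) f" and z: "\<And>z. z \<notin> cbox (c, p) (d, q) \<Longrightarrow> f z = 0"
  shows "(\<integral>z. f z \<partial>lborel) = integral {c..d} (\<lambda>t. integral {p..q} (\<lambda>x. f (t, x)))"
proof -
  have i: "set_integrable lborel (cbox (c, p) (d, q)) f"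
    unfolding set_integrable_def by (intro borel_integrable_compact f compact_cbox)
  have "(\<integral>z. f z \<partial>lborel) = (LINT z:cbox (c, p) (d, q)|lborel. f z)"
    unfolding set_lebesgue_integral_def using z by (intro Bochner_Integration.integral_cong) (auto simp: indicator_def)
  also have "\<dots> = integral (cbox (c, p) (d, q)) f" by (rule set_borel_integral_eq_integral(2)[OF i])
  also have "\<dots> = integral {c..d} (\<lambda>t. integral {p..q} (\<lambda>x. f (t, x)))"
    using integral_prod_continuous[OF f] by simp
  finally show ?thesis .
qed

lemma deriv_zero_outside:
  assumes "\<And>x::real. x \<notin> {c..d} \<Longrightarrow> a x = 0" "x \<notin> {c..d}"
  shows "deriv a x = (0::real)"
proof (rule DERIV_imp_deriv)
  show "(a has_real_derivative 0) (at x)"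
    using assms by (intro has_field_derivative_transform_within_open[OF DERIV_const, of "- {c..d}"]) auto
qed

lemma continuous_on_slices:
  fixes f :: "real \<Rightarrow> real \<Rightarrow> real"
  assumes "continuous_on (I \<times> J) (\<lambda>(t, x). f t x)"
  shows "t \<in> I \<Longrightarrow> continuous_on J (f t)" "x \<in> J \<Longrightarrow> continuous_on I (\<lambda>t. f t x)"
proof -
  have c: "continuous_on J (\<lambda>x. (t, x))" "continuous_on I (\<lambda>t. (t, x))" for t x
    by (intro continuous_intros)+
  show "t \<in> I \<Longrightarrow> continuous_on J (f t)"
    using continuous_on_compose2[OF assms c(1), of t] by (simp add: image_subset_iff)
  show "x \<in> J \<Longrightarrow> continuous_on I (\<lambda>t. f t x)"
    using continuous_on_compose2[OF assms c(2), of x] by (simp add: image_subset_iff)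
qed

text \<open>Product test functions reduce the claim to two uses of du Bois-Reymond in one variable.
  In time, with \<open>b\<close> fixed, the averages of \<open>m\<close> against \<open>b\<close>
  get the weak flux as derivative. In space, the flux integrated over time becomes a primitive of
  the increment of \<open>m\<close>.\<close>

lemma continuity_equation_rectangle:
  fixes m w :: "real \<Rightarrow> real \<Rightarrow> real"
  assumes m: "continuous_on ({0<..<T} \<times> UNIV) (\<lambda>(t, x). m t x)"
    and w: "continuous_on ({0<..<T} \<times> UNIV) (\<lambda>(t, x). w t x)"
    and weak: "\<And>\<psi>. test_function ({0<..<T} \<times> UNIV) \<psi> \<Longrightarrow>
        (\<integral>(t, x). m t x * d_time \<psi> t x - w t x * d_space \<psi> t x \<partial>lborel) = 0"
    and t: "0 < t0" "t0 \<le> t1" "t1 < T" and yz: "y \<le> z"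
  shows "integral {y..z} (\<lambda>x. m t1 x - m t0 x) = integral {t0..t1} (\<lambda>t. w t z - w t y)"
proof -
  let ?S = "{0<..<T} \<times> (UNIV :: real set)"
  have mS: "continuous_on A (\<lambda>z. m (fst z) (snd z))" and wS: "continuous_on A (\<lambda>z. w (fst z) (snd z))"
    if "A \<subseteq> ?S" for A
    using m w that by (auto simp: split_beta' intro: continuous_on_subset)
  have tested: "integral {c..d} (\<lambda>t. integral {p..q} (\<lambda>x. m t x * (deriv a t * b x) - w t x * (a t * deriv b x))) = 0"
    if a: "smooth_fun a" "0 < c" "d < T" "\<And>t. t \<notin> {c..d} \<Longrightarrow> a t = 0"
      and b: "smooth_fun b" "\<And>x. x \<notin> {p..q} \<Longrightarrow> b x = 0" for a b c d p q
  proof -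
    let ?f = "\<lambda>z. m (fst z) (snd z) * (deriv a (fst z) * b (snd z)) - w (fst z) (snd z) * (a (fst z) * deriv b (snd z))"
    have "(\<integral>(t, x). m t x * d_time (\<lambda>t x. a t * b x) t x - w t x * d_space (\<lambda>t x. a t * b x) t x \<partial>lborel) = 0"
      by (rule weak[OF test_function_product[OF a(1) b(1) a(2-4) b(2)]])
    then have "(\<integral>z. ?f z \<partial>lborel) = 0"
      by (simp add: split_beta' d_time_mult_left d_space_mult_right smooth_fun_differentiable a(1) b(1))
    moreover have "continuous_on (cbox (c, p) (d, q)) ?f"
    proof -
      have ac: "continuous_on A a" "continuous_on A (deriv a)"
        and bc: "continuous_on A b" "continuous_on A (deriv b)" for A
        by (intro smooth_fun_continuous_on smooth_fun_deriv a b)+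
      show ?thesis
        using a(2,3) by (intro continuous_intros mS wS continuous_on_snd_fun ac bc) (auto simp: cbox_Pair_eq)
    qed
    moreover have "?f z = 0" if "z \<notin> cbox (c, p) (d, q)" for z
      using that a(4) b(2) deriv_zero_outside[of c d a, OF a(4)] deriv_zero_outside[of p q b, OF b(2)]
      by (cases z) (auto simp: cbox_Pair_eq)
    ultimately show ?thesis using lborel_integral_box[of c p d q ?f] by simp
  qed
  have 1: "integral {p..q} (\<lambda>x. m t1 x * b x) - integral {p..q} (\<lambda>x. m t0 x * b x)
      = integral {t0..t1} (\<lambda>t. - integral {p..q} (\<lambda>x. w t x * deriv b x))"
    if b: "smooth_fun b" "\<And>x. x \<notin> {p..q} \<Longrightarrow> b x = 0" for b p q
  proof -
    have bc: "continuous_on A b" "continuous_on A (deriv b)" for A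
      by (intro smooth_fun_continuous_on smooth_fun_deriv b)+
    show ?thesis
    proof (rule du_bois_reymond[where a=0 and b=T])
      show f: "continuous_on {0<..<T} (\<lambda>t. integral {p..q} (\<lambda>x. m t x * b x))"
      proof -
        have "continuous_on ({0<..<T} \<times> cbox p q) (\<lambda>(t, x). m t x * b x)"
          unfolding split_beta' by (intro continuous_intros mS continuous_on_snd_fun bc) auto
        from integral_continuous_on_param[OF this] show ?thesis by simp
      qed
      show g: "continuous_on {0<..<T} (\<lambda>t. - integral {p..q} (\<lambda>x. w t x * deriv b x))"
      proof -
        have "continuous_on ({0<..<T} \<times> cbox p q) (\<lambda>(t, x). w t x * deriv b x)"
          unfolding split_beta' by (intro continuous_intros wS continuous_on_snd_fun bc) auto
        from continuous_on_minus[OF integral_continuous_on_param[OF this]] show ?thesis by simp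
      qed
      fix a c d assume a: "smooth_fun a" "0 < c" "c < d" "d < T" "\<And>t. t \<notin> {c..d} \<Longrightarrow> a t = 0"
      have "integral {c..d} (\<lambda>t. deriv a t * integral {p..q} (\<lambda>x. m t x * b x)
              + a t * - integral {p..q} (\<lambda>x. w t x * deriv b x))
          = integral {c..d} (\<lambda>t. integral {p..q} (\<lambda>x. m t x * (deriv a t * b x) - w t x * (a t * deriv b x)))"
      proof (rule integral_cong)
        fix t assume t: "t \<in> {c..d}"
        then have T: "t \<in> {0<..<T}" using a by auto
        have i: "(\<lambda>x. m t x * b x) integrable_on {p..q}" "(\<lambda>x. w t x * deriv b x) integrable_on {p..q}"
          using continuous_on_slices(1)[OF m T] continuous_on_slices(1)[OF w T]
          by (auto intro!: integrable_continuous_interval continuous_intros bc intro: continuous_on_subset)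
        have "integral {p..q} (\<lambda>x. m t x * (deriv a t * b x) - w t x * (a t * deriv b x))
            = integral {p..q} (\<lambda>x. deriv a t * (m t x * b x) - a t * (w t x * deriv b x))"
          by (simp add: algebra_simps)
        also have "\<dots> = integral {p..q} (\<lambda>x. deriv a t * (m t x * b x)) - integral {p..q} (\<lambda>x. a t * (w t x * deriv b x))"
          by (intro Henstock_Kurzweil_Integration.integral_diff integrable_on_mult_right i)
        finally show "deriv a t * integral {p..q} (\<lambda>x. m t x * b x) + a t * - integral {p..q} (\<lambda>x. w t x * deriv b x)
            = integral {p..q} (\<lambda>x. m t x * (deriv a t * b x) - w t x * (a t * deriv b x))"
          by simp
      qed
      also have "\<dots> = 0" by (rule tested[OF a(1,2,4,5) b])
      finally show "integral {c..d} (\<lambda>t. deriv a t * integral {p..q} (\<lambda>x. m t x * b x)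
              + a t * - integral {p..q} (\<lambda>x. w t x * deriv b x)) = 0" .
    qed (use t in auto)
  qed
  have t01: "{t0..t1} \<subseteq> {0<..<T}" using t by auto
  have wc: "continuous_on A (\<lambda>z. w (snd z) (fst z))" if "A \<subseteq> UNIV \<times> {t0..t1}" for A
  proof -
    have "continuous_on A (\<lambda>z. (snd z, fst z))" by (intro continuous_intros)
    moreover have "(\<lambda>z. (snd z, fst z)) ` A \<subseteq> ?S" using that t01 by auto
    ultimately have "continuous_on A (\<lambda>z. w (fst (snd z, fst z)) (snd (snd z, fst z)))"
      by (intro continuous_on_compose2[OF wS[of ?S]]) auto
    then show ?thesis by simp
  qed
  define f where "f x = integral {t0..t1} (\<lambda>t. w t x)" for x
  define g where "g x = m t1 x - m t0 x" for x
  have fc: "continuous_on A f" for A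
  proof -
    have "continuous_on (A \<times> cbox t0 t1) (\<lambda>(x, t). w t x)"
      unfolding split_beta' by (rule wc) auto
    from integral_continuous_on_param[OF this] show ?thesis by (simp add: f_def[abs_def])
  qed
  have mc: "continuous_on A (m t0)" "continuous_on A (m t1)" for A
    using continuous_on_slices(1)[OF m, of t0] continuous_on_slices(1)[OF m, of t1] t
    by (auto intro: continuous_on_subset)
  have gc: "continuous_on A g" for A
    unfolding g_def by (intro continuous_intros mc)
  have "f z - f y = integral {y..z} g"
  \<comment> \<open>The margins serve because du Bois-Reymond only compares points inside an open
    interval.\<close>
  proof (rule du_bois_reymond[where a="y - 1" and b="z + 1"])
    fix b p q assume b: "smooth_fun b" "p < q" "\<And>x. x \<notin> {p..q} \<Longrightarrow> b x = 0"
    have bc: "continuous_on A b" "continuous_on A (deriv b)" for A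
      by (intro smooth_fun_continuous_on smooth_fun_deriv b)+
    have "integral {p..q} (\<lambda>x. b x * g x) = integral {p..q} (\<lambda>x. m t1 x * b x) - integral {p..q} (\<lambda>x. m t0 x * b x)"
      unfolding g_def by (subst Henstock_Kurzweil_Integration.integral_diff[symmetric])
        (auto intro!: integrable_continuous_interval continuous_intros mc bc simp: algebra_simps)
    also have "\<dots> = - integral {t0..t1} (\<lambda>t. integral {p..q} (\<lambda>x. w t x * deriv b x))"
      by (subst 1[OF b(1,3)]) simp_all
    also have "integral {t0..t1} (\<lambda>t. integral {p..q} (\<lambda>x. w t x * deriv b x))
        = integral {p..q} (\<lambda>x. integral {t0..t1} (\<lambda>t. w t x * deriv b x))"
    proof -
      have "cbox (t0, p) (t1, q) \<subseteq> ?S" using t01 by (auto simp: cbox_Pair_eq)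
      then have "continuous_on (cbox (t0, p) (t1, q)) (\<lambda>(t, x). w t x * deriv b x)"
        unfolding split_beta' by (intro continuous_intros wS continuous_on_snd_fun bc)
      from integral_swap_continuous[OF this] show ?thesis by simp
    qed
    also have "\<dots> = integral {p..q} (\<lambda>x. deriv b x * f x)"
      unfolding f_def by (simp add: mult.commute)
    finally have "integral {p..q} (\<lambda>x. b x * g x) + integral {p..q} (\<lambda>x. deriv b x * f x) = 0" by simp
    then show "integral {p..q} (\<lambda>x. deriv b x * f x + b x * g x) = 0"
      by (subst Henstock_Kurzweil_Integration.integral_add)
        (auto intro!: integrable_continuous_interval continuous_intros fc gc bc)
  qed (use fc gc yz in auto)
  then show ?thesis
  proof -
    assume *: "f z - f y = integral {y..z} g"
    have "f z - f y = integral {t0..t1} (\<lambda>t. w t z - w t y)"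
      unfolding f_def using t01
      by (subst Henstock_Kurzweil_Integration.integral_diff)
        (auto intro!: integrable_continuous_interval intro: continuous_on_subset[OF continuous_on_slices(2)[OF w]])
    then show ?thesis using * by (simp add: g_def[abs_def])
  qed
qed


section \<open>Finite speed of propagation\<close>

text \<open>Continuity of one partial derivative, here the one in time, suffices for joint
  differentiability; in space only the derivative at the point in question is required. It is
  applied to \<open>u\<close> along trajectories and to distribution functions along lines.\<close>

lemma chain_rule_partials:
  fixes f ft :: "real \<Rightarrow> real \<Rightarrow> real"
  assumes ft: "\<And>t x. t \<in> I \<Longrightarrow> x \<in> J \<Longrightarrow> ((\<lambda>s. f s x) has_real_derivative ft t x) (at t)"
    and c: "continuous_on (I \<times> J) (\<lambda>(t, x). ft t x)"
    and fx: "(f t0 has_real_derivative fx) (at (\<gamma> t0))"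
    and \<gamma>: "(\<gamma> has_real_derivative g') (at t0)"
    and IJ: "open I" "open J" "convex I" "t0 \<in> I" "\<gamma> t0 \<in> J"
  shows "((\<lambda>t. f t (\<gamma> t)) has_real_derivative ft t0 (\<gamma> t0) + fx * g') (at t0)"
proof -
  have "((\<lambda>x. f t0 x) has_derivative (\<lambda>h. fx * h)) (at (\<gamma> t0) within J)"
    using fx by (simp add: has_field_derivative_def has_derivative_at_withinI)
  moreover have "((\<lambda>s. f s x) has_derivative blinfun_apply (blinfun_scaleR_left (ft t x))) (at t within I)"
    if "x \<in> J" "t \<in> I" for t x
    using has_derivative_at_withinI[OF ft[OF that(2,1), unfolded has_field_derivative_def], of I]
    by (simp add: mult.commute[of _ "ft t x"])
  moreover have "continuous (at (\<gamma> t0, t0) within J \<times> I) (\<lambda>(x, t). blinfun_scaleR_left (ft t x))"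
  proof -
    have "continuous_on (J \<times> I) (\<lambda>z. (snd z, fst z))" by (intro continuous_intros)
    then have "continuous_on (J \<times> I) (\<lambda>z. ft (snd z) (fst z))"
      using continuous_on_compose2[OF c, of "J \<times> I" "\<lambda>z. (snd z, fst z)"]
      by (simp add: split_beta' image_subset_iff)
    then have "continuous_on (J \<times> I) (\<lambda>z. blinfun_scaleR_left (ft (snd z) (fst z)))"
      by (intro continuous_intros)
    then show ?thesis using IJ by (auto simp: split_beta' continuous_on_eq_continuous_within)
  qed
  ultimately have D: "((\<lambda>(x, t). f t x) has_derivative (\<lambda>(tx, ty). fx * tx + blinfun_apply (blinfun_scaleR_left (ft t0 (\<gamma> t0))) ty))
      (at (\<gamma> t0, t0) within J \<times> I)"
    using IJ by (intro has_derivative_partialsI[where f="\<lambda>x t. f t x" and fy="\<lambda>x t. blinfun_scaleR_left (ft t x)"]) auto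
  have D: "((\<lambda>z. f (snd z) (fst z)) has_derivative (\<lambda>z. fx * fst z + snd z * ft t0 (\<gamma> t0))) (at (\<gamma> t0, t0))"
    using D IJ by (simp add: split_beta' at_within_open[OF _ open_Times])
  have "((\<lambda>t. (\<gamma> t, t)) has_derivative (\<lambda>h. (g' * h, h))) (at t0)"
    using \<gamma> by (intro has_derivative_Pair has_derivative_ident) (simp add: has_field_derivative_def)
  from has_derivative_compose[OF this, of "\<lambda>z. f (snd z) (fst z)", OF D]
  have "((\<lambda>t. f t (\<gamma> t)) has_derivative (\<lambda>h. fx * (g' * h) + h * ft t0 (\<gamma> t0))) (at t0)" by simp
  moreover have "(\<lambda>h. fx * (g' * h) + h * ft t0 (\<gamma> t0)) = (*) (ft t0 (\<gamma> t0) + fx * g')"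
    by (auto simp: algebra_simps)
  ultimately show ?thesis by (simp only: has_field_derivative_def)
qed

lemma integral_upper_derivative:
  fixes f :: "real \<Rightarrow> real"
  assumes "continuous_on {a..} f" "a < x"
  shows "((\<lambda>x. integral {a..x} f) has_real_derivative f x) (at x)"
proof -
  have "((\<lambda>x. integral {a..x} f) has_real_derivative f x) (at x within {a..x + 1})"
    using assms by (intro integral_has_real_derivative) (auto intro: continuous_on_subset)
  then show ?thesis using assms by (metis at_within_Icc_at less_add_one)
qed

text \<open>Rescaling \<open>{a..x}\<close> to the unit interval moves the variable end point into
  the integrand, so that continuity in a parameter applies.\<close>

lemma continuous_on_upper_integral:
  fixes f :: "real \<Rightarrow> real \<Rightarrow> real"
  assumes "continuous_on (S \<times> {a..}) (\<lambda>(t, x). f t x)"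
  shows "continuous_on (S \<times> {a..}) (\<lambda>(t, x). integral {a..x} (f t))"
proof -
  have eq: "integral {a..x} (f t) = integral {0..1} (\<lambda>r. (x - a) * f t (a + (x - a) * r))"
    if "t \<in> S" "a \<le> x" for t x
  proof -
    have c: "continuous_on {a..x} (f t)"
      using continuous_on_slices(1)[OF assms \<open>t \<in> S\<close>] by (rule continuous_on_subset) auto
    define G where "G y = integral {a..y} (f t)" for y
    have G: "(G has_real_derivative f t y) (at y within {a..x})" if "y \<in> {a..x}" for y
      unfolding G_def by (rule integral_has_real_derivative[OF c that])
    have r: "a + (x - a) * r \<in> {a..x}" if "r \<in> {0..1}" for r
      using that \<open>a \<le> x\<close> mult_left_le[of r "x - a"] by auto
    have "((\<lambda>r. (x - a) * f t (a + (x - a) * r)) has_integral (G (a + (x - a) * 1) - G (a + (x - a) * 0))) {0..1}"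
    proof (rule fundamental_theorem_of_calculus)
      fix s :: real assume s: "s \<in> {0..1}"
      have "(\<lambda>r. a + (x - a) * r) ` {0..1} \<subseteq> {a..x}" using r by blast
      moreover have "((\<lambda>r. a + (x - a) * r) has_real_derivative (x - a)) (at s within {0..1})"
        by (auto intro!: derivative_eq_intros)
      ultimately have "((\<lambda>r. G (a + (x - a) * r)) has_real_derivative f t (a + (x - a) * s) * (x - a)) (at s within {0..1})"
        using DERIV_subset[OF G[OF r[OF s]]] by (intro DERIV_image_chain[unfolded o_def]) auto
      then show "((\<lambda>r. G (a + (x - a) * r)) has_vector_derivative (x - a) * f t (a + (x - a) * s)) (at s within {0..1})"
        by (simp add: has_real_derivative_iff_has_vector_derivative mult.commute)
    qed simp
    from integral_unique[OF this] show ?thesis by (simp add: G_def)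
  qed
  have "continuous_on ((S \<times> {a..}) \<times> {0..1}) (\<lambda>w. (fst (fst w), a + (snd (fst w) - a) * snd w))"
    by (intro continuous_intros)
  moreover have "(\<lambda>w. (fst (fst w), a + (snd (fst w) - a) * snd w)) ` ((S \<times> {a..}) \<times> {0..1}) \<subseteq> S \<times> {a..}"
    by auto
  ultimately have "continuous_on ((S \<times> {a..}) \<times> {0..1}) (\<lambda>w. f (fst (fst w)) (a + (snd (fst w) - a) * snd w))"
    using continuous_on_compose2[OF assms, of _ "\<lambda>w. (fst (fst w), a + (snd (fst w) - a) * snd w)"] by (simp add: split_beta')
  then have "continuous_on ((S \<times> {a..}) \<times> cbox 0 1) (\<lambda>(z, r). (snd z - a) * f (fst z) (a + (snd z - a) * r))"
    unfolding split_beta' by (auto intro!: continuous_intros)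
  from integral_continuous_on_param[OF this]
  have "continuous_on (S \<times> {a..}) (\<lambda>z. integral {0..1} (\<lambda>r. (snd z - a) * f (fst z) (a + (snd z - a) * r)))"
    by simp
  then show ?thesis
    by (rule continuous_on_cong[THEN iffD1, OF refl, rotated]) (auto simp: eq)
qed

lemma continuous_nonneg_integral_zero:
  fixes f :: "real \<Rightarrow> real"
  assumes "continuous_on {a..b} f" "\<And>x. x \<in> {a..b} \<Longrightarrow> f x \<ge> 0" "integral {a..b} f \<le> 0" "a < x" "x < b"
  shows "f x = 0"
proof -
  have i: "f integrable_on {a..b}" by (intro integrable_continuous_interval assms)
  have "integral {a..b} f \<ge> 0" by (intro integral_nonneg i assms)
  then have "(f has_integral 0) (cbox a b)" using integrable_integral[OF i] assms(3) by simp
  then show ?thesis using assms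
    by (intro has_integral_0_cbox_imp_0[of a b f]) auto
qed

text \<open>Here \<open>p\<close> stands for the space derivative of \<open>u\<close>, and mass
  moves with velocity \<open>- p\<close>. The mass starts in \<open>{- A..A}\<close> and has speed
  at most \<open>L\<close>, so \<open>K\<close> lies beyond its reach up to time
  \<open>T\<close>.\<close>

locale mass_flow =
  fixes T L A K :: real and m p :: "real \<Rightarrow> real \<Rightarrow> real"
  assumes T: "T > 0" and L: "L \<ge> 0" and A: "A > 0" and K: "K > A + L * T"
    and m_cont: "continuous_on ({0..T} \<times> UNIV) (\<lambda>(t, x). m t x)"
    and m_nonneg: "\<And>t x. t \<in> {0..T} \<Longrightarrow> m t x \<ge> 0"
    and p_cont: "continuous_on ({0<..<T} \<times> UNIV) (\<lambda>(t, x). p t x)"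
    and p_bound: "\<And>t x. t \<in> {0<..<T} \<Longrightarrow> \<bar>p t x\<bar> \<le> L"
    and rect: "\<And>t0 t1 y z. \<lbrakk>0 < t0; t0 \<le> t1; t1 < T; y \<le> z\<rbrakk> \<Longrightarrow>
      integral {y..z} (\<lambda>x. m t1 x - m t0 x) = integral {t0..t1} (\<lambda>t. m t z * p t z - m t y * p t y)"
    and mass_le: "\<And>t y z. \<lbrakk>t \<in> {0..T}; y \<le> z\<rbrakk> \<Longrightarrow> integral {y..z} (m t) \<le> 1"
    and mass_0: "integral {- A..A} (m 0) = 1"
begin

text \<open>Starting at \<open>- K - 1\<close> leaves a margin to the left of \<open>- K\<close>
  where \<open>F\<close> vanishes, so that differentiation across \<open>- K\<close> is
  unproblematic.\<close>

definition F :: "real \<Rightarrow> real \<Rightarrow> real" where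
  "F t x = integral {- K - 1..x} (m t)"

lemma K_pos: "K > 0"
  using A K L T mult_nonneg_nonneg[of L T] by linarith

lemma cone_bounds:
  assumes "t \<in> {0..T}"
  shows "0 < A + L * t" "A + L * t < K"
proof -
  have "0 \<le> L * t" "L * t \<le> L * T" using assms L by (auto intro: mult_left_mono)
  then show "0 < A + L * t" "A + L * t < K" using A K by auto
qed

lemma m_cont_x: "t \<in> {0..T} \<Longrightarrow> continuous_on S (m t)"
  using continuous_on_slices(1)[OF m_cont] continuous_on_subset by blast

lemma m_integrable: "t \<in> {0..T} \<Longrightarrow> m t integrable_on {y..z}"
  by (intro integrable_continuous_interval m_cont_x)

lemma mp_cont: "continuous_on ({0<..<T} \<times> UNIV) (\<lambda>(t, x). m t x * p t x)"
proof -
  have "continuous_on ({0<..<T} \<times> UNIV) (\<lambda>(t, x). m t x)"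
    by (rule continuous_on_subset[OF m_cont]) auto
  with p_cont show ?thesis unfolding split_beta' by (intro continuous_intros)
qed

lemma F_deriv_x': "t \<in> {0..T} \<Longrightarrow> - K - 1 < x \<Longrightarrow> (F t has_real_derivative m t x) (at x)"
  unfolding F_def[abs_def] by (intro integral_upper_derivative m_cont_x)

lemma F_cont': "continuous_on ({0..T} \<times> {- K - 1..}) (\<lambda>(t, x). F t x)"
  unfolding F_def by (intro continuous_on_upper_integral continuous_on_subset[OF m_cont]) auto

lemma F_deriv_t':
  assumes t: "t \<in> {0<..<T}" and x: "- K - 1 \<le> x"
  shows "((\<lambda>t. F t x) has_real_derivative m t x * p t x - m t (- K - 1) * p t (- K - 1)) (at t)"
proof -
  obtain a b where ab: "0 < a" "a < t" "t < b" "b < T" using t dense by (metis greaterThanLessThan_iff)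
  define w where "w t = m t x * p t x - m t (- K - 1) * p t (- K - 1)" for t
  have w: "continuous_on {a..b} w"
    unfolding w_def using ab
    by (auto intro!: continuous_intros continuous_on_subset[OF continuous_on_slices(2)[OF mp_cont]])
  have "((\<lambda>s. integral {a..s} w) has_real_derivative w t) (at t within {a..b})"
    using ab by (intro integral_has_real_derivative w) auto
  then have "((\<lambda>s. integral {a..s} w) has_real_derivative w t) (at t)"
    using ab by (simp add: at_within_Icc_at)
  from DERIV_add[OF DERIV_const[of "F a x"] this]
  have D: "((\<lambda>s. F a x + integral {a..s} w) has_real_derivative w t) (at t)" by simp
  have E: "F a x + integral {a..s} w = F s x" if "s \<in> {a<..<b}" for s
  proof -
    have "integral {- K - 1..x} (\<lambda>x. m s x - m a x) = integral {a..s} w"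
      unfolding w_def using ab that x by (intro rect) auto
    moreover have "integral {- K - 1..x} (\<lambda>x. m s x - m a x) = F s x - F a x"
      unfolding F_def using ab that
      by (intro Henstock_Kurzweil_Integration.integral_diff m_integrable) auto
    ultimately show ?thesis by simp
  qed
  have "((\<lambda>t. F t x) has_real_derivative w t) (at t)"
    by (rule has_field_derivative_transform_within_open[OF D open_greaterThanLessThan[of a b]])
      (use ab E in simp_all)
  then show ?thesis by (simp add: w_def)
qed

text \<open>The flux through \<open>- K - 1\<close> is kept since \<open>m\<close> is not yet known
  to vanish there. It cancels in the difference of two values of \<open>F\<close>.\<close>

lemma F_along_line:
  assumes t: "t \<in> {0<..<T}" and x: "\<bar>c + s * t\<bar> < K + 1"
  shows "((\<lambda>t. F t (c + s * t)) has_real_derivative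
     m t (c + s * t) * p t (c + s * t) - m t (- K - 1) * p t (- K - 1) + m t (c + s * t) * s) (at t)"
proof (rule chain_rule_partials[where I="{0<..<T}" and J="{- K - 1<..}"
      and ft="\<lambda>t x. m t x * p t x - m t (- K - 1) * p t (- K - 1)"])
  show "continuous_on ({0<..<T} \<times> {- K - 1<..}) (\<lambda>(t, x). m t x * p t x - m t (- K - 1) * p t (- K - 1))"
  proof -
    have "continuous_on {0<..<T} (\<lambda>t. m t (- K - 1) * p t (- K - 1))"
      using continuous_on_slices(2)[OF mp_cont, of "- K - 1"] by simp
    then have "continuous_on ({0<..<T} \<times> {- K - 1<..}) (\<lambda>z. m (fst z) (- K - 1) * p (fst z) (- K - 1))"
      by (rule continuous_on_compose2) (auto intro!: continuous_intros)
    moreover have "continuous_on ({0<..<T} \<times> {- K - 1<..}) (\<lambda>z. m (fst z) (snd z) * p (fst z) (snd z))"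
      by (rule continuous_on_subset[OF mp_cont[unfolded split_beta']]) auto
    ultimately show ?thesis unfolding split_beta' by (rule continuous_on_diff[rotated])
  qed
  show "((\<lambda>t. c + s * t) has_real_derivative s) (at t)" by (auto intro!: derivative_eq_intros)
qed (use t x in \<open>auto intro!: F_deriv_t'[simplified] F_deriv_x'\<close>)

text \<open>Since the speed is at most \<open>L\<close>, the mass in the interval expanding at speed \<open>L\<close> cannot
  decrease.\<close>

lemma mass_in_cone:
  assumes t: "t \<in> {0..T}"
  shows "F t (A + L * t) - F t (- A - L * t) \<ge> 1"
proof -
  let ?E = "\<lambda>t. F t (A + L * t) - F t (- A + (- L) * t)"
  have x: "\<bar>A + L * s\<bar> < K" "\<bar>- A + (- L) * s\<bar> < K" if "s \<in> {0..T}" for s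
    using cone_bounds[OF that] by auto
  have c: "continuous_on {0..t} (\<lambda>s. F s (c + r * s))"
    if "\<And>s. s \<in> {0..T} \<Longrightarrow> \<bar>c + r * s\<bar> < K" for c r
  proof -
    have "continuous_on {0..t} (\<lambda>s. (s, c + r * s))" by (intro continuous_intros)
    moreover have "(\<lambda>s. (s, c + r * s)) ` {0..t} \<subseteq> {0..T} \<times> {- K - 1..}"
      using that t by (force simp: abs_less_iff)
    ultimately show ?thesis
      using continuous_on_compose2[OF F_cont', of "{0..t}" "\<lambda>s. (s, c + r * s)"] by simp
  qed
  have "?E 0 \<le> ?E t"
  proof (rule DERIV_nonneg_imp_increasing_open[where f="?E"])
    fix s assume s: "0 < s" "s < t"
    then have sT: "s \<in> {0<..<T}" "s \<in> {0..T}" using t by auto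
    let ?a = "A + L * s" and ?b = "- A + (- L) * s"
    have D: "(?E has_real_derivative
       (m s ?a * p s ?a - m s (- K - 1) * p s (- K - 1) + m s ?a * L)
       - (m s ?b * p s ?b - m s (- K - 1) * p s (- K - 1) + m s ?b * - L)) (at s)"
      using x[OF sT(2)] by (intro DERIV_diff F_along_line sT) auto
    \<comment> \<open>These are the inflows through the end points of the expanding interval: the
      ends recede at speed \<open>L\<close>, and the mass is no faster.\<close>
    have "m s ?a * (L + p s ?a) \<ge> 0" "m s ?b * (L - p s ?b) \<ge> 0"
      using m_nonneg[OF sT(2)] p_bound[OF sT(1), of ?a] p_bound[OF sT(1), of ?b]
      by (auto intro!: mult_nonneg_nonneg simp: abs_le_iff)
    then show "\<exists>y. (?E has_real_derivative y) (at s) \<and> 0 \<le> y"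
      by - (rule exI, rule conjI, rule D, simp add: algebra_simps)
  next
    show "continuous_on {0..t} ?E" using x by (intro continuous_on_diff c) auto
  qed (use t in auto)
  moreover have "?E 0 = 1"
    using Henstock_Kurzweil_Integration.integral_combine[of "- K - 1" "- A" A "m 0"] mass_0 A T
      cone_bounds[of 0] m_integrable[of 0]
    by (simp add: F_def)
  ultimately show ?thesis by simp
qed

text \<open>The cone already holds mass 1 and no interval holds more, so integrals of
  \<open>m\<close> over the rest vanish; continuity makes this pointwise.\<close>

lemma m_support:
  assumes t: "t \<in> {0..T}" and x: "\<bar>x\<bar> \<ge> K"
  shows "m t x = 0"
proof -
  let ?a = "A + L * t"
  have a: "0 < ?a" "?a < K"
    using cone_bounds[OF t] by auto
  have comb: "integral {y..z} (m t) = integral {y..u} (m t) + integral {u..z} (m t)"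
    if "y \<le> u" "u \<le> z" for y u z
    using Henstock_Kurzweil_Integration.integral_combine[OF that m_integrable[OF t]] by simp
  have one: "integral {- ?a..?a} (m t) \<ge> 1"
    using mass_in_cone[OF t] comb[of "- K - 1" "- ?a" ?a] a by (simp add: F_def)
  \<comment> \<open>This puts \<open>x\<close> strictly inside the outer interval, where a
    nonnegative continuous function of zero integral is known to vanish.\<close>
  define z where "z = \<bar>x\<bar> + 1"
  have "integral {?a..z} (m t) \<le> 0" "integral {- z..- ?a} (m t) \<le> 0"
    using comb[of "- ?a" ?a z] comb[of "- z" "- ?a" ?a] one a x
      mass_le[OF t, of "- ?a" z] mass_le[OF t, of "- z" ?a] by (auto simp: z_def)
  then show ?thesis
    using continuous_nonneg_integral_zero[OF m_cont_x[OF t] m_nonneg[OF t], where x=x] a x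
    unfolding z_def by (cases "x \<ge> 0") force+
qed

lemma F_zero: "t \<in> {0..T} \<Longrightarrow> x \<le> - K \<Longrightarrow> F t x = 0"
  unfolding F_def by (intro integral_unique has_integral_is_0 m_support) (auto simp: abs_if)

lemma F_one:
  assumes t: "t \<in> {0..T}" and x: "x \<ge> K"
  shows "F t x = 1"
proof (rule antisym)
  show "F t x \<le> 1" unfolding F_def using x K_pos by (intro mass_le t) auto
  let ?a = "A + L * t"
  have a: "0 < ?a" "?a < K"
    using cone_bounds[OF t] by auto
  have "F t ?a \<le> F t x" unfolding F_def
    using a x K_pos m_nonneg[OF t] m_integrable[OF t] by (intro integral_subset_le) auto
  moreover have "F t (- A - L * t) \<ge> 0" unfolding F_def
    by (intro integral_nonneg m_integrable t m_nonneg)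
  ultimately show "1 \<le> F t x" using mass_in_cone[OF t] by linarith
qed

lemma F_deriv_x: "t \<in> {0..T} \<Longrightarrow> (F t has_real_derivative m t x) (at x)"
proof (cases "x > - K - 1")
  case False
  assume t: "t \<in> {0..T}"
  have "(F t has_real_derivative 0) (at x)"
    using False t by (intro has_field_derivative_transform_within_open[OF DERIV_const, of "{..<- K}"]) (auto simp: F_zero)
  then show ?thesis using m_support[OF t, of x] False K_pos by (simp add: abs_if)
qed (rule F_deriv_x')

lemma F_deriv_t:
  assumes t: "t \<in> {0<..<T}"
  shows "((\<lambda>t. F t x) has_real_derivative m t x * p t x) (at t)"
proof (cases "x \<ge> - K - 1")
  case True
  then show ?thesis using F_deriv_t'[OF t True] m_support[of t "- K - 1"] t K_pos by simp
next
  case False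
  have "((\<lambda>t. F t x) has_real_derivative 0) (at t)"
    using False t by (intro has_field_derivative_transform_within_open[OF DERIV_const, of "{0<..<T}"]) (auto simp: F_zero)
  then show ?thesis using m_support[of t x] False K_pos t by (simp add: abs_if)
qed

lemma F_cont: "continuous_on ({0..T} \<times> UNIV) (\<lambda>(t, x). F t x)"
proof -
  \<comment> \<open>Truncating the argument at \<open>- K\<close> does not change \<open>F\<close>,
    which is zero further left, and leads into the region of \<open>F_cont'\<close>.\<close>
  have "continuous_on ({0..T} \<times> UNIV) (\<lambda>z. (fst z, max (- K) (snd z)))"
    by (intro continuous_intros)
  moreover have "(\<lambda>z. (fst z, max (- K) (snd z))) ` ({0..T} \<times> UNIV) \<subseteq> {0..T} \<times> {- K - 1..}"
    by (auto simp: max_def)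
  ultimately have "continuous_on ({0..T} \<times> UNIV) (\<lambda>z. F (fst z) (max (- K) (snd z)))"
    using continuous_on_compose2[OF F_cont', of "{0..T} \<times> UNIV" "\<lambda>z. (fst z, max (- K) (snd z))"]
    by (simp add: split_beta')
  then show ?thesis
    by (rule continuous_on_cong[THEN iffD1, OF refl, rotated]) (auto simp: F_zero max_def split_beta')
qed

end


section \<open>Regularised flow\<close>

locale regularized_flow = mass_flow +
  fixes \<eta> :: real
  assumes \<eta>: "0 < \<eta>"
begin

definition n :: "real \<Rightarrow> real \<Rightarrow> real" where
  "n t x = (m t x + \<eta> / (2 * K)) / (1 + \<eta>)"

text \<open>The linear part also grows outside \<open>{- K..K}\<close>, where \<open>G\<close>
  leaves the unit interval. So \<open>G t\<close> is a bijection of the line, and \<open>X t\<close>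
  is defined and differentiable at every level, 0 and 1 included.\<close>

definition G :: "real \<Rightarrow> real \<Rightarrow> real" where
  "G t x = (F t x + \<eta> * (x + K) / (2 * K)) / (1 + \<eta>)"

definition X :: "real \<Rightarrow> real \<Rightarrow> real" where
  "X t s = (THE x. G t x = s)"

text \<open>Only \<open>m\<close> moves in the mixture: this is its flux - m p / (1 + \<eta>)
  divided by the density \<open>n\<close>.\<close>

definition V :: "real \<Rightarrow> real \<Rightarrow> real" where
  "V t x = - (m t x / (m t x + \<eta> / (2 * K))) * p t x"

definition c :: real where "c = \<eta> / (2 * K) / (1 + \<eta>)"

lemma c_pos: "c > 0"
  unfolding c_def using \<eta> K_pos by simp

lemma mK_pos: "t \<in> {0..T} \<Longrightarrow> m t x + \<eta> / (2 * K) > 0"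
  using m_nonneg[of t x] \<eta> K_pos by (simp add: add_nonneg_pos)

lemma n_ge: "t \<in> {0..T} \<Longrightarrow> n t x \<ge> c"
  unfolding n_def c_def using m_nonneg[of t x] \<eta> by (intro divide_right_mono) auto

lemma n_pos: "t \<in> {0..T} \<Longrightarrow> n t x > 0"
  using n_ge[of t x] c_pos by linarith

lemma n_cont: "continuous_on ({0..T} \<times> UNIV) (\<lambda>(t, x). n t x)"
  using m_cont \<eta> unfolding n_def split_beta' by (intro continuous_intros) auto

lemma G_deriv_x: "t \<in> {0..T} \<Longrightarrow> (G t has_real_derivative n t x) (at x)"
  unfolding G_def[abs_def] n_def using K_pos \<eta>
  by (auto intro!: derivative_eq_intros F_deriv_x)

lemma G_deriv_t: "t \<in> {0<..<T} \<Longrightarrow> ((\<lambda>t. G t x) has_real_derivative m t x * p t x / (1 + \<eta>)) (at t)"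
  unfolding G_def using \<eta> by (auto intro!: derivative_eq_intros F_deriv_t)

lemma G_cont: "continuous_on ({0..T} \<times> UNIV) (\<lambda>(t, x). G t x)"
  using F_cont K_pos \<eta> unfolding G_def split_beta' by (intro continuous_intros) auto

lemma G_mean_value:
  assumes "t \<in> {0..T}"
  shows "\<exists>\<xi>. \<bar>\<xi> - x\<bar> \<le> \<bar>y - x\<bar> \<and> G t y - G t x = n t \<xi> * (y - x)"
proof (cases x y rule: linorder_cases)
  case less
  then show ?thesis using MVT2[of x y "G t" "n t"] G_deriv_x[OF assms] by force
next
  case greater
  then obtain \<xi> where "y < \<xi>" "\<xi> < x" "G t x - G t y = (x - y) * n t \<xi>"
    using MVT2[of y x "G t" "n t"] G_deriv_x[OF assms] by blast
  then show ?thesis by (intro exI[of _ \<xi>]) (auto simp: algebra_simps)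
qed auto

lemma G_expand:
  assumes "t \<in> {0..T}"
  shows "c * \<bar>y - x\<bar> \<le> \<bar>G t y - G t x\<bar>"
proof -
  obtain \<xi> where "G t y - G t x = n t \<xi> * (y - x)" using G_mean_value[OF assms] by blast
  then show ?thesis using n_ge[OF assms, of \<xi>] c_pos by (simp add: abs_mult mult_right_mono)
qed

lemma G_mono:
  assumes "t \<in> {0..T}" "x < y"
  shows "G t x < G t y"
proof -
  obtain \<xi> where "G t y - G t x = n t \<xi> * (y - x)" using G_mean_value[OF assms(1)] by blast
  moreover have "n t \<xi> * (y - x) > 0" using n_pos[OF assms(1)] assms(2) by simp
  ultimately show ?thesis by linarith
qed

lemma G_K:
  assumes "t \<in> {0..T}"
  shows "G t (- K) = 0" "G t K = 1"
  using F_zero[OF assms, of "- K"] F_one[OF assms, of K] K_pos \<eta>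
  by (simp_all add: G_def field_simps)

lemma G_ex1:
  assumes t: "t \<in> {0..T}"
  shows "\<exists>!x. G t x = s"
proof -
  define d where "d = (\<bar>s\<bar> + 1) / c"
  have d: "d > 0" "c * d = \<bar>s\<bar> + 1" unfolding d_def using c_pos by (auto simp: add_nonneg_pos)
  have 1: "s \<le> G t (K + d)"
    using G_expand[OF t, of "K + d" K] G_mono[OF t, of K "K + d"] G_K[OF t] d by simp
  have 2: "G t (- K - d) \<le> s"
    using G_expand[OF t, of "- K - d" "- K"] G_mono[OF t, of "- K - d" "- K"] G_K[OF t] d by simp
  have "continuous_on {- K - d..K + d} (G t)"
    using G_deriv_x[OF t] by (meson DERIV_isCont continuous_at_imp_continuous_on)
  then obtain x where "G t x = s" using IVT'[of "G t" "- K - d" s "K + d"] 1 2 K_pos d by auto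
  then show ?thesis using G_mono[OF t] by (metis linorder_neqE_linordered_idom less_irrefl)
qed

lemma G_X: "t \<in> {0..T} \<Longrightarrow> G t (X t s) = s"
  unfolding X_def by (rule theI') (rule G_ex1)

lemma X_G: "t \<in> {0..T} \<Longrightarrow> X t (G t x) = x"
  using G_ex1 G_X by blast

lemma X_ends: "t \<in> {0..T} \<Longrightarrow> X t 0 = - K" "t \<in> {0..T} \<Longrightarrow> X t 1 = K"
  using X_G[of t] G_K[of t] by metis+

lemma X_mono: "t \<in> {0..T} \<Longrightarrow> s \<le> s' \<Longrightarrow> X t s \<le> X t s'"
  using G_mono[of t "X t s'" "X t s"] G_X[of t] by (metis leD leI)

lemma X_bounds: "t \<in> {0..T} \<Longrightarrow> s \<in> {0..1} \<Longrightarrow> X t s \<in> {- K..K}"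
  using X_mono[of t 0 s] X_mono[of t s 1] X_ends by auto

text \<open>The density is at least \<open>c\<close>, so \<open>G t\<close> expands distances by
  this factor; changing the level or the time moves the quantile by at most the induced change of
  \<open>G\<close> over \<open>c\<close>.\<close>

lemma X_modulus:
  assumes "t \<in> {0..T}" "t' \<in> {0..T}"
  shows "\<bar>X t s - X t' s'\<bar> \<le> (\<bar>s - s'\<bar> + \<bar>G t' (X t' s') - G t (X t' s')\<bar>) / c"
proof -
  have "c * \<bar>X t s - X t' s'\<bar> \<le> \<bar>s - G t (X t' s')\<bar>"
    using G_expand[OF assms(1), of "X t s" "X t' s'"] G_X[OF assms(1)] by simp
  also have "\<dots> \<le> \<bar>s - s'\<bar> + \<bar>G t' (X t' s') - G t (X t' s')\<bar>"
    using G_X[OF assms(2), of s'] by linarith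
  finally show ?thesis using c_pos by (simp add: field_simps)
qed

lemma X_cont: "continuous_on ({0..T} \<times> UNIV) (\<lambda>(t, s). X t s)"
  unfolding continuous_on_def split_beta'
proof safe
  fix t s :: real assume t: "t \<in> {0..T}"
  let ?F = "at (t, s) within {0..T} \<times> UNIV"
  let ?h = "\<lambda>z. (\<bar>snd z - s\<bar> + \<bar>G t (X t s) - G (fst z) (X t s)\<bar>) / c"
  have "continuous_on ({0..T} \<times> UNIV) (\<lambda>z. (fst z, X t s))" by (intro continuous_intros)
  then have "continuous_on ({0..T} \<times> UNIV) (\<lambda>z. G (fst z) (X t s))"
    using continuous_on_compose2[OF G_cont, of "{0..T} \<times> UNIV" "\<lambda>z. (fst z, X t s)"]
    by (auto simp: split_beta' image_subset_iff)
  then have "((\<lambda>z::real \<times> real. G (fst z) (X t s)) \<longlongrightarrow> G t (X t s)) ?F"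
    using t by (auto simp: continuous_on_def)
  moreover have "(snd \<longlongrightarrow> s) ?F" using tendsto_snd[OF tendsto_ident_at[of "(t, s)"]] by simp
  ultimately have "(?h \<longlongrightarrow> (\<bar>s - s\<bar> + \<bar>G t (X t s) - G t (X t s)\<bar>) / c) ?F"
    using c_pos by (intro tendsto_intros) auto
  then have h: "(?h \<longlongrightarrow> 0) ?F" by simp
  have "((\<lambda>z. X (fst z) (snd z) - X t s) \<longlongrightarrow> 0) ?F"
  proof (rule Lim_null_comparison[OF _ h])
    show "\<forall>\<^sub>F z in ?F. norm (X (fst z) (snd z) - X t s) \<le> ?h z"
      unfolding eventually_at_filter
      by (rule always_eventually) (use X_modulus[OF _ t, where s'=s] in auto)
  qed
  then show "((\<lambda>z. X (fst z) (snd z)) \<longlongrightarrow> X (fst (t, s)) (snd (t, s))) ?F"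
    by (simp add: LIM_zero_iff)
qed

lemma X_deriv_s:
  assumes t: "t \<in> {0..T}"
  shows "(X t has_real_derivative 1 / n t (X t s)) (at s)"
proof -
  have "(X t has_real_derivative inverse (n t (X t s))) (at s)"
  proof (rule DERIV_inverse_function[of "G t" _ _ _ "s - 1" "s + 1"])
    show "isCont (X t) s"
      using continuous_on_slices(1)[OF X_cont t] by (simp add: continuous_on_eq_continuous_at)
  qed (use G_deriv_x[OF t] n_pos[OF t, of "X t s"] G_X[OF t] in auto)
  then show ?thesis by (simp add: inverse_eq_divide)
qed

text \<open>Implicit differentiation of \<open>G t (X t s) = s\<close>. A mean value \<xi> in space
  trades the increment of \<open>X\<close> for that of \<open>G\<close> at the fixed point
  \<open>y\<close>, divided by the density at \<xi>; joint continuity of \<open>n\<close> handles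
  the moving \<xi>.\<close>

lemma X_deriv_t:
  assumes t: "t \<in> {0<..<T}"
  shows "((\<lambda>t. X t s) has_real_derivative V t (X t s)) (at t)"
proof -
  define y where "y = X t s"
  have tT: "t \<in> {0..T}" using t by auto
  have ev: "eventually (\<lambda>u. u \<in> {0<..<T}) (at t)"
    using t by (intro eventually_at_in_open') auto
  have "\<exists>\<xi>. \<bar>\<xi> - y\<bar> \<le> \<bar>X u s - y\<bar> \<and> s - G u y = n u \<xi> * (X u s - y)" if "u \<in> {0<..<T}" for u
    using G_mean_value[of u y "X u s"] G_X[of u s] that by auto
  then obtain \<xi> where \<xi>: "\<And>u. u \<in> {0<..<T} \<Longrightarrow> \<bar>\<xi> u - y\<bar> \<le> \<bar>X u s - y\<bar>"
      "\<And>u. u \<in> {0<..<T} \<Longrightarrow> s - G u y = n u (\<xi> u) * (X u s - y)" by metis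
  have "((\<lambda>u. X u s - y) \<longlongrightarrow> 0) (at t)"
  proof -
    have "isCont (\<lambda>u. X u s) t"
      using continuous_on_interior[OF continuous_on_slices(2)[OF X_cont], of s t] t by simp
    then show ?thesis by (simp add: isCont_def y_def LIM_zero_iff)
  qed
  then have "((\<lambda>u. \<bar>X u s - y\<bar>) \<longlongrightarrow> 0) (at t)" by (rule tendsto_rabs_zero)
  then have "((\<lambda>u. \<xi> u - y) \<longlongrightarrow> 0) (at t)"
    by (rule Lim_null_comparison[rotated]) (use \<xi>(1) in \<open>auto intro: eventually_mono[OF ev]\<close>)
  then have \<xi>y: "(\<xi> \<longlongrightarrow> y) (at t)" by (simp add: LIM_zero_iff)
  have "((\<lambda>u. n u (\<xi> u)) \<longlongrightarrow> n t y) (at t)"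
  proof -
    have "isCont (\<lambda>(t, x). n t x) (t, y)"
      using continuous_on_interior[OF n_cont, of "(t, y)"] t by (simp add: interior_Times)
    from isCont_tendsto_compose[OF this tendsto_Pair[OF tendsto_ident_at \<xi>y]] show ?thesis by simp
  qed
  moreover have Gt: "((\<lambda>u. (G u y - s) / (u - t)) \<longlongrightarrow> m t y * p t y / (1 + \<eta>)) (at t)"
    using G_deriv_t[OF t, of y] G_X[OF tT, of s] by (simp add: has_field_derivative_iff y_def)
  ultimately have lim: "((\<lambda>u. - ((G u y - s) / (u - t)) / n u (\<xi> u)) \<longlongrightarrow> - (m t y * p t y / (1 + \<eta>)) / n t y) (at t)"
    using n_pos[OF tT, of y] by (intro tendsto_divide tendsto_minus[OF Gt]) auto
  have eq: "- (m t y * p t y / (1 + \<eta>)) / n t y = V t y"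
  proof -
    define M where "M = m t y + \<eta> / (2 * K)"
    have "M > 0" using mK_pos[OF tT, of y] by (simp add: M_def)
    then show ?thesis unfolding n_def V_def using \<eta> by (simp flip: M_def)
  qed
  have "\<forall>\<^sub>F u in at t. u \<noteq> t" by (simp add: eventually_at_filter)
  with ev have tr: "\<forall>\<^sub>F u in at t. - ((G u y - s) / (u - t)) / n u (\<xi> u) = (X u s - X t s) / (u - t)"
  proof eventually_elim
    case (elim u)
    then have "n u (\<xi> u) > 0" by (intro n_pos) auto
    moreover have "- (G u y - s) = n u (\<xi> u) * (X u s - y)" using \<xi>(2)[OF elim(1)] by simp
    ultimately show ?case by (simp add: y_def divide_simps)
  qed
  from Lim_transform_eventually[OF lim tr, unfolded eq] show ?thesis by (simp add: has_field_derivative_iff y_def)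
qed

lemma V_bound: "t \<in> {0<..<T} \<Longrightarrow> \<bar>V t x\<bar> \<le> L"
proof -
  assume t: "t \<in> {0<..<T}"
  define e where "e = m t x / (m t x + \<eta> / (2 * K))"
  have e: "e \<le> 1" "0 \<le> e"
    unfolding e_def using mK_pos[of t x] m_nonneg[of t x] t \<eta> K_pos
    by (auto intro!: divide_nonneg_pos simp: divide_le_eq_1_pos)
  have "\<bar>V t x\<bar> = e * \<bar>p t x\<bar>" using e by (simp add: V_def abs_mult flip: e_def)
  also have "\<dots> \<le> 1 * L" using e p_bound[OF t, of x] L by (intro mult_mono) auto
  finally show ?thesis by simp
qed

lemma V_cont: "continuous_on ({0<..<T} \<times> UNIV) (\<lambda>(t, x). V t x)"
proof -
  have "continuous_on ({0<..<T} \<times> UNIV) (\<lambda>(t, x). m t x)"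
    by (rule continuous_on_subset[OF m_cont]) auto
  with p_cont show ?thesis
    unfolding V_def split_beta' using mK_pos
    by (intro continuous_intros) (auto simp: less_le)
qed

text \<open>Where \<open>m\<close> vanishes \<open>V\<close> does too, but \<open>p\<close> need not, so \<open>V + p\<close> is small only on average.\<close>

lemma V_error:
  assumes t: "t \<in> {0<..<T}"
  shows "(V t (X t s) + p t (X t s))\<^sup>2 \<le> L\<^sup>2 * (\<eta> / (2 * K) / (1 + \<eta>) * (1 / n t (X t s)))"
proof -
  define x where "x = X t s"
  define e where "e = (\<eta> / (2 * K)) / (m t x + \<eta> / (2 * K))"
  have tT: "t \<in> {0..T}" using t by auto
  have e: "0 \<le> e" "e \<le> 1"
    unfolding e_def using mK_pos[OF tT, of x] m_nonneg[OF tT, of x] \<eta> K_pos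
    by (auto intro!: divide_nonneg_pos simp del: divide_divide_eq_left simp: divide_le_eq_1_pos)
  have "V t x + p t x = e * p t x"
    unfolding V_def e_def using mK_pos[OF tT, of x] by (simp add: field_simps)
  then have "(V t x + p t x)\<^sup>2 = e\<^sup>2 * (p t x)\<^sup>2" by (simp add: power_mult_distrib)
  also have "\<dots> \<le> e * L\<^sup>2"
  proof (intro mult_mono)
    show "e\<^sup>2 \<le> e" using e by (simp add: power2_eq_square mult_left_le)
    show "(p t x)\<^sup>2 \<le> L\<^sup>2" using p_bound[OF t, of x] L by (metis abs_of_nonneg power2_abs power_mono abs_ge_zero)
  qed (use e in auto)
  also have "e = \<eta> / (2 * K) / (1 + \<eta>) * (1 / n t x)"
    unfolding e_def n_def using mK_pos[OF tT, of x] \<eta> by simp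
  finally show ?thesis by (simp add: x_def mult.commute)
qed

text \<open>Along the quantile function 1 / n is the derivative of \<open>X\<close> in
  \<open>s\<close>, so the pointwise bound integrates to the length 2 K and the factor 1 / (2 K)
  cancels.\<close>

lemma V_error_integral:
  assumes t: "t \<in> {0<..<T}"
  shows "integral {0..1} (\<lambda>s. (V t (X t s) + p t (X t s))\<^sup>2) \<le> L\<^sup>2 * \<eta>"
proof -
  have tT: "t \<in> {0..T}" using t by auto
  have Xc: "continuous_on {0..1} (X t)"
    using continuous_on_slices(1)[OF X_cont tT] by (rule continuous_on_subset) auto
  have "continuous_on {0..1} (\<lambda>s. (V t (X t s) + p t (X t s))\<^sup>2)"
    using continuous_on_compose2[OF continuous_on_slices(1)[OF V_cont t] Xc]
      continuous_on_compose2[OF continuous_on_slices(1)[OF p_cont t] Xc]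
    by (intro continuous_intros) auto
  then have "((\<lambda>s. (V t (X t s) + p t (X t s))\<^sup>2) has_integral
      integral {0..1} (\<lambda>s. (V t (X t s) + p t (X t s))\<^sup>2)) {0..1}"
    by (intro integrable_integral integrable_continuous_interval)
  moreover have "((\<lambda>s. L\<^sup>2 * (\<eta> / (2 * K) / (1 + \<eta>) * (1 / n t (X t s)))) has_integral
      L\<^sup>2 * (\<eta> / (2 * K) / (1 + \<eta>) * (X t 1 - X t 0))) {0..1}"
  proof (intro has_integral_mult_right fundamental_theorem_of_calculus_interior)
    show "(X t has_vector_derivative 1 / n t (X t s)) (at s)" for s
      using X_deriv_s[OF tT] by (simp add: has_real_derivative_iff_has_vector_derivative)
  qed (use Xc in auto)
  ultimately have "integral {0..1} (\<lambda>s. (V t (X t s) + p t (X t s))\<^sup>2)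
      \<le> L\<^sup>2 * (\<eta> / (2 * K) / (1 + \<eta>) * (X t 1 - X t 0))"
    by (rule has_integral_le) (rule V_error[OF t])
  also have "\<dots> = L\<^sup>2 * (\<eta> / (1 + \<eta>))" using X_ends[OF tT] K_pos by simp
  also have "\<dots> \<le> L\<^sup>2 * \<eta>" using \<eta> by (intro mult_left_mono) (auto simp: field_simps)
  finally show ?thesis .
qed

end


section \<open>Displacement convexity\<close>

text \<open>The tangent inequality of the convex function v^(-\<theta>) at the point 1 / b,
  evaluated at 1 / a; here it is obtained from Young's inequality with exponents \<theta> + 1 and
  (\<theta> + 1) / \<theta>.\<close>

lemma powr_young:
  fixes a b \<theta> :: real
  assumes "a > 0" "b \<ge> 0" "\<theta> > 0"
  shows "(\<theta> + 1) * b powr \<theta> \<le> a powr \<theta> + \<theta> * b powr (\<theta> + 1) / a"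
proof (cases "b = 0")
  case False
  then have b: "b > 0" using assms by simp
  have "(a powr \<theta>) powr (1 / (\<theta> + 1)) * (b powr (\<theta> + 1) / a) powr (\<theta> / (\<theta> + 1))
      \<le> 1 / (\<theta> + 1) * a powr \<theta> + \<theta> / (\<theta> + 1) * (b powr (\<theta> + 1) / a)"
    using assms b by (intro Youngs_inequality_0) (auto simp: field_simps)
  also have "(a powr \<theta>) powr (1 / (\<theta> + 1)) * (b powr (\<theta> + 1) / a) powr (\<theta> / (\<theta> + 1)) = b powr \<theta>"
    using assms b by (simp add: powr_divide powr_powr)
  finally have "b powr \<theta> \<le> (a powr \<theta> + \<theta> * b powr (\<theta> + 1) / a) / (\<theta> + 1)"
    by (simp add: add_divide_distrib mult.commute[of a])
  then show ?thesis using assms by (simp add: pos_le_divide_eq mult.commute)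
qed (use assms in simp)

lemma has_integral_le_interior:
  fixes f g :: "real \<Rightarrow> real"
  assumes "(f has_integral I) {a..b}" "(g has_integral J) {a..b}" "\<And>x. x \<in> {a<..<b} \<Longrightarrow> f x \<le> g x"
  shows "I \<le> J"
  using assms by (auto simp: has_integral_Icc_iff_Ioo intro: has_integral_le)

lemma powr_add_le:
  fixes x d B \<theta> :: real
  assumes "0 \<le> x" "0 < d" "x + d \<le> B" "\<theta> \<ge> 1"
  shows "(x + d) powr \<theta> \<le> x powr \<theta> + \<theta> * B powr (\<theta> - 1) * d"
proof -
  have "\<exists>l z. z > x \<and> z < x + d \<and> DERIV (\<lambda>z. z powr \<theta>) z :> l \<and> (x + d) powr \<theta> - x powr \<theta> = (x + d - x) * l"
  proof (intro MVT)
    show "continuous_on {x..x + d} (\<lambda>z. z powr \<theta>)"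
      using assms by (intro continuous_on_powr' continuous_intros) auto
    show "(\<lambda>z. z powr \<theta>) differentiable at v" if "x < v" "v < x + d" for v
      using has_real_derivative_powr[of v \<theta>] that assms by (auto simp: real_differentiable_def)
  qed (use assms in auto)
  then obtain l z where z: "x < z" "z < x + d" "DERIV (\<lambda>z. z powr \<theta>) z :> l"
      "(x + d) powr \<theta> - x powr \<theta> = d * l" by auto
  have "l = \<theta> * z powr (\<theta> - 1)"
    using DERIV_unique[OF z(3) has_real_derivative_powr] z assms by simp
  also have "\<dots> \<le> \<theta> * B powr (\<theta> - 1)"
    using z assms by (intro mult_left_mono powr_mono2) auto
  finally show ?thesis using z(4) assms mult_left_mono[of l "\<theta> * B powr (\<theta> - 1)" d] by (simp add: algebra_simps)
qed

text \<open>Here \<open>x\<close> is the quantile function of the density \<open>\<mu>\<close> mixed with a small multiple of the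
  uniform density on \<open>[-K, K]\<close>, and \<open>z\<close> is that of the minimiser, with density \<open>r\<close> along \<open>z\<close>, of the
  energy with confinement \<open>a z\<^sup>2 / 2\<close>. Both the convexity of \<open>p \<mapsto> p\<^sup>-\<^sup>\<theta>\<close> and the duality with \<open>\<mu>\<^sup>\<theta>\<close>
  are instances of Young's inequality.\<close>

lemma energy_comparison:
  fixes \<mu> x z r :: "real \<Rightarrow> real" and \<theta> \<eta> K B a \<nu> :: real
  assumes \<theta>: "\<theta> \<ge> 1" and \<eta>: "0 < \<eta>" "\<eta> \<le> 1" and K: "K > 0" and \<nu>: "0 \<le> \<nu>" "\<nu> \<le> 1"
    and \<mu>: "continuous_on UNIV \<mu>" "\<And>v. \<mu> v \<ge> 0" "\<And>v. \<mu> v \<le> B"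
    and x: "continuous_on {0..1} x" "x 0 = - K" "x 1 = K" "\<And>s. s \<in> {0..1} \<Longrightarrow> x s \<in> {-K..K}"
      "\<And>s. s \<in> {0<..<1} \<Longrightarrow> (x has_real_derivative (1 + \<eta>) / (\<mu> (x s) + \<eta> / (2 * K))) (at s)"
    and z: "continuous_on {0..1} z" "\<And>s. s \<in> {0..1} \<Longrightarrow> z s \<in> {-K..K}"
      "\<And>s. s \<in> {0<..<1} \<Longrightarrow> (z has_real_derivative 1 / r s) (at s)"
    and r: "continuous_on {0..1} r" "r 0 = 0" "r 1 = 0" "\<And>s. s \<in> {0<..<1} \<Longrightarrow> r s > 0"
      "\<And>s. s \<in> {0<..<1} \<Longrightarrow>
        ((\<lambda>s. r s powr (\<theta> + 1)) has_real_derivative - ((\<theta> + 1) / \<theta>) * a * z s) (at s)"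
  shows "integral {0..1} (\<lambda>s. \<mu> (x s - \<nu> * (x s - z s)) powr \<theta> - \<mu> (x s) powr \<theta>)
    \<le> \<nu> * a * integral {0..1} (\<lambda>s. z s * (x s - z s))
      + (\<theta> * (B + 1 / (2 * K)) powr (\<theta> - 1) / (2 * K) + \<theta> * B powr \<theta>) * \<eta>"
proof -
  define g where "g = 1 / (2 * K)"
  have g: "g > 0" using K by (simp add: g_def)
  define n where "n s = (\<mu> (x s) + \<eta> * g) / (1 + \<eta>)" for s
  define y where "y s = x s - \<nu> * (x s - z s)" for s
  have n: "n s > 0" for s unfolding n_def using \<mu>(2)[of "x s"] \<eta> g by (intro divide_pos_pos add_nonneg_pos) auto
  have xd: "(x has_real_derivative 1 / n s) (at s)" if "s \<in> {0<..<1}" for s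
    using x(5)[OF that] by (simp add: n_def g_def)
  have \<mu>c: "continuous_on {0..1} (\<lambda>s. \<mu> (h s))" if "continuous_on {0..1} h" for h
    using continuous_on_compose2[OF \<mu>(1) that] by simp
  have nc: "continuous_on {0..1} n"
    unfolding n_def using \<eta> by (intro continuous_intros \<mu>c x) auto
  have yc: "continuous_on {0..1} y" unfolding y_def by (intro continuous_intros x z)
  have \<mu>p: "continuous_on S (\<lambda>v. \<mu> v powr e)" if "e > 0" for e S
    using continuous_on_subset[OF \<mu>(1)] \<mu>(2) that by (intro continuous_on_powr') (auto intro!: continuous_intros)
  \<comment> \<open>By substitution the integral of
    \<open>\<mu> (h s) powr (\<theta> + 1) * h' s\<close> depends only on the end points of
    \<open>h\<close>. This makes the curves \<open>x\<close> and \<open>y\<close> comparable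
    although \<mu> is evaluated at different places.\<close>
  define P where "P v = integral {- K..v} (\<lambda>v. \<mu> v powr (\<theta> + 1))" for v
  have Pd: "(P has_real_derivative \<mu> v powr (\<theta> + 1)) (at v within {-K..K})" if "v \<in> {-K..K}" for v
    unfolding P_def using that \<theta> by (intro integral_has_real_derivative \<mu>p) auto
  have Pc: "continuous_on {-K..K} P" using Pd by (rule DERIV_continuous_on)
  have Pd': "(P has_real_derivative \<mu> v powr (\<theta> + 1)) (at v)" if "v \<in> {-K<..<K}" for v
    using Pd[of v] that by (simp add: at_within_Icc_at)
  have Pmono: "P u \<le> P v" if "- K \<le> u" "u \<le> v" "v \<le> K" for u v
    unfolding P_def using that \<theta>
    by (intro integral_subset_le integrable_continuous_interval \<mu>p) auto
  define M1 where "M1 = P K"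
  define N where "N = integral {0..1} (\<lambda>s. n s powr \<theta>)"
  define M2 where "M2 = integral {0..1} (\<lambda>s. r s powr \<theta>)"
  define A where "A = integral {0..1} (\<lambda>s. \<mu> (x s) powr \<theta>)"
  define Y where "Y = integral {0..1} (\<lambda>s. \<mu> (y s) powr \<theta>)"
  define Z where "Z = integral {0..1} (\<lambda>s. z s * (x s - z s))"
  have pc: "continuous_on {0..1} (\<lambda>s. h s powr \<theta>)"
    if "continuous_on {0..1} h" "\<And>s. s \<in> {0..1} \<Longrightarrow> h s \<ge> 0" for h :: "real \<Rightarrow> real"
    using that \<theta> by (intro continuous_on_powr' continuous_intros) auto
  have r0: "r s \<ge> 0" if "s \<in> {0..1}" for s
    using r(2-4) that by (cases "s = 0 \<or> s = 1") (auto intro: less_imp_le)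
  have hN: "((\<lambda>s. n s powr \<theta>) has_integral N) {0..1}"
    unfolding N_def by (intro integrable_integral integrable_continuous_interval pc nc less_imp_le n)
  have hM2: "((\<lambda>s. r s powr \<theta>) has_integral M2) {0..1}"
    unfolding M2_def by (intro integrable_integral integrable_continuous_interval pc r r0)
  have hA: "((\<lambda>s. \<mu> (x s) powr \<theta>) has_integral A) {0..1}"
    unfolding A_def by (intro integrable_integral integrable_continuous_interval pc \<mu>c \<mu> x)
  have hY: "((\<lambda>s. \<mu> (y s) powr \<theta>) has_integral Y) {0..1}"
    unfolding Y_def by (intro integrable_integral integrable_continuous_interval pc \<mu>c \<mu> yc)
  have hZ: "((\<lambda>s. z s * (x s - z s)) has_integral Z) {0..1}"
    unfolding Z_def by (intro integrable_integral integrable_continuous_interval continuous_intros x z)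
  have sub: "((\<lambda>s. \<mu> (h s) powr (\<theta> + 1) * h' s) has_integral P (h 1) - P (h 0)) {0..1}"
    if "continuous_on {0..1} h" "\<And>s. s \<in> {0..1} \<Longrightarrow> h s \<in> {-K..K}" "\<And>s. s \<in> {0<..<1} \<Longrightarrow> h s \<in> {-K<..<K}"
      "\<And>s. s \<in> {0<..<1} \<Longrightarrow> (h has_real_derivative h' s) (at s)" for h h'
  proof (rule fundamental_theorem_of_calculus_interior)
    show "continuous_on {0..1} (\<lambda>s. P (h s))"
      using continuous_on_compose2[OF Pc that(1)] that(2) by blast
    show "((\<lambda>s. P (h s)) has_vector_derivative \<mu> (h s) powr (\<theta> + 1) * h' s) (at s)" if "s \<in> {0<..<1}" for s
      using DERIV_chain2[OF Pd' \<open>\<And>s. s \<in> {0<..<1} \<Longrightarrow> (h has_real_derivative h' s) (at s)\<close>]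
        that \<open>\<And>s. s \<in> {0<..<1} \<Longrightarrow> h s \<in> {-K<..<K}\<close>
      by (simp add: has_real_derivative_iff_has_vector_derivative)
  qed simp
  have strict: "h u < h v" if "continuous_on {0..1} h" "0 \<le> u" "u < v" "v \<le> 1"
      "\<And>s. s \<in> {0<..<1} \<Longrightarrow> (h has_real_derivative 1 / q s) (at s)" "\<And>s. s \<in> {0<..<1} \<Longrightarrow> q s > 0"
    for h q :: "real \<Rightarrow> real" and u v
  proof (rule DERIV_pos_imp_increasing_open[OF \<open>u < v\<close>])
    show "continuous_on {u..v} h" using that by (intro continuous_on_subset[OF that(1)]) auto
    fix s assume "u < s" "s < v"
    then have "s \<in> {0<..<1}" using that by auto
    then show "\<exists>y. (h has_real_derivative y) (at s) \<and> y > 0"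
      using that(5,6) by (intro exI[of _ "1 / q s"]) simp
  qed
  have xs: "x s \<in> {-K<..<K}" if "s \<in> {0<..<1}" for s
    using strict[OF x(1), of 0 s n] strict[OF x(1), of s 1 n] xd n that x(2,3) by auto
  have zs: "z s \<in> {-K<..<K}" if "s \<in> {0<..<1}" for s
    using strict[OF z(1), of 0 s r] strict[OF z(1), of s 1 r] z(2)[of 0] z(2)[of 1] z(3) r(4) that by force
  have yK: "y s = (1 - \<nu>) * x s + \<nu> * z s" for s by (simp add: y_def algebra_simps)
  have ys: "y s \<in> {-K<..<K}" if "s \<in> {0<..<1}" for s
    unfolding yK using xs[OF that] zs[OF that] \<nu>
      convexD[of "{-K<..<K}" "x s" "z s" "1 - \<nu>" \<nu>] by auto
  have yS: "y s \<in> {-K..K}" if "s \<in> {0..1}" for s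
    unfolding yK using x(4)[OF that] z(2)[OF that] \<nu>
      convexD[of "{-K..K}" "x s" "z s" "1 - \<nu>" \<nu>] by auto
  have yd: "(y has_real_derivative (1 - \<nu>) * (1 / n s) + \<nu> * (1 / r s)) (at s)" if "s \<in> {0<..<1}" for s
    unfolding yK[abs_def] by (intro DERIV_add DERIV_cmult xd z that)
  have hy: "((\<lambda>s. \<mu> (y s) powr (\<theta> + 1) * ((1 - \<nu>) * (1 / n s) + \<nu> * (1 / r s))) has_integral P (y 1) - P (y 0)) {0..1}"
    by (rule sub) (use yc yS ys yd in auto)
  have hx: "((\<lambda>s. \<mu> (x s) powr (\<theta> + 1) * (1 / n s)) has_integral M1) {0..1}"
    using sub[OF x(1) x(4) xs xd] by (simp add: x M1_def P_def)
  \<comment> \<open>Young's inequality with b = \<mu>(y), once with a = n and once with a = r,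
    weighted by 1 - \<nu> and \<nu>. The remainders combine because y' is (1 - \<nu>) / n + \<nu> /
    r.\<close>
  have Y: "(\<theta> + 1) * Y \<le> (1 - \<nu>) * N + \<nu> * M2 + \<theta> * M1"
  proof -
    have "(\<theta> + 1) * Y \<le> (1 - \<nu>) * N + \<nu> * M2 + \<theta> * (P (y 1) - P (y 0))"
    proof (rule has_integral_le_interior)
      show "((\<lambda>s. (\<theta> + 1) * \<mu> (y s) powr \<theta>) has_integral (\<theta> + 1) * Y) {0..1}"
        by (intro has_integral_mult_right hY)
      show "((\<lambda>s. (1 - \<nu>) * n s powr \<theta> + \<nu> * r s powr \<theta>
           + \<theta> * (\<mu> (y s) powr (\<theta> + 1) * ((1 - \<nu>) * (1 / n s) + \<nu> * (1 / r s)))) has_integral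
           (1 - \<nu>) * N + \<nu> * M2 + \<theta> * (P (y 1) - P (y 0))) {0..1}"
        by (intro has_integral_add has_integral_mult_right hN hM2 hy)
      fix s :: real assume s: "s \<in> {0<..<1}"
      have "(1 - \<nu>) * ((\<theta> + 1) * \<mu> (y s) powr \<theta>) + \<nu> * ((\<theta> + 1) * \<mu> (y s) powr \<theta>)
          \<le> (1 - \<nu>) * (n s powr \<theta> + \<theta> * \<mu> (y s) powr (\<theta> + 1) / n s)
           + \<nu> * (r s powr \<theta> + \<theta> * \<mu> (y s) powr (\<theta> + 1) / r s)"
        using \<nu> \<theta> n r(4)[OF s] \<mu>(2) by (intro add_mono mult_left_mono powr_young) auto
      then show "(\<theta> + 1) * \<mu> (y s) powr \<theta> \<le> (1 - \<nu>) * n s powr \<theta> + \<nu> * r s powr \<theta>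
           + \<theta> * (\<mu> (y s) powr (\<theta> + 1) * ((1 - \<nu>) * (1 / n s) + \<nu> * (1 / r s)))"
        by (simp add: algebra_simps)
    qed
    moreover have "P (y 1) - P (y 0) \<le> M1"
      using Pmono[of "y 1" K] Pmono[of "-K" "y 0"] yS[of 0] yS[of 1] by (simp add: M1_def P_def)
    ultimately show ?thesis using \<theta> mult_left_mono[of "P (y 1) - P (y 0)" M1 \<theta>] by linarith
  qed
  \<comment> \<open>Young's inequality is nearly sharp for a = n, b = \<mu>(x), since \<mu>(x) / n
    is at most 1 + \<eta>. With the bound on \<open>N\<close> this closes the loop at the energy
    \<open>A\<close> of \<open>x\<close>.\<close>
  have M1: "M1 \<le> (1 + \<eta>) * A"
  proof (rule has_integral_le_interior[OF hx has_integral_mult_right[OF hA]])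
    fix s :: real
    have "\<mu> (x s) / n s \<le> 1 + \<eta>"
      using \<mu>(2)[of "x s"] \<eta> g by (simp add: n_def field_simps add_pos_nonneg add_nonneg_pos)
    then have "\<mu> (x s) powr \<theta> * (\<mu> (x s) / n s) \<le> \<mu> (x s) powr \<theta> * (1 + \<eta>)"
      by (intro mult_left_mono) auto
    then show "\<mu> (x s) powr (\<theta> + 1) * (1 / n s) \<le> (1 + \<eta>) * \<mu> (x s) powr \<theta>"
      using \<mu>(2)[of "x s"] by (simp add: powr_add mult.commute)
  qed
  have N: "N \<le> A + \<theta> * (B + g) powr (\<theta> - 1) * g * \<eta>"
  proof (rule has_integral_le_interior[OF hN])
    show "((\<lambda>s. \<mu> (x s) powr \<theta> + \<theta> * (B + g) powr (\<theta> - 1) * g * \<eta>) has_integral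
        A + \<theta> * (B + g) powr (\<theta> - 1) * g * \<eta>) {0..1}"
      using has_integral_add[OF hA has_integral_const_real[of "\<theta> * (B + g) powr (\<theta> - 1) * g * \<eta>" 0 1]] by simp
    fix s :: real
    have "\<eta> * g \<le> g" using \<eta> g by simp
    with \<mu>(3)[of "x s"] have g1: "\<mu> (x s) + \<eta> * g \<le> B + g" by linarith
    have "n s \<le> \<mu> (x s) + \<eta> * g"
      unfolding n_def using \<mu>(2)[of "x s"] \<eta> g by (simp add: divide_le_eq mult_left_mono algebra_simps)
    then have "n s powr \<theta> \<le> (\<mu> (x s) + \<eta> * g) powr \<theta>"
      using n[of s] \<theta> by (intro powr_mono2) auto
    also have "\<dots> \<le> \<mu> (x s) powr \<theta> + \<theta> * (B + g) powr (\<theta> - 1) * (\<eta> * g)"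
      using \<mu>(2)[of "x s"] \<eta> g \<theta> by (intro powr_add_le g1) auto
    finally show "n s powr \<theta> \<le> \<mu> (x s) powr \<theta> + \<theta> * (B + g) powr (\<theta> - 1) * g * \<eta>"
      by (simp add: algebra_simps)
  qed
  have A: "A \<le> B powr \<theta>"
  proof (rule has_integral_le_interior[OF hA])
    show "((\<lambda>s::real. B powr \<theta>) has_integral B powr \<theta>) {0..1}"
      using has_integral_const_real[of "B powr \<theta>" 0 1] by simp
  qed (use \<mu> \<theta> in \<open>auto intro: powr_mono2\<close>)
  have M2: "M2 \<le> N + (\<theta> + 1) * a * Z"
  proof -
    \<comment> \<open>Tests the equilibrium equation of \<open>z\<close> with x - z. The boundary
      terms vanish because \<open>r\<close> is zero at both ends.\<close>
    define w where "w s = r s powr (\<theta> + 1) * (x s - z s)" for s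
    have wd: "(w has_real_derivative - ((\<theta> + 1) / \<theta>) * a * z s * (x s - z s)
         + (1 / n s - 1 / r s) * r s powr (\<theta> + 1)) (at s)" if "s \<in> {0<..<1}" for s
      unfolding w_def by (intro DERIV_mult[OF r(5)[OF that] DERIV_diff[OF xd[OF that] z(3)[OF that]]])
    have "((\<lambda>s. - ((\<theta> + 1) / \<theta>) * a * z s * (x s - z s) + (1 / n s - 1 / r s) * r s powr (\<theta> + 1))
        has_integral w 1 - w 0) {0..1}"
    proof (rule fundamental_theorem_of_calculus_interior)
      show "continuous_on {0..1} w"
        unfolding w_def using r0 \<theta> by (intro continuous_intros x z continuous_on_powr' r) auto
    qed (use wd in \<open>auto simp: has_real_derivative_iff_has_vector_derivative\<close>)
    then have hw: "((\<lambda>s. - ((\<theta> + 1) / \<theta>) * a * z s * (x s - z s) + (1 / n s - 1 / r s) * r s powr (\<theta> + 1))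
        has_integral 0) {0..1}" by (simp add: w_def r)
    have "M2 \<le> N + \<theta> * 0 + (\<theta> + 1) * a * Z"
    proof (rule has_integral_le_interior[OF hM2])
      show "((\<lambda>s. n s powr \<theta> + \<theta> * (- ((\<theta> + 1) / \<theta>) * a * z s * (x s - z s)
          + (1 / n s - 1 / r s) * r s powr (\<theta> + 1)) + (\<theta> + 1) * a * (z s * (x s - z s)))
          has_integral N + \<theta> * 0 + (\<theta> + 1) * a * Z) {0..1}"
        by (intro has_integral_add has_integral_mult_right hN hw hZ)
      fix s :: real assume s: "s \<in> {0<..<1}"
      have *: "(\<theta> + 1) * r s powr \<theta> \<le> n s powr \<theta> + \<theta> * r s powr (\<theta> + 1) / n s"
        using n r(4)[OF s] \<theta> by (intro powr_young) auto
      have e1: "\<theta> * (- ((\<theta> + 1) / \<theta>) * a * z s * (x s - z s)) = - ((\<theta> + 1) * a * (z s * (x s - z s)))"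
        using \<theta> by simp
      have e2: "(1 / n s - 1 / r s) * r s powr (\<theta> + 1) = r s powr (\<theta> + 1) / n s - r s powr \<theta>"
        using r(4)[OF s] by (simp add: left_diff_distrib powr_add)
      show "r s powr \<theta> \<le> n s powr \<theta> + \<theta> * (- ((\<theta> + 1) / \<theta>) * a * z s * (x s - z s)
          + (1 / n s - 1 / r s) * r s powr (\<theta> + 1)) + (\<theta> + 1) * a * (z s * (x s - z s))"
        unfolding e2 distrib_left e1 using * by (simp add: algebra_simps)
    qed
    then show ?thesis by simp
  qed
  \<comment> \<open>The (1 - \<nu>) N and \<nu> M2 add up to N plus the confinement term, and N +
    \<theta> M1 is (\<theta> + 1) A up to multiples of \<eta>.\<close>
  have "(\<theta> + 1) * (Y - A) \<le> (\<theta> + 1) * (\<nu> * a * Z) + (\<theta> * (B + g) powr (\<theta> - 1) * g + \<theta> * B powr \<theta>) * \<eta>"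
  proof -
    have "\<nu> * M2 \<le> \<nu> * (N + (\<theta> + 1) * a * Z)" using M2 \<nu> by (intro mult_left_mono) auto
    moreover have "\<theta> * M1 \<le> \<theta> * ((1 + \<eta>) * A)" using M1 \<theta> by (intro mult_left_mono) auto
    moreover have "\<theta> * \<eta> * A \<le> \<theta> * \<eta> * B powr \<theta>" using A \<theta> \<eta> by (intro mult_left_mono) auto
    ultimately show ?thesis using Y N by (simp add: algebra_simps)
  qed
  \<comment> \<open>Enlarging the error by the factor \<theta> + 1 allows this factor to be
    cancelled throughout.\<close>
  moreover have "(\<theta> * (B + g) powr (\<theta> - 1) * g + \<theta> * B powr \<theta>) * \<eta> * 1
      \<le> (\<theta> * (B + g) powr (\<theta> - 1) * g + \<theta> * B powr \<theta>) * \<eta> * (\<theta> + 1)"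
    using \<theta> \<eta> g by (intro mult_left_mono mult_nonneg_nonneg add_nonneg_nonneg) auto
  ultimately have "(\<theta> + 1) * (Y - A) \<le> (\<theta> + 1) * (\<nu> * a * Z + (\<theta> * (B + g) powr (\<theta> - 1) * g + \<theta> * B powr \<theta>) * \<eta>)"
    by (simp add: algebra_simps)
  then have "Y - A \<le> \<nu> * a * Z + (\<theta> * (B + g) powr (\<theta> - 1) * g + \<theta> * B powr \<theta>) * \<eta>"
    using \<theta> by (subst (asm) mult_le_cancel_left_pos) auto
  moreover have "integral {0..1} (\<lambda>s. \<mu> (x s - \<nu> * (x s - z s)) powr \<theta> - \<mu> (x s) powr \<theta>) = Y - A"
    using has_integral_diff[OF hY hA] by (simp add: integral_unique y_def)
  ultimately show ?thesis by (simp add: Z_def g_def)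
qed


section \<open>Quantile function of the self-similar profile\<close>

definition phi_cdf :: "real \<Rightarrow> real \<Rightarrow> real" where
  "phi_cdf \<theta> x = integral {- R_alpha \<theta>..x} (phi \<theta>)"

definition phi_quantile :: "real \<Rightarrow> real \<Rightarrow> real" where
  "phi_quantile \<theta> = inv_into {- R_alpha \<theta>..R_alpha \<theta>} (phi_cdf \<theta>)"

context
  fixes \<theta> :: real
  assumes \<theta>: "\<theta> > 0"
begin

abbreviation "R \<equiv> R_alpha \<theta>"

text \<open>The second derivative of t^\<alpha> is - \<open>curv\<close> t^(\<alpha> - 2), so this
  is the strength of the inverse-square force acting on the self-similar trajectories.\<close>

abbreviation "curv \<equiv> alpha \<theta> * (1 - alpha \<theta>)"

lemma curv_pos: "curv > 0"
  using alpha_bounds[OF \<theta>] by simp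

lemma phi_cont: "continuous_on S (phi \<theta>)"
  unfolding phi_def by (rule continuous_on_profile[OF \<theta>])

lemma phi_nonneg: "phi \<theta> x \<ge> 0"
  by (simp add: phi_def profile_def)

lemma phi_zero: "\<bar>x\<bar> \<ge> R \<Longrightarrow> phi \<theta> x = 0"
  unfolding phi_def using profile_eq_0[OF \<theta> R_alpha(1)[OF \<theta>]] .

lemma phi_inside:
  assumes "\<bar>x\<bar> < R"
  shows "curv / 2 * (R\<^sup>2 - x\<^sup>2) > 0" "phi \<theta> x = (curv / 2 * (R\<^sup>2 - x\<^sup>2)) powr (1 / \<theta>)" "phi \<theta> x > 0"
proof -
  have "x\<^sup>2 < R\<^sup>2" using assms by (metis abs_le_square_iff abs_of_pos R_alpha(1)[OF \<theta>] not_le)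
  then show *: "curv / 2 * (R\<^sup>2 - x\<^sup>2) > 0" using curv_pos by simp
  then show "phi \<theta> x = (curv / 2 * (R\<^sup>2 - x\<^sup>2)) powr (1 / \<theta>)"
    unfolding phi_def profile_def by (simp add: max_def)
  with * show "phi \<theta> x > 0" by (metis powr_gt_zero less_irrefl)
qed

lemma phi_integral: "integral {- R..R} (phi \<theta>) = 1"
proof -
  have "integrable lborel (phi \<theta>)"
    unfolding phi_def by (rule integrable_profile[OF \<theta> R_alpha(1)[OF \<theta>]])
  then have "(phi \<theta> has_integral 1) UNIV"
    using has_integral_integral_lborel[of "phi \<theta>"] R_alpha(2)[OF \<theta>] by simp
  moreover have "((\<lambda>x. if x \<in> {- R..R} then phi \<theta> x else 0) has_integral integral {- R..R} (phi \<theta>)) UNIV"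
    by (subst has_integral_restrict_UNIV) (intro integrable_integral integrable_continuous_interval phi_cont)
  moreover have "(\<lambda>x. if x \<in> {- R..R} then phi \<theta> x else 0) = phi \<theta>"
  proof
    show "(if x \<in> {- R..R} then phi \<theta> x else 0) = phi \<theta> x" for x
      using phi_zero[of x] by (cases "x \<in> {- R..R}") auto
  qed
  ultimately show ?thesis by (metis has_integral_unique)
qed

lemma phi_cdf_deriv: "x \<in> {- R<..<R} \<Longrightarrow> (phi_cdf \<theta> has_real_derivative phi \<theta> x) (at x)"
  unfolding phi_cdf_def[abs_def] by (intro integral_upper_derivative phi_cont) auto

lemma phi_cdf_cont: "continuous_on {- R..R} (phi_cdf \<theta>)"
  unfolding phi_cdf_def[abs_def]
  by (intro indefinite_integral_continuous_1 integrable_continuous_interval phi_cont)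

lemma phi_cdf_ends: "phi_cdf \<theta> (- R) = 0" "phi_cdf \<theta> R = 1"
  by (simp_all add: phi_cdf_def phi_integral)

lemma phi_cdf_strict:
  assumes "- R \<le> x" "x < y" "y \<le> R"
  shows "phi_cdf \<theta> x < phi_cdf \<theta> y"
proof (rule DERIV_pos_imp_increasing_open[OF assms(2)])
  show "\<exists>d. (phi_cdf \<theta> has_real_derivative d) (at v) \<and> d > 0" if "x < v" "v < y" for v
    using phi_cdf_deriv[of v] phi_inside(3)[of v] that assms by (intro exI[of _ "phi \<theta> v"]) auto
  show "continuous_on {x..y} (phi_cdf \<theta>)"
    by (rule continuous_on_subset[OF phi_cdf_cont]) (use assms in auto)
qed

lemma phi_cdf_inj: "inj_on (phi_cdf \<theta>) {- R..R}"
  by (rule linorder_inj_onI) (metis phi_cdf_strict atLeastAtMost_iff less_irrefl, auto)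

lemma phi_cdf_image: "phi_cdf \<theta> ` {- R..R} = {0..1}"
proof (intro equalityI subsetI)
  fix s assume "s \<in> phi_cdf \<theta> ` {- R..R}"
  then obtain x where x: "x \<in> {- R..R}" "s = phi_cdf \<theta> x" by blast
  then show "s \<in> {0..1}"
    using phi_cdf_strict[of "- R" x] phi_cdf_strict[of x R] phi_cdf_ends
    by (cases "x = - R"; cases "x = R") auto
next
  fix s :: real assume "s \<in> {0..1}"
  then show "s \<in> phi_cdf \<theta> ` {- R..R}"
    using IVT'[of "phi_cdf \<theta>" "- R" s R] phi_cdf_ends phi_cdf_cont R_alpha(1)[OF \<theta>] by auto
qed

lemma phi_quantile_range: "s \<in> {0..1} \<Longrightarrow> phi_quantile \<theta> s \<in> {- R..R}"
  unfolding phi_quantile_def by (rule inv_into_into) (simp add: phi_cdf_image)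

lemma phi_cdf_quantile: "s \<in> {0..1} \<Longrightarrow> phi_cdf \<theta> (phi_quantile \<theta> s) = s"
  unfolding phi_quantile_def by (rule f_inv_into_f) (simp add: phi_cdf_image)

lemma phi_quantile_cdf: "x \<in> {- R..R} \<Longrightarrow> phi_quantile \<theta> (phi_cdf \<theta> x) = x"
  unfolding phi_quantile_def by (rule inv_into_f_f[OF phi_cdf_inj])

lemma phi_quantile_cont: "continuous_on {0..1} (phi_quantile \<theta>)"
  using continuous_on_inv[OF phi_cdf_cont compact_Icc, of "phi_quantile \<theta>"] phi_quantile_cdf
  by (simp add: phi_cdf_image)

lemma phi_quantile_ends: "phi_quantile \<theta> 0 = - R" "phi_quantile \<theta> 1 = R"
  using phi_quantile_cdf[of "- R"] phi_quantile_cdf[of R] phi_cdf_ends R_alpha(1)[OF \<theta>] by auto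

lemma phi_quantile_inside:
  assumes s: "s \<in> {0<..<1}"
  shows "\<bar>phi_quantile \<theta> s\<bar> < R"
proof -
  have "s \<in> {0..1}" using s by auto
  note phi_quantile_range[OF this] phi_cdf_quantile[OF this]
  moreover have "phi_quantile \<theta> s \<noteq> - R" "phi_quantile \<theta> s \<noteq> R"
    using calculation(2) phi_cdf_ends s by auto
  ultimately show ?thesis by auto
qed

lemma phi_quantile_deriv:
  assumes s: "s \<in> {0<..<1}"
  shows "(phi_quantile \<theta> has_real_derivative 1 / phi \<theta> (phi_quantile \<theta> s)) (at s)"
proof -
  have "(phi_quantile \<theta> has_real_derivative inverse (phi \<theta> (phi_quantile \<theta> s))) (at s)"
  proof (rule DERIV_inverse_function[of "phi_cdf \<theta>" _ _ _ 0 1])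
    show "isCont (phi_quantile \<theta>) s"
      using continuous_on_interior[OF phi_quantile_cont] s by simp
  qed (use phi_quantile_inside[OF s] phi_inside(3) s in \<open>auto intro!: phi_cdf_deriv phi_cdf_quantile simp: less_imp_neq[symmetric]\<close>)
  then show ?thesis by (simp add: inverse_eq_divide)
qed

text \<open>The equilibrium equation of the profile: phi^\<theta> is \<open>curv\<close> (R^2 - q^2)
  / 2 and q' = 1 / phi, so one factor phi cancels.\<close>

lemma phi_along_quantile_deriv:
  assumes s: "s \<in> {0<..<1}"
  shows "((\<lambda>s. phi \<theta> (phi_quantile \<theta> s) powr (\<theta> + 1)) has_real_derivative
    - ((\<theta> + 1) / \<theta>) * curv * phi_quantile \<theta> s) (at s)"
proof -
  let ?q = "phi_quantile \<theta>"
  let ?k = "\<lambda>s. curv / 2 * (R\<^sup>2 - (?q s)\<^sup>2)"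
  have k: "?k s > 0" and \<phi>: "phi \<theta> (?q s) = ?k s powr (1 / \<theta>)" if "s \<in> {0<..<1}" for s
    using phi_inside[OF phi_quantile_inside[OF that]] by auto
  have "(?k has_real_derivative - curv * ?q s * (1 / phi \<theta> (?q s))) (at s)"
    by (auto intro!: derivative_eq_intros phi_quantile_deriv[OF s])
  from DERIV_powr[OF this k[OF s] DERIV_const[of "(\<theta> + 1) / \<theta>"]]
  have D: "((\<lambda>s. ?k s powr ((\<theta> + 1) / \<theta>)) has_real_derivative
      ?k s powr ((\<theta> + 1) / \<theta>) * (- curv * ?q s * (1 / phi \<theta> (?q s)) * ((\<theta> + 1) / \<theta>) / ?k s)) (at s)"
    by simp
  define k0 where "k0 = ?k s"
  have k0: "k0 > 0" using k[OF s] by (simp add: k0_def)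
  then have "k0 powr ((\<theta> + 1) / \<theta>) = k0 * k0 powr (1 / \<theta>)"
    using \<theta> by (simp add: add_divide_distrib powr_add)
  then have eq: "?k s powr ((\<theta> + 1) / \<theta>) * (- curv * ?q s * (1 / phi \<theta> (?q s)) * ((\<theta> + 1) / \<theta>) / ?k s)
      = - ((\<theta> + 1) / \<theta>) * curv * ?q s"
    unfolding \<phi>[OF s] k0_def[symmetric] using k0 by simp
  show ?thesis
  proof (rule has_field_derivative_transform_within_open[OF D[unfolded eq], of "{0<..<1}"])
    fix s :: real assume s: "s \<in> {0<..<1}"
    show "?k s powr ((\<theta> + 1) / \<theta>) = phi \<theta> (?q s) powr (\<theta> + 1)"
      unfolding \<phi>[OF s] powr_powr using \<theta> by simp
  qed (use s in auto)
qed

end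


section \<open>The action along interpolating curves\<close>

lemma continuous_on_second_arg:
  fixes f h :: "real \<Rightarrow> real \<Rightarrow> real"
  assumes "continuous_on (I \<times> UNIV) (\<lambda>(t, x). f t x)" "D \<subseteq> I"
    and "continuous_on (D \<times> J) (\<lambda>w. h (fst w) (snd w))"
  shows "continuous_on (D \<times> J) (\<lambda>w. f (fst w) (h (fst w) (snd w)))"
proof -
  have "continuous_on (D \<times> J) (\<lambda>w. (fst w, h (fst w) (snd w)))"
    by (intro continuous_intros assms)
  moreover have "(\<lambda>w. (fst w, h (fst w) (snd w))) ` (D \<times> J) \<subseteq> I \<times> UNIV"
    using assms(2) by auto
  ultimately show ?thesis
    using continuous_on_compose2[OF assms(1), of "D \<times> J" "\<lambda>w. (fst w, h (fst w) (snd w))"] by simp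
qed

text \<open>The derivatives \<open>p\<close> and \<open>ut\<close> of \<open>u\<close> are available
  at interior times only; on the closed strip there is just the Lipschitz bound.
  \<open>K_large\<close> keeps the self-similar solution inside \<open>{- K..K}\<close> up to time
  \<open>T\<close>.\<close>

locale mfg_data = mass_flow +
  fixes \<theta> \<epsilon> B :: real and u ut :: "real \<Rightarrow> real \<Rightarrow> real"
  assumes \<theta>: "\<theta> \<ge> 1" and \<epsilon>: "\<epsilon> > 0"
    and u_lipschitz: "L-lipschitz_on ({0..T} \<times> UNIV) (\<lambda>(t, x). u t x)"
    and u_deriv_x: "\<And>t x. t \<in> {0<..<T} \<Longrightarrow> (u t has_real_derivative p t x) (at x)"
    and u_deriv_t: "\<And>t x. t \<in> {0<..<T} \<Longrightarrow> ((\<lambda>t. u t x) has_real_derivative ut t x) (at t)"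
    and ut_cont: "continuous_on ({0<..<T} \<times> UNIV) (\<lambda>(t, x). ut t x)"
    and hamilton_jacobi: "\<And>t x. t \<in> {0<..<T} \<Longrightarrow> - ut t x + 1/2 * (p t x)\<^sup>2 = m t x powr \<theta>"
    and m_bound: "\<And>t x. t \<in> {0..T} \<Longrightarrow> m t x \<le> B"
    and K_large: "R_alpha \<theta> * (T + \<epsilon>) powr alpha \<theta> \<le> K"
begin

lemma \<theta>0: "\<theta> > 0" using \<theta> by simp

end

locale mfg_flow = mfg_data + regularized_flow +
  assumes \<eta>1: "\<eta> \<le> 1"
begin

definition Z :: "real \<Rightarrow> real \<Rightarrow> real" where
  "Z t s = (t + \<epsilon>) powr alpha \<theta> * phi_quantile \<theta> s"

definition Zt :: "real \<Rightarrow> real \<Rightarrow> real" where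
  "Zt t s = alpha \<theta> * (t + \<epsilon>) powr (alpha \<theta> - 1) * phi_quantile \<theta> s"

definition W :: "real \<Rightarrow> real \<Rightarrow> real" where
  "W t s = X t s - Z t s"

definition Wt :: "real \<Rightarrow> real \<Rightarrow> real" where
  "Wt t s = V t (X t s) - Zt t s"

definition speed :: real where
  "speed = L + \<epsilon> powr (alpha \<theta> - 1) * R_alpha \<theta>"

text \<open>The first summand is half the bound of \<open>V_error_integral\<close>, the rest is the
  error constant of \<open>energy_comparison\<close>.\<close>

definition C0 :: real where
  "C0 = L\<^sup>2 / 2 + (\<theta> * (B + 1 / (2 * K)) powr (\<theta> - 1) / (2 * K) + \<theta> * B powr \<theta>)"

lemma alpha01: "0 < alpha \<theta>" "alpha \<theta> < 1"
  using alpha_bounds[OF \<theta>0] by auto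

lemma R_pos: "R_alpha \<theta> > 0"
  by (rule R_alpha(1)[OF \<theta>0])

lemma quantile_bound: "s \<in> {0..1} \<Longrightarrow> \<bar>phi_quantile \<theta> s\<bar> \<le> R_alpha \<theta>"
  using phi_quantile_range[OF \<theta>0, of s] by auto

lemma Z_bounds:
  assumes "t \<in> {0..T}" "s \<in> {0..1}"
  shows "Z t s \<in> {- K..K}"
proof -
  have "\<bar>Z t s\<bar> = (t + \<epsilon>) powr alpha \<theta> * \<bar>phi_quantile \<theta> s\<bar>"
    by (simp add: Z_def abs_mult)
  also have "\<dots> \<le> (T + \<epsilon>) powr alpha \<theta> * R_alpha \<theta>"
    using assms \<epsilon> alpha01 quantile_bound by (intro mult_mono powr_mono2) auto
  also have "\<dots> \<le> K" using K_large by (simp add: mult.commute)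
  finally show ?thesis by auto
qed

lemma Zt_bound:
  assumes "t \<in> {0..T}" "s \<in> {0..1}"
  shows "\<bar>Zt t s\<bar> \<le> \<epsilon> powr (alpha \<theta> - 1) * R_alpha \<theta>"
proof -
  have "\<bar>Zt t s\<bar> = alpha \<theta> * ((t + \<epsilon>) powr (alpha \<theta> - 1) * \<bar>phi_quantile \<theta> s\<bar>)"
    using alpha01 by (simp add: Zt_def abs_mult)
  also have "\<dots> \<le> 1 * (\<epsilon> powr (alpha \<theta> - 1) * R_alpha \<theta>)"
    using assms \<epsilon> alpha01 R_pos quantile_bound by (intro mult_mono powr_mono2') auto
  finally show ?thesis by simp
qed

lemma W_bound:
  assumes "t \<in> {0..T}" "s \<in> {0..1}"
  shows "\<bar>W t s\<bar> \<le> 2 * K"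
  using X_bounds[OF assms] Z_bounds[OF assms] by (auto simp: W_def)

lemma Wt_bound:
  assumes "t \<in> {0<..<T}" "s \<in> {0..1}"
  shows "\<bar>Wt t s\<bar> \<le> speed"
  using V_bound[OF assms(1), of "X t s"] Zt_bound[of t s] assms by (auto simp: Wt_def speed_def)

lemma Z_deriv_t:
  assumes "t \<ge> 0"
  shows "((\<lambda>t. Z t s) has_real_derivative Zt t s) (at t)"
  unfolding Z_def Zt_def using assms \<epsilon>
  by (auto intro!: derivative_eq_intros simp: powr_diff field_simps)

text \<open>The explicit curve \<open>Z\<close> is the only one that is differentiated twice in
  time; its acceleration matches the confinement coefficient in
  \<open>energy_comparison\<close>.\<close>

lemma Zt_deriv_t:
  assumes "t \<ge> 0"
  shows "((\<lambda>t. Zt t s) has_real_derivative - (curv \<theta> / (t + \<epsilon>)\<^sup>2) * Z t s) (at t)"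
proof -
  have "((\<lambda>t. Zt t s) has_real_derivative
      alpha \<theta> * ((alpha \<theta> - 1) * (t + \<epsilon>) powr (alpha \<theta> - 1 - 1)) * phi_quantile \<theta> s) (at t)"
    unfolding Zt_def using assms \<epsilon> by (auto intro!: derivative_eq_intros)
  moreover have "(t + \<epsilon>) powr (alpha \<theta> - 1 - 1) = (t + \<epsilon>) powr alpha \<theta> / (t + \<epsilon>)\<^sup>2"
    using assms \<epsilon> by (simp add: powr_diff power2_eq_square)
  ultimately show ?thesis by (simp add: Z_def algebra_simps diff_divide_distrib)
qed

lemma W_deriv_t:
  "t \<in> {0<..<T} \<Longrightarrow> ((\<lambda>t. W t s) has_real_derivative Wt t s) (at t)"
  unfolding W_def Wt_def by (intro DERIV_diff X_deriv_t Z_deriv_t) auto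

lemma time_cont:
  assumes "continuous_on D g"
  shows "continuous_on (D \<times> J) (\<lambda>w::real \<times> real. g (fst w) :: real)"
  by (rule continuous_on_compose2[OF assms]) (auto intro!: continuous_intros)

lemma quantile_cont: "continuous_on (D \<times> {0..1}) (\<lambda>w::real \<times> real. phi_quantile \<theta> (snd w))"
  by (rule continuous_on_compose2[OF phi_quantile_cont[OF \<theta>0]]) (auto intro!: continuous_intros)

lemma XZ_cont:
  assumes "D \<subseteq> {0..T}"
  shows "continuous_on (D \<times> {0..1}) (\<lambda>w. X (fst w) (snd w))"
    "continuous_on (D \<times> {0..1}) (\<lambda>w. Z (fst w) (snd w))"
    "continuous_on (D \<times> {0..1}) (\<lambda>w. Zt (fst w) (snd w))"
    "continuous_on (D \<times> {0..1}) (\<lambda>w. W (fst w) (snd w))"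
proof -
  show X: "continuous_on (D \<times> {0..1}) (\<lambda>w. X (fst w) (snd w))"
    by (rule continuous_on_subset[OF X_cont[unfolded split_beta']]) (use assms in auto)
  have p: "continuous_on D (\<lambda>t. (t + \<epsilon>) powr e)" for e
    using assms \<epsilon> by (intro continuous_intros) force
  show Z: "continuous_on (D \<times> {0..1}) (\<lambda>w. Z (fst w) (snd w))"
    "continuous_on (D \<times> {0..1}) (\<lambda>w. Zt (fst w) (snd w))"
    unfolding Z_def Zt_def by (intro continuous_intros time_cont p quantile_cont)+
  show "continuous_on (D \<times> {0..1}) (\<lambda>w. W (fst w) (snd w))"
    unfolding W_def by (intro continuous_intros X Z)
qed

lemma slice_cont:
  assumes "t \<in> {0..T}"
  shows "continuous_on {0..1} (X t)" "continuous_on {0..1} (Z t)" "continuous_on {0..1} (Zt t)"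
    "continuous_on {0..1} (W t)"
  using XZ_cont[of "{0..T}"] assms
  by (auto simp: split_beta' intro: continuous_on_slices(1)[of "{0..T}" "{0..1}"])

lemma energy_step:
  assumes t: "t \<in> {0<..<T}" and \<nu>: "0 \<le> \<nu>" "\<nu> \<le> 1"
  shows "integral {0..1} (\<lambda>s. m t (X t s - \<nu> * W t s) powr \<theta> - m t (X t s) powr \<theta>)
    \<le> \<nu> * (curv \<theta> / (t + \<epsilon>)\<^sup>2) * integral {0..1} (\<lambda>s. Z t s * W t s) + (C0 - L\<^sup>2 / 2) * \<eta>"
proof -
  define \<tau> where "\<tau> = t + \<epsilon>"
  have \<tau>: "\<tau> > 0" using t \<epsilon> by (simp add: \<tau>_def)
  have tT: "t \<in> {0..T}" using t by auto
  \<comment> \<open>Density of the self-similar solution at time t along its own quantile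
    function.\<close>
  define r where "r s = \<tau> powr (- alpha \<theta>) * phi \<theta> (phi_quantile \<theta> s)" for s
  have "integral {0..1} (\<lambda>s. m t (X t s - \<nu> * (X t s - Z t s)) powr \<theta> - m t (X t s) powr \<theta>)
    \<le> \<nu> * (curv \<theta> / \<tau>\<^sup>2) * integral {0..1} (\<lambda>s. Z t s * (X t s - Z t s))
      + (\<theta> * (B + 1 / (2 * K)) powr (\<theta> - 1) / (2 * K) + \<theta> * B powr \<theta>) * \<eta>"
  proof (rule energy_comparison[where r=r])
    show "(X t has_real_derivative (1 + \<eta>) / (m t (X t s) + \<eta> / (2 * K))) (at s)" for s
      using X_deriv_s[OF tT, of s] by (simp add: n_def)
    show "(Z t has_real_derivative 1 / r s) (at s)" if "s \<in> {0<..<1}" for s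
    proof -
      have "(Z t has_real_derivative \<tau> powr alpha \<theta> * (1 / phi \<theta> (phi_quantile \<theta> s))) (at s)"
        unfolding Z_def[abs_def] \<tau>_def by (intro DERIV_cmult phi_quantile_deriv \<theta>0 that)
      then show ?thesis by (simp add: r_def powr_minus field_simps)
    qed
    show "((\<lambda>s. r s powr (\<theta> + 1)) has_real_derivative - ((\<theta> + 1) / \<theta>) * (curv \<theta> / \<tau>\<^sup>2) * Z t s) (at s)"
      if "s \<in> {0<..<1}" for s
    proof -
      \<comment> \<open>The scaling relation that fixes \<alpha>: the pressure term scales like
        \<tau>^(\<alpha> - 2), exactly as the acceleration of \<tau>^\<alpha> does.\<close>
      have a2: "alpha \<theta> * (\<theta> + 1) = 2 - alpha \<theta>" using \<theta>0 by (simp add: alpha_def field_simps)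
      have "(\<tau> powr (- alpha \<theta>)) powr (\<theta> + 1) = \<tau> powr (alpha \<theta> - 2)"
        unfolding powr_powr using a2 by simp
      also have "\<dots> = \<tau> powr alpha \<theta> / \<tau>\<^sup>2" using \<tau> by (simp add: powr_diff)
      finally have "(\<lambda>s. r s powr (\<theta> + 1)) =
          (\<lambda>s. \<tau> powr alpha \<theta> / \<tau>\<^sup>2 * phi \<theta> (phi_quantile \<theta> s) powr (\<theta> + 1))"
        using phi_nonneg[OF \<theta>0] by (simp add: r_def powr_mult)
      then show ?thesis
        using DERIV_cmult[OF phi_along_quantile_deriv[OF \<theta>0 that], of "\<tau> powr alpha \<theta> / \<tau>\<^sup>2"]
        by (simp add: Z_def \<tau>_def algebra_simps diff_divide_distrib add_divide_distrib)
    qed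
    show "continuous_on {0..1} r"
      unfolding r_def
      by (intro continuous_intros continuous_on_compose2[OF phi_cont[OF \<theta>0] phi_quantile_cont[OF \<theta>0]]) auto
    show "r s > 0" if "s \<in> {0<..<1}" for s
      using phi_inside(3)[OF \<theta>0 phi_quantile_inside[OF \<theta>0 that]] \<tau> by (simp add: r_def)
    show "continuous_on UNIV (m t)" by (rule m_cont_x[OF tT])
  qed (use tT \<nu> \<theta> \<eta> \<eta>1 K_pos m_nonneg m_bound slice_cont X_bounds Z_bounds X_ends phi_quantile_ends[OF \<theta>0]
       phi_zero[OF \<theta>0] R_pos in \<open>auto simp: r_def\<close>)
  then show ?thesis by (simp add: W_def \<tau>_def C0_def)
qed

text \<open>The competitor \<open>X - \<nu> W\<close> moves the quantile function towards the self-similar one. Along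
  any curve the Hamilton-Jacobi equation bounds the growth of \<open>u\<close> from below by minus the
  Lagrangian, with equality (up to the regularisation) along the flow itself.\<close>

lemma action_derivative_le:
  assumes t: "t \<in> {0<..<T}" and \<nu>: "0 \<le> \<nu>" "\<nu> \<le> 1"
  shows "integral {0..1} (\<lambda>s.
      (ut t (X t s) + p t (X t s) * V t (X t s))
      - (ut t (X t s - \<nu> * W t s) + p t (X t s - \<nu> * W t s) * (V t (X t s) - (\<nu>' * W t s + \<nu> * Wt t s)))
      + (\<nu>' * W t s + \<nu> * Wt t s) * Zt t s - \<nu> * W t s * (curv \<theta> / (t + \<epsilon>)\<^sup>2 * Z t s))
    \<le> integral {0..1} (\<lambda>s. (\<nu>' * W t s + \<nu> * Wt t s)\<^sup>2 / 2 - Wt t s * (\<nu>' * W t s + \<nu> * Wt t s)) + C0 * \<eta>"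
    (is "integral {0..1} ?f \<le> integral {0..1} ?g + _")
proof -
  have tT: "t \<in> {0..T}" using t by auto
  have pc: "continuous_on {0..1} (\<lambda>s. p t (h s))" "continuous_on {0..1} (\<lambda>s. V t (h s))"
    "continuous_on {0..1} (\<lambda>s. ut t (h s))" "continuous_on {0..1} (\<lambda>s. m t (h s))"
    if "continuous_on {0..1} h" for h
    using continuous_on_compose2[OF continuous_on_slices(1)[OF p_cont t] that]
      continuous_on_compose2[OF continuous_on_slices(1)[OF V_cont t] that]
      continuous_on_compose2[OF continuous_on_slices(1)[OF ut_cont t] that]
      continuous_on_compose2[OF m_cont_x[OF tT, of UNIV] that] by auto
  have Yc: "continuous_on {0..1} (\<lambda>s. X t s - \<nu> * W t s)"
    by (intro continuous_intros slice_cont tT)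
  have mc: "continuous_on {0..1} (\<lambda>s. m t (h s) powr \<theta>)" if "continuous_on {0..1} h" for h
    using pc(4)[OF that] m_nonneg[OF tT] \<theta>0 by (intro continuous_on_powr' continuous_intros) auto
  have Wtc: "continuous_on {0..1} (Wt t)"
    unfolding Wt_def by (intro continuous_intros pc slice_cont tT)
  note cc = continuous_intros pc mc slice_cont[OF tT] Yc Wtc
  note ii = integrable_integral[OF integrable_continuous_interval]
  define e where "e s = (V t (X t s) + p t (X t s))\<^sup>2" for s
  define d where "d s = m t (X t s - \<nu> * W t s) powr \<theta> - m t (X t s) powr \<theta>" for s
  have h1: "(e has_integral integral {0..1} e) {0..1}" unfolding e_def by (intro ii cc)
  have h2: "(d has_integral integral {0..1} d) {0..1}" unfolding d_def by (intro ii cc)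
  have h3: "(?g has_integral integral {0..1} ?g) {0..1}" by (intro ii cc) auto
  have h4: "((\<lambda>s. Z t s * W t s) has_integral integral {0..1} (\<lambda>s. Z t s * W t s)) {0..1}" by (intro ii cc)
  have h5: "(?f has_integral integral {0..1} ?f) {0..1}" by (intro ii cc)
  let ?c = "curv \<theta> / (t + \<epsilon>)\<^sup>2"
  have "integral {0..1} ?f \<le> 1/2 * integral {0..1} e + integral {0..1} d + integral {0..1} ?g
      - \<nu> * ?c * integral {0..1} (\<lambda>s. Z t s * W t s)"
  proof (rule has_integral_le[OF h5])
    show "((\<lambda>s. 1/2 * e s + d s + ?g s - \<nu> * ?c * (Z t s * W t s)) has_integral
      1/2 * integral {0..1} e + integral {0..1} d + integral {0..1} ?g
      - \<nu> * ?c * integral {0..1} (\<lambda>s. Z t s * W t s)) {0..1}"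
      by (intro has_integral_diff has_integral_add has_integral_mult_right h1 h2 h3 h4)
    fix s :: real
    let ?x = "X t s" and ?y = "X t s - \<nu> * W t s" and ?D = "\<nu>' * W t s + \<nu> * Wt t s" and ?v = "V t (X t s)"
    have ut: "ut t x = 1/2 * (p t x)\<^sup>2 - m t x powr \<theta>" for x using hamilton_jacobi[OF t, of x] by linarith
    have v: "?v = Zt t s + Wt t s" by (simp add: Wt_def)
    \<comment> \<open>Both Hamilton-Jacobi terms complete to squares, with velocity z + w along the
      flow and z + w - D along the competitor. The first square is the velocity error; the last has
      a minus sign and is dropped, which is the calibration inequality.\<close>
    have id: "(1/2 * P\<^sup>2 - mx + P * (z + w)) - (1/2 * q\<^sup>2 - my + q * ((z + w) - D)) + D * z - k
        = 1/2 * (z + w + P)\<^sup>2 + (my - mx) + (D\<^sup>2 / 2 - w * D) - k - 1/2 * (q + ((z + w) - D))\<^sup>2"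
      for P q mx my z w D k :: real
      by (simp add: power2_eq_square field_simps)
    have "?f s = 1/2 * e s + d s + ?g s - \<nu> * W t s * (?c * Z t s) - 1/2 * (p t ?y + (?v - ?D))\<^sup>2"
      unfolding e_def d_def ut v by (rule id)
    also have "\<dots> \<le> 1/2 * e s + d s + ?g s - \<nu> * ?c * (Z t s * W t s)" by (simp add: mult_ac)
    finally show "?f s \<le> 1/2 * e s + d s + ?g s - \<nu> * ?c * (Z t s * W t s)" .
  qed
  moreover have "integral {0..1} e \<le> L\<^sup>2 * \<eta>"
    unfolding e_def by (rule V_error_integral[OF t])
  moreover have "integral {0..1} d \<le> \<nu> * ?c * integral {0..1} (\<lambda>s. Z t s * W t s) + (C0 - L\<^sup>2 / 2) * \<eta>"
    unfolding d_def by (rule energy_step[OF t \<nu>])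
  ultimately show ?thesis by (simp add: algebra_simps)
qed

end


section \<open>Monotonicity of the rescaled distance\<close>

context mfg_flow
begin

definition Lam :: "real \<Rightarrow> (real \<Rightarrow> real) \<Rightarrow> (real \<Rightarrow> real) \<Rightarrow> real \<Rightarrow> real" where
  "Lam \<delta> \<zeta> \<sigma> t = integral {0..1} (\<lambda>s.
     (u t (X t s) - u t (X t s - \<delta> * \<zeta> t * W t s) + \<delta> * \<zeta> t * W t s * Zt t s) / \<delta> + \<sigma> t * (W t s)\<^sup>2)"

lemma u_cont: "continuous_on ({0..T} \<times> UNIV) (\<lambda>(t, x). u t x)"
  using lipschitz_on_continuous_on[OF u_lipschitz] .

lemma u_along_curve:
  assumes t: "t \<in> {0<..<T}" and "(\<gamma> has_real_derivative g) (at t)"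
  shows "((\<lambda>t. u t (\<gamma> t)) has_real_derivative ut t (\<gamma> t) + p t (\<gamma> t) * g) (at t)"
  using t assms(2)
  by (intro chain_rule_partials[where I="{0<..<T}" and J=UNIV and ft=ut])
    (auto intro: u_deriv_t u_deriv_x ut_cont)

text \<open>The competitor has amplitude \<delta> \<zeta>(t). After division by \<delta>,
  \<open>action_derivative_le\<close> replaces the term with W_tt, and the two conditions on
  \<sigma> are those for which the remaining quadratic form in W and W_t is minus \<zeta> times a
  square. The error consists of the quadratic cost of the competitor and the mixing error over
  \<delta>.\<close>

lemma lyapunov:
  assumes ab: "0 \<le> a" "a \<le> b" "b \<le> T" and \<delta>: "\<delta> > 0"
    and \<zeta>: "\<And>t. t \<in> {a..b} \<Longrightarrow> 0 \<le> \<zeta> t" "\<And>t. t \<in> {a..b} \<Longrightarrow> \<zeta> t \<le> 1 / \<epsilon>"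
      "\<And>t. t \<in> {a..b} \<Longrightarrow> \<delta> * \<zeta> t \<le> 1" "continuous_on {a..b} \<zeta>" "continuous_on {a<..<b} \<zeta>'"
      "\<And>t. t \<in> {a<..<b} \<Longrightarrow> (\<zeta> has_real_derivative \<zeta>' t) (at t)"
      "\<And>t. t \<in> {a<..<b} \<Longrightarrow> \<bar>\<zeta>' t\<bar> \<le> 1 / \<epsilon>\<^sup>2"
    and \<sigma>: "continuous_on {a..b} \<sigma>" "continuous_on {a<..<b} \<sigma>'"
      "\<And>t. t \<in> {a<..<b} \<Longrightarrow> (\<sigma> has_real_derivative \<sigma>' t) (at t)"
      "\<And>t. t \<in> {a<..<b} \<Longrightarrow> \<sigma>' t = - (\<zeta> t / (t + \<epsilon>)\<^sup>2)"
      "\<And>t. t \<in> {a<..<b} \<Longrightarrow> 2 * \<sigma> t = \<zeta>' t + 2 * (\<zeta> t / (t + \<epsilon>))"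
  shows "Lam \<delta> \<zeta> \<sigma> b \<le> Lam \<delta> \<zeta> \<sigma> a + (\<delta> / 2 * (2 * K / \<epsilon>\<^sup>2 + speed / \<epsilon>)\<^sup>2 + C0 * \<eta> / \<delta>) * (b - a)"
proof -
  define E where "E = \<delta> / 2 * (2 * K / \<epsilon>\<^sup>2 + speed / \<epsilon>)\<^sup>2 + C0 * \<eta> / \<delta>"
  define h where "h t s = (u t (X t s) - u t (X t s - \<delta> * \<zeta> t * W t s) + \<delta> * \<zeta> t * W t s * Zt t s) / \<delta>
     + \<sigma> t * (W t s)\<^sup>2" for t s
  define D where "D t s = (\<delta> * \<zeta>' t) * W t s + (\<delta> * \<zeta> t) * Wt t s" for t s
  define f where "f t s = (ut t (X t s) + p t (X t s) * V t (X t s))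
      - (ut t (X t s - \<delta> * \<zeta> t * W t s) + p t (X t s - \<delta> * \<zeta> t * W t s) * (V t (X t s) - D t s))
      + D t s * Zt t s - \<delta> * \<zeta> t * W t s * (curv \<theta> / (t + \<epsilon>)\<^sup>2 * Z t s)" for t s
  define h' where "h' t s = f t s / \<delta> + (\<sigma>' t * (W t s)\<^sup>2 + \<sigma> t * (2 * (W t s * Wt t s)))" for t s
  have Lam_h: "Lam \<delta> \<zeta> \<sigma> = (\<lambda>t. integral {0..1} (h t))"
    unfolding Lam_def[abs_def] h_def[abs_def] by (rule refl)
  have hc: "continuous_on ({a..b} \<times> cbox 0 1) (\<lambda>(t, s). h t s)"
  proof -
    have D: "{a..b} \<subseteq> {0..T}" using ab by auto
    note c = XZ_cont[OF D] time_cont[OF \<zeta>(4)] time_cont[OF \<sigma>(1)]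
    show ?thesis
      unfolding h_def split_beta' using \<delta>
      by (intro continuous_intros continuous_on_second_arg[OF u_cont D] c[simplified]) (auto intro!: continuous_intros c)
  qed
  have h'c: "continuous_on ({a<..<b} \<times> cbox 0 1) (\<lambda>(t, s). h' t s)"
  proof -
    have D: "{a<..<b} \<subseteq> {0..T}" and D': "{a<..<b} \<subseteq> {0<..<T}" using ab by auto
    have z: "continuous_on {a<..<b} \<zeta>" "continuous_on {a<..<b} \<sigma>"
      using \<zeta>(4) \<sigma>(1) by (auto elim!: continuous_on_subset)
    have cc: "continuous_on {a<..<b} (\<lambda>t. curv \<theta> / (t + \<epsilon>)\<^sup>2)"
      using ab \<epsilon> by (intro continuous_intros) auto
    note c = XZ_cont[OF D] time_cont[OF z(1)] time_cont[OF z(2)] time_cont[OF \<zeta>(5)] time_cont[OF \<sigma>(2)] time_cont[OF cc]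
    note s = continuous_on_second_arg[OF p_cont D'] continuous_on_second_arg[OF ut_cont D'] continuous_on_second_arg[OF V_cont D']
    show ?thesis
      unfolding h'_def f_def D_def Wt_def split_beta' using \<delta> ab(1) \<epsilon>
      by (auto intro!: continuous_intros s c)
  qed
  have hd: "((\<lambda>t. h t s) has_real_derivative h' t s) (at t)" if t: "t \<in> {a<..<b}" for t s
  proof -
    have T: "t \<in> {0<..<T}" "t \<ge> 0" using t ab by auto
    note W = W_deriv_t[OF T(1), of s] and X = X_deriv_t[OF T(1), of s] and z = DERIV_cmult[OF \<zeta>(6)[OF t], of \<delta>]
    have zW: "((\<lambda>t. \<delta> * \<zeta> t * W t s) has_real_derivative D t s) (at t)"
      using DERIV_mult[OF z W] by (simp add: D_def algebra_simps)
    have 1: "((\<lambda>t. \<delta> * \<zeta> t * W t s * Zt t s) has_real_derivative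
        D t s * Zt t s - \<delta> * \<zeta> t * W t s * (curv \<theta> / (t + \<epsilon>)\<^sup>2 * Z t s)) (at t)"
      using DERIV_mult[OF zW Zt_deriv_t[OF T(2), of s]] by (simp add: algebra_simps)
    have 2: "((\<lambda>t. \<sigma> t * (W t s)\<^sup>2) has_real_derivative \<sigma>' t * (W t s)\<^sup>2 + \<sigma> t * (2 * (W t s * Wt t s))) (at t)"
      using DERIV_mult[OF \<sigma>(3)[OF t] DERIV_power[OF W, of 2]] by (simp add: algebra_simps)
    from DERIV_add[OF DERIV_cdivide[OF DERIV_add[OF DERIV_diff[OF u_along_curve[OF T(1) X] u_along_curve[OF T(1) DERIV_diff[OF X zW]]] 1], of \<delta>] 2]
    show ?thesis unfolding h_def h'_def f_def by (simp add: algebra_simps)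
  qed
  have Ld: "(Lam \<delta> \<zeta> \<sigma> has_real_derivative integral {0..1} (h' t)) (at t)" if t: "t \<in> {a<..<b}" for t
  proof -
    have "((\<lambda>t. integral (cbox 0 1) (h t)) has_real_derivative integral (cbox 0 1) (h' t)) (at t within {a<..<b})"
    proof (rule leibniz_rule_field_derivative)
      show "h t integrable_on cbox 0 1" if "t \<in> {a<..<b}" for t
        using continuous_on_slices(1)[OF hc, of t] that by (intro integrable_continuous) auto
    qed (use hd h'c t in \<open>auto intro: has_field_derivative_at_within\<close>)
    then show ?thesis using t by (simp add: at_within_open[OF _ open_greaterThanLessThan] Lam_h)
  qed
  have le: "integral {0..1} (h' t) \<le> E" if t: "t \<in> {a<..<b}" for t
  proof -
    have T: "t \<in> {0<..<T}" and tab: "t \<in> {a..b}" and tT: "t \<in> {0..T}" using t ab by auto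
    define \<nu> where "\<nu> = \<delta> * \<zeta> t"
    define \<nu>' where "\<nu>' = \<delta> * \<zeta>' t"
    have \<nu>: "0 \<le> \<nu>" "\<nu> \<le> 1" using \<zeta>(1,3)[OF tab] \<delta> by (auto simp: \<nu>_def)
    define q where "q s = \<sigma>' t * (W t s)\<^sup>2 + \<sigma> t * (2 * (W t s * Wt t s))" for s
    define g where "g s = (D t s)\<^sup>2 / 2 - Wt t s * D t s" for s
    have Vc: "continuous_on {0..1} (\<lambda>s. V t (X t s))"
      using continuous_on_compose2[OF continuous_on_slices(1)[OF V_cont T] slice_cont(1)[OF tT]] by auto
    have Dc: "continuous_on {0..1} (D t)" "continuous_on {0..1} (Wt t)"
      unfolding D_def Wt_def by (intro continuous_intros slice_cont[OF tT] Vc)+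
    have gc: "continuous_on {0..1} g" unfolding g_def by (intro continuous_intros Dc) auto
    have qc: "continuous_on {0..1} q" unfolding q_def by (intro continuous_intros Dc slice_cont[OF tT])
    have gi: "g integrable_on {0..1}" "q integrable_on {0..1}"
      by (intro integrable_continuous_interval gc qc)+
    have gd: "(\<lambda>s. g s / \<delta>) integrable_on {0..1}"
      using \<delta> by (intro integrable_continuous_interval continuous_intros gc) auto
    have fi: "f t integrable_on {0..1}"
    proof -
      have h'i: "h' t integrable_on {0..1}"
        using continuous_on_slices(1)[OF h'c t] by (intro integrable_continuous_interval) auto
      have "f t = (\<lambda>s. \<delta> * (h' t s - q s))" using \<delta> by (auto simp: h'_def q_def)
      then show ?thesis using integrable_on_mult_right[OF integrable_diff[OF h'i gi(2)], of \<delta>] by simp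
    qed
    have "integral {0..1} (f t) \<le> integral {0..1} g + C0 * \<eta>"
      using action_derivative_le[OF T \<nu>, of \<nu>'] by (simp add: f_def[abs_def] g_def[abs_def] D_def \<nu>_def \<nu>'_def)
    then have "integral {0..1} (f t) / \<delta> + integral {0..1} q \<le> (integral {0..1} g + C0 * \<eta>) / \<delta> + integral {0..1} q"
      using \<delta> by (simp add: divide_right_mono)
    also have "\<dots> = integral {0..1} (\<lambda>s. g s / \<delta> + q s) + C0 * \<eta> / \<delta>"
      using gi gd by (subst Henstock_Kurzweil_Integration.integral_add) (auto simp: add_divide_distrib)
    also have "integral {0..1} (\<lambda>s. g s / \<delta> + q s) \<le> integral {0..1} (\<lambda>s::real. \<delta> / 2 * (2 * K / \<epsilon>\<^sup>2 + speed / \<epsilon>)\<^sup>2)"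
    proof (rule integral_le)
      show "(\<lambda>s. g s / \<delta> + q s) integrable_on {0..1}" by (intro integrable_add gd gi)
      fix s :: real assume s: "s \<in> {0..1}"
      define w where "w = W t s"
      define v where "v = Wt t s"
      define l where "l = t + \<epsilon>"
      have l: "l > 0" using T \<epsilon> by (simp add: l_def)
      have D: "D t s = \<delta> * (\<zeta>' t * w + \<zeta> t * v)" by (simp add: D_def w_def v_def algebra_simps)
      \<comment> \<open>Completing the square in \<open>v - w / l\<close>. It vanishes for W
        proportional to t + \<epsilon>, the extremal case of the growth bound.\<close>
      have id: "\<delta> / 2 * A\<^sup>2 - \<zeta> t * (v - w / l)\<^sup>2 = (\<delta> * A)\<^sup>2 / 2 / \<delta> - (\<zeta>' t * w + \<zeta> t * v) * v
          + (- (\<zeta> t / l\<^sup>2) * w\<^sup>2 + (\<zeta>' t + 2 * (\<zeta> t / l)) * (w * v))" for A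
        using l \<delta> by (simp add: power2_eq_square field_simps)
      have "g s / \<delta> + q s = (\<delta> * (\<zeta>' t * w + \<zeta> t * v))\<^sup>2 / 2 / \<delta> - (\<zeta>' t * w + \<zeta> t * v) * v
          + (- (\<zeta> t / l\<^sup>2) * w\<^sup>2 + (\<zeta>' t + 2 * (\<zeta> t / l)) * (w * v))"
        unfolding g_def q_def D \<sigma>(4)[OF t] \<sigma>(5)[OF t, folded l_def, symmetric] l_def[symmetric]
          w_def[symmetric] v_def[symmetric] using \<delta> by (simp add: diff_divide_distrib)
      also have "\<dots> \<le> \<delta> / 2 * (\<zeta>' t * w + \<zeta> t * v)\<^sup>2"
        unfolding id[symmetric] using \<zeta>(1)[OF tab] by simp
      also have "\<dots> \<le> \<delta> / 2 * (2 * K / \<epsilon>\<^sup>2 + speed / \<epsilon>)\<^sup>2"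
      proof (intro mult_left_mono)
        have "\<bar>\<zeta>' t * w + \<zeta> t * v\<bar> \<le> \<bar>\<zeta>' t\<bar> * \<bar>w\<bar> + \<bar>\<zeta> t\<bar> * \<bar>v\<bar>"
          by (metis abs_mult abs_triangle_ineq)
        also have "\<dots> \<le> 1 / \<epsilon>\<^sup>2 * (2 * K) + 1 / \<epsilon> * speed"
          using \<zeta>(7)[OF t] W_bound[OF tT s] \<zeta>(1,2)[OF tab] Wt_bound[OF T s] \<epsilon>
          unfolding w_def v_def by (intro add_mono mult_mono) auto
        finally show "(\<zeta>' t * w + \<zeta> t * v)\<^sup>2 \<le> (2 * K / \<epsilon>\<^sup>2 + speed / \<epsilon>)\<^sup>2"
          by (simp add: mult.commute flip: abs_le_square_iff)
      qed (use \<delta> in auto)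
      finally show "g s / \<delta> + q s \<le> \<delta> / 2 * (2 * K / \<epsilon>\<^sup>2 + speed / \<epsilon>)\<^sup>2" .
    qed auto
    finally have "integral {0..1} (f t) / \<delta> + integral {0..1} q \<le> E"
      by (simp add: E_def)
    moreover have "integral {0..1} (h' t) = integral {0..1} (f t) / \<delta> + integral {0..1} q"
      unfolding h'_def q_def[symmetric] using fi gi
      by (subst Henstock_Kurzweil_Integration.integral_add) (auto intro: integrable_on_divide)
    ultimately show ?thesis by simp
  qed
  have "Lam \<delta> \<zeta> \<sigma> a - E * a \<ge> Lam \<delta> \<zeta> \<sigma> b - E * b"
  proof (rule DERIV_nonpos_imp_decreasing_open[where f="\<lambda>t. Lam \<delta> \<zeta> \<sigma> t - E * t"])
    show "continuous_on {a..b} (\<lambda>t. Lam \<delta> \<zeta> \<sigma> t - E * t)"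
      using integral_continuous_on_param[OF hc] unfolding Lam_h by (auto intro!: continuous_intros)
    show "\<exists>y. ((\<lambda>t. Lam \<delta> \<zeta> \<sigma> t - E * t) has_real_derivative y) (at t) \<and> y \<le> 0" if "a < t" "t < b" for t
      using DERIV_diff[OF Ld[of t] DERIV_cmult_Id[of E]] le[of t] that
      by (intro exI[of _ "integral {0..1} (h' t) - E"]) auto
  qed (use ab in auto)
  then show ?thesis unfolding E_def[symmetric] right_diff_distrib by linarith
qed

text \<open>Two weights are glued at time t: constant before, decreasing to 0 at T after. Adding the
  two monotonicity statements for \<open>Lam\<close> leaves the jump of \<sigma> at t, which is the
  left-hand side, and boundary terms at 0 and T.\<close>

lemma decay_regularized:
  assumes t: "0 < t" "t < T" and \<delta>: "0 < \<delta>" "\<delta> \<le> \<epsilon>"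
  shows "integral {0..1} (\<lambda>s. (W t s)\<^sup>2) / (2 * (t + \<epsilon>)\<^sup>2)
    \<le> integral {0..1} (\<lambda>s. (W T s)\<^sup>2) / (2 * (T + \<epsilon>)\<^sup>2)
      + 1 / \<epsilon> * (speed + 2 * K / \<epsilon>) * integral {0..1} (\<lambda>s. \<bar>W 0 s\<bar>)
      + (\<delta> / 2 * (2 * K / \<epsilon>\<^sup>2 + speed / \<epsilon>)\<^sup>2 + C0 * \<eta> / \<delta>) * T"
proof -
  define M where "M = \<delta> / 2 * (2 * K / \<epsilon>\<^sup>2 + speed / \<epsilon>)\<^sup>2 + C0 * \<eta> / \<delta>"
  define l2 where "l2 = T + \<epsilon>"
  \<comment> \<open>The value of \<open>\<zeta>2\<close> at time t, so that the terms of
    \<open>Lam\<close> with \<open>u\<close> agree on both sides.\<close>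
  define c where "c = 1 / (t + \<epsilon>) - 1 / l2"
  define \<zeta>1 where "\<zeta>1 = (\<lambda>_::real. c)"
  define \<sigma>1 where "\<sigma>1 s = c / (s + \<epsilon>)" for s
  define \<zeta>2 where "\<zeta>2 s = 1 / (s + \<epsilon>) - 1 / l2" for s
  define \<sigma>2 where "\<sigma>2 s = 1 / (2 * (s + \<epsilon>)\<^sup>2) - 1 / ((s + \<epsilon>) * l2)" for s
  have l2: "l2 > 0" "t + \<epsilon> < l2" using T \<epsilon> t by (auto simp: l2_def)
  have \<zeta>b: "0 \<le> 1 / (s + \<epsilon>) - 1 / l2" "1 / (s + \<epsilon>) - 1 / l2 \<le> 1 / \<epsilon>" if "s \<in> {0..T}" for s
  proof -
    have "1 / l2 \<le> 1 / (s + \<epsilon>)" "1 / (s + \<epsilon>) \<le> 1 / \<epsilon>" "0 \<le> 1 / l2"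
      using that \<epsilon> l2 by (auto simp: l2_def intro!: divide_left_mono)
    then show "0 \<le> 1 / (s + \<epsilon>) - 1 / l2" "1 / (s + \<epsilon>) - 1 / l2 \<le> 1 / \<epsilon>" by linarith+
  qed
  have cb: "0 \<le> c" "c \<le> 1 / \<epsilon>" using \<zeta>b[of t] t by (auto simp: c_def)
  have \<delta>1: "\<delta> * z \<le> 1" if "z \<le> 1 / \<epsilon>" for z
  proof -
    have "\<delta> * z \<le> \<delta> * (1 / \<epsilon>)" using that \<delta> by (intro mult_left_mono) auto
    also have "\<dots> \<le> 1" using \<delta> \<epsilon> by simp
    finally show ?thesis .
  qed
  have sq: "1 / (s + \<epsilon>)\<^sup>2 \<le> 1 / \<epsilon>\<^sup>2" if "s \<ge> 0" for s
    using that \<epsilon> by (intro divide_left_mono power_mono) auto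
  have 1: "Lam \<delta> \<zeta>1 \<sigma>1 t \<le> Lam \<delta> \<zeta>1 \<sigma>1 0 + M * (t - 0)"
    unfolding M_def
  proof (rule lyapunov[where \<zeta>'="\<lambda>_. 0" and \<sigma>'="\<lambda>s. - (c / (s + \<epsilon>)\<^sup>2)"])
    show "continuous_on {0..t} \<sigma>1" "continuous_on {0<..<t} (\<lambda>s. - (c / (s + \<epsilon>)\<^sup>2))"
      unfolding \<sigma>1_def using \<epsilon> by (auto intro!: continuous_intros)
    show "(\<sigma>1 has_real_derivative - (c / (s + \<epsilon>)\<^sup>2)) (at s)" if "s \<in> {0<..<t}" for s
      unfolding \<sigma>1_def[abs_def] using that \<epsilon> by (auto intro!: derivative_eq_intros simp: power2_eq_square)
  qed (use t \<delta> \<epsilon> cb \<delta>1 in \<open>auto simp: \<zeta>1_def \<sigma>1_def\<close>)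
  have 2: "Lam \<delta> \<zeta>2 \<sigma>2 T \<le> Lam \<delta> \<zeta>2 \<sigma>2 t + M * (T - t)"
    unfolding M_def
  proof (rule lyapunov[where \<zeta>'="\<lambda>s. - (1 / (s + \<epsilon>)\<^sup>2)" and \<sigma>'="\<lambda>s. - (\<zeta>2 s / (s + \<epsilon>)\<^sup>2)"])
    have p: "s + \<epsilon> > 0" if "s \<ge> t" for s using that t \<epsilon> by auto
    show "continuous_on {t..T} \<zeta>2" "continuous_on {t<..<T} (\<lambda>s. - (1 / (s + \<epsilon>)\<^sup>2))" "continuous_on {t..T} \<sigma>2"
      "continuous_on {t<..<T} (\<lambda>s. - (\<zeta>2 s / (s + \<epsilon>)\<^sup>2))"
      unfolding \<zeta>2_def \<sigma>2_def using p l2 by (auto intro!: continuous_intros simp: less_imp_neq[symmetric])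
    fix s assume s: "s \<in> {t<..<T}"
    define l where "l = s + \<epsilon>"
    have l: "l > 0" using s t \<epsilon> by (simp add: l_def)
    show "(\<zeta>2 has_real_derivative - (1 / (s + \<epsilon>)\<^sup>2)) (at s)"
      unfolding \<zeta>2_def[abs_def] using l[unfolded l_def] by (auto intro!: derivative_eq_intros simp: power2_eq_square)
    have "((\<lambda>s. 1 / (2 * (s + \<epsilon>)\<^sup>2) - 1 / ((s + \<epsilon>) * l2)) has_real_derivative
        - (2 * (2 * l)) / (2 * l\<^sup>2)\<^sup>2 + l2 / (l * l2)\<^sup>2) (at s)"
      using l[unfolded l_def] l2 unfolding l_def
      by (auto intro!: derivative_eq_intros simp: power2_eq_square)
    moreover have "- (2 * (2 * l)) / (2 * l\<^sup>2)\<^sup>2 + l2 / (l * l2)\<^sup>2 = - ((1 / l - 1 / l2) / l\<^sup>2)"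
      using l l2 by (simp add: field_simps power2_eq_square)
    ultimately show "(\<sigma>2 has_real_derivative - (\<zeta>2 s / (s + \<epsilon>)\<^sup>2)) (at s)"
      unfolding \<sigma>2_def[abs_def] \<zeta>2_def l_def by simp
    show "2 * \<sigma>2 s = - (1 / (s + \<epsilon>)\<^sup>2) + 2 * (\<zeta>2 s / (s + \<epsilon>))"
      unfolding \<sigma>2_def \<zeta>2_def l_def[symmetric] using l l2 by (simp add: field_simps power2_eq_square)
    show "\<bar>- (1 / (s + \<epsilon>)\<^sup>2)\<bar> \<le> 1 / \<epsilon>\<^sup>2" using sq[of s] s t by simp
  qed (use t \<delta> \<zeta>b \<delta>1 in \<open>auto simp: \<zeta>2_def\<close>)
  have tT: "t \<in> {0..T}" "0 \<in> {0..T}" "T \<in> {0..T}" using t T by auto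
  have Wi: "(\<lambda>s. (W r s)\<^sup>2) integrable_on {0..1}" if "r \<in> {0..T}" for r
    by (intro integrable_continuous_interval continuous_intros slice_cont that)
  \<comment> \<open>The weight vanishes at T, which removes \<open>u\<close> and leaves only the
    distance at T.\<close>
  have 3: "Lam \<delta> \<zeta>2 \<sigma>2 T = - (1 / (2 * l2\<^sup>2)) * integral {0..1} (\<lambda>s. (W T s)\<^sup>2)"
  proof -
    have "\<sigma>2 T = - (1 / (2 * l2\<^sup>2))" unfolding \<sigma>2_def l2_def[symmetric] using l2
      by (simp add: field_simps power2_eq_square)
    moreover have "\<zeta>2 T = 0" by (simp add: \<zeta>2_def l2_def)
    ultimately show ?thesis by (simp add: Lam_def)
  qed
  \<comment> \<open>The weights agree at t but \<sigma> jumps there, because \<zeta>' does.\<close>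
  have 4: "Lam \<delta> \<zeta>2 \<sigma>2 t = Lam \<delta> \<zeta>1 \<sigma>1 t - 1 / (2 * (t + \<epsilon>)\<^sup>2) * integral {0..1} (\<lambda>s. (W t s)\<^sup>2)"
  proof -
    let ?h = "\<lambda>s. (u t (X t s) - u t (X t s - \<delta> * c * W t s) + \<delta> * c * W t s * Zt t s) / \<delta>"
    have uc: "continuous_on {0..1} (\<lambda>s. u t (h s))" if "continuous_on {0..1} h" for h
      using continuous_on_compose2[OF continuous_on_slices(1)[OF u_cont tT(1)] that] by simp
    have hi: "?h integrable_on {0..1}"
      using \<delta> by (intro integrable_continuous_interval continuous_intros uc slice_cont tT) auto
    have L: "Lam \<delta> \<zeta> \<sigma> t = integral {0..1} ?h + \<sigma> t * integral {0..1} (\<lambda>s. (W t s)\<^sup>2)" if "\<zeta> t = c" for \<zeta> \<sigma>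
      unfolding Lam_def that
      using Henstock_Kurzweil_Integration.integral_add[OF hi integrable_on_mult_right[OF Wi[OF tT(1)]], of "\<sigma> t"] by simp
    have "\<sigma>2 t - \<sigma>1 t = - (1 / (2 * (t + \<epsilon>)\<^sup>2))"
    proof -
      have id: "1 / (2 * l\<^sup>2) - 1 / (l * k) - (1 / l - 1 / k) / l = - (1 / (2 * l\<^sup>2))"
        if "l > 0" "k > 0" for l k :: real
        using that by (simp add: field_simps power2_eq_square)
      show ?thesis unfolding \<sigma>2_def \<sigma>1_def c_def using t \<epsilon> l2 by (intro id) auto
    qed
    then have eq: "\<sigma>2 t = \<sigma>1 t - 1 / (2 * (t + \<epsilon>)\<^sup>2)" by linarith
    have "\<zeta>1 t = c" "\<zeta>2 t = c" by (auto simp: \<zeta>1_def \<zeta>2_def c_def)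
    from L[of \<zeta>1 \<sigma>1, OF this(1)] L[of \<zeta>2 \<sigma>2, OF this(2)] show ?thesis
      unfolding eq left_diff_distrib by linarith
  qed
  \<comment> \<open>\<open>W\<close> is not zero at time 0 because of the uniform density mixed in.
    The Lipschitz bound on \<open>u\<close> controls the difference quotient by |W|, uniformly in
    \<delta>.\<close>
  have 5: "Lam \<delta> \<zeta>1 \<sigma>1 0 \<le> 1 / \<epsilon> * (speed + 2 * K / \<epsilon>) * integral {0..1} (\<lambda>s. \<bar>W 0 s\<bar>)"
  proof -
    have uc: "continuous_on {0..1} (\<lambda>s. u 0 (h s))" if "continuous_on {0..1} h" for h
      using continuous_on_compose2[OF continuous_on_slices(1)[OF u_cont tT(2)] that] by simp
    have "Lam \<delta> \<zeta>1 \<sigma>1 0 \<le> integral {0..1} (\<lambda>s. 1 / \<epsilon> * (speed + 2 * K / \<epsilon>) * \<bar>W 0 s\<bar>)"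
      unfolding Lam_def
    proof (rule integral_le)
      show "(\<lambda>s. (u 0 (X 0 s) - u 0 (X 0 s - \<delta> * \<zeta>1 0 * W 0 s) + \<delta> * \<zeta>1 0 * W 0 s * Zt 0 s) / \<delta> + \<sigma>1 0 * (W 0 s)\<^sup>2)
          integrable_on {0..1}"
        using \<delta> by (intro integrable_continuous_interval continuous_intros uc slice_cont tT) auto
      show "(\<lambda>s. 1 / \<epsilon> * (speed + 2 * K / \<epsilon>) * \<bar>W 0 s\<bar>) integrable_on {0..1}"
        by (intro integrable_continuous_interval continuous_intros slice_cont tT)
      fix s :: real assume s: "s \<in> {0..1}"
      let ?w = "\<bar>W 0 s\<bar>"
      let ?S = "\<epsilon> powr (alpha \<theta> - 1) * R_alpha \<theta>"
      have "u 0 (X 0 s) - u 0 (X 0 s - \<delta> * c * W 0 s) \<le> L * \<bar>\<delta> * c * W 0 s\<bar>"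
        using lipschitz_onD[OF u_lipschitz, of "(0, X 0 s)" "(0, X 0 s - \<delta> * c * W 0 s)"] tT
        by (auto simp: dist_Pair_Pair dist_real_def)
      also have "\<dots> = \<delta> * (c * L * ?w)" using \<delta> cb by (simp add: abs_mult)
      finally have a: "u 0 (X 0 s) - u 0 (X 0 s - \<delta> * c * W 0 s) \<le> \<delta> * (c * L * ?w)" .
      have "W 0 s * Zt 0 s \<le> ?w * ?S"
      proof -
        have "W 0 s * Zt 0 s \<le> ?w * \<bar>Zt 0 s\<bar>" by (simp flip: abs_mult)
        also have "\<dots> \<le> ?w * ?S" by (intro mult_left_mono Zt_bound tT s) auto
        finally show ?thesis .
      qed
      then have b: "\<delta> * c * W 0 s * Zt 0 s \<le> \<delta> * (c * (?w * ?S))"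
        using \<delta> cb by (simp add: mult.assoc mult_left_mono)
      have "(u 0 (X 0 s) - u 0 (X 0 s - \<delta> * c * W 0 s) + \<delta> * c * W 0 s * Zt 0 s) / \<delta>
          \<le> (\<delta> * (c * L * ?w) + \<delta> * (c * (?w * ?S))) / \<delta>"
        using add_mono[OF a b] \<delta> by (intro divide_right_mono) simp_all
      also have "\<dots> = c * speed * ?w" using \<delta> by (simp add: speed_def field_simps)
      also have "\<dots> \<le> 1 / \<epsilon> * speed * ?w"
        using cb L R_pos by (intro mult_right_mono) (auto simp: speed_def)
      finally have A: "(u 0 (X 0 s) - u 0 (X 0 s - \<delta> * c * W 0 s) + \<delta> * c * W 0 s * Zt 0 s) / \<delta> \<le> 1 / \<epsilon> * speed * ?w" .
      have "(W 0 s)\<^sup>2 \<le> 2 * K * ?w"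
        using mult_right_mono[OF W_bound[OF tT(2) s], of ?w] by (simp add: power2_eq_square)
      moreover have "c / \<epsilon> \<le> 1 / \<epsilon> / \<epsilon>"
        by (rule divide_right_mono) (use cb \<epsilon> in auto)
      moreover have "0 \<le> c / \<epsilon>" using cb \<epsilon> by simp
      ultimately have "c / \<epsilon> * (W 0 s)\<^sup>2 \<le> 1 / \<epsilon> / \<epsilon> * (2 * K * ?w)"
        using K_pos \<epsilon> by (intro mult_mono) auto
      then show "(u 0 (X 0 s) - u 0 (X 0 s - \<delta> * \<zeta>1 0 * W 0 s) + \<delta> * \<zeta>1 0 * W 0 s * Zt 0 s) / \<delta> + \<sigma>1 0 * (W 0 s)\<^sup>2
         \<le> 1 / \<epsilon> * (speed + 2 * K / \<epsilon>) * \<bar>W 0 s\<bar>"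
        using A by (simp add: \<zeta>1_def \<sigma>1_def algebra_simps)
    qed
    then show ?thesis by simp
  qed
  show ?thesis
    using 1 2 3 4 5 unfolding M_def[symmetric] l2_def[symmetric] by (simp add: algebra_simps)
qed

end


section \<open>Removing the regularisation\<close>

text \<open>Convergence is asked at interior levels only: at s = 0 and s = 1 the regularised
  quantiles stay at - K and K, away from those of the initial profile.\<close>

lemma integral_dominated_interior:
  fixes f :: "nat \<Rightarrow> real \<Rightarrow> real"
  assumes f: "\<And>k. continuous_on {0..1} (f k)" "\<And>k s. s \<in> {0..1} \<Longrightarrow> \<bar>f k s\<bar> \<le> C"
    and lim: "\<And>s. s \<in> {0<..<1} \<Longrightarrow> (\<lambda>k. f k s) \<longlonglongrightarrow> 0"
  shows "(\<lambda>k. integral {0..1} (f k)) \<longlonglongrightarrow> 0"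
proof -
  have "(\<lambda>k. integral {0<..<1} (f k)) \<longlonglongrightarrow> integral {0<..<1} (\<lambda>_::real. 0)"
  proof (rule dominated_convergence(2))
    show "f k integrable_on {0<..<1}" for k
      using integrable_continuous_interval[OF f(1)] by (simp add: integrable_on_Icc_iff_Ioo)
    show "(\<lambda>_::real. C) integrable_on {0<..<1}"
      using integrable_continuous_interval[OF continuous_on_const[of "{0..1::real}" C]]
      by (simp add: integrable_on_Icc_iff_Ioo)
    show "norm (f k s) \<le> C" if "s \<in> {0<..<1}" for k s using f(2)[of s k] that by auto
  qed (use lim in auto)
  then show ?thesis by (simp add: integral_open_interval_real)
qed

locale mfg_limit = mfg_data +
  fixes r :: real
  assumes initial: "m 0 = initial_approx \<theta> \<epsilon>"
    and terminal: "\<And>x. \<bar>x\<bar> > r \<Longrightarrow> m T x = 0" and r: "0 \<le> r" "r \<le> K"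
begin

lemma mfg_flow:
  assumes "0 < \<eta>" "\<eta> \<le> 1"
  shows "mfg_flow T L A K m p \<theta> \<epsilon> B u ut \<eta>"
  by unfold_locales (fact assms)+

definition z0 :: "real \<Rightarrow> real" where
  "z0 s = \<epsilon> powr alpha \<theta> * phi_quantile \<theta> s"

text \<open>Both sides have the same derivative in \<open>y\<close>, the dilation factors
  cancelling, and both vanish at the left end of the support.\<close>

lemma F_initial:
  assumes y: "y \<in> {- R_alpha \<theta>..R_alpha \<theta>}"
  shows "F 0 (\<epsilon> powr alpha \<theta> * y) = phi_cdf \<theta> y"
proof -
  let ?R = "R_alpha \<theta>"
  define e where "e = \<epsilon> powr alpha \<theta>"
  have e: "e > 0" using \<epsilon> by (simp add: e_def)
  have T0: "0 \<in> {0..T}" using T by simp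
  have R: "?R > 0" by (rule R_alpha(1)[OF \<theta>0])
  have m0: "m 0 x = 1 / e * phi \<theta> (x / e)" for x
    unfolding initial initial_approx_def using \<epsilon> by (simp add: e_def powr_minus field_simps)
  define h where "h y = F 0 (e * y) - phi_cdf \<theta> y" for y
  have Fd: "((\<lambda>y. F 0 (e * y)) has_real_derivative m 0 (e * y) * e) (at y)" for y
    by (rule DERIV_chain2[OF F_deriv_x[OF T0]]) (auto intro!: derivative_eq_intros)
  have Fc: "continuous_on S (\<lambda>y. F 0 (e * y))" for S
    by (intro continuous_at_imp_continuous_on ballI DERIV_isCont[OF Fd])
  have hc: "continuous_on {- ?R..?R} h"
    unfolding h_def by (intro continuous_intros Fc phi_cdf_cont[OF \<theta>0])
  have hd: "(h has_real_derivative 0) (at y)" if "y \<in> {- ?R<..<?R}" for y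
  proof -
    have "((\<lambda>y. F 0 (e * y)) has_real_derivative phi \<theta> y) (at y)" using Fd[of y] e by (simp add: m0)
    from DERIV_diff[OF this phi_cdf_deriv[OF \<theta>0 that]] show ?thesis by (simp add: h_def[abs_def])
  qed
  have "h y = h (- ?R)"
  proof (cases "y = - ?R")
    case False
    then show ?thesis
      using DERIV_isconst2[of "- ?R" ?R h y] hc hd y R by auto
  qed simp
  also have "\<dots> = 0"
  proof -
    have "F 0 (e * - ?R) = 0"
      unfolding F_def
    proof (intro integral_unique has_integral_is_0)
      fix x assume "x \<in> {- K - 1..e * - ?R}"
      then have "?R \<le> \<bar>x / e\<bar>" using e R by (simp add: abs_if field_simps)
      then show "m 0 x = 0" unfolding m0 using phi_zero[OF \<theta>0] by simp
    qed
    then show ?thesis by (simp add: h_def phi_cdf_ends[OF \<theta>0])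
  qed
  finally show ?thesis by (simp add: h_def e_def)
qed

lemma F_mono:
  assumes t: "t \<in> {0..T}" and "x \<le> y"
  shows "F t x \<le> F t y"
  unfolding F_def using m_nonneg[OF t] assms(2) by (intro integral_subset_le m_integrable t) auto

text \<open>The profile is positive inside its support, so the distribution function crosses each
  interior level strictly. This is what makes the regularised quantiles converge at time 0.\<close>

lemma F_initial_strict:
  assumes s: "s \<in> {0<..<1}"
  shows "x < z0 s \<Longrightarrow> F 0 x < s" "z0 s < x \<Longrightarrow> s < F 0 x"
proof -
  let ?R = "R_alpha \<theta>" and ?q = "phi_quantile \<theta> s"
  define e where "e = \<epsilon> powr alpha \<theta>"
  have e: "e > 0" using \<epsilon> by (simp add: e_def)
  have T0: "0 \<in> {0..T}" using T by simp
  have q: "\<bar>?q\<bar> < ?R" by (rule phi_quantile_inside[OF \<theta>0 s])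
  have sq: "phi_cdf \<theta> ?q = s" using phi_cdf_quantile[OF \<theta>0] s by auto
  show "F 0 x < s" if "x < z0 s"
  proof -
    \<comment> \<open>Clamped to the support, since \<open>F_initial\<close> speaks of that range
      only.\<close>
    define y where "y = max (x / e) (- ?R)"
    have "x / e < ?q" using that e by (simp add: z0_def e_def field_simps)
    then have y: "y < ?q" "- ?R \<le> y" "x \<le> e * y" using q e by (auto simp: y_def max_def field_simps)
    then have "F 0 x \<le> F 0 (e * y)" by (intro F_mono T0)
    also have "\<dots> = phi_cdf \<theta> y" unfolding e_def using y q by (intro F_initial) auto
    also have "\<dots> < phi_cdf \<theta> ?q" using y q by (intro phi_cdf_strict[OF \<theta>0]) auto
    finally show ?thesis by (simp only: sq)
  qed
  show "s < F 0 x" if "z0 s < x"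
  proof -
    define y where "y = min (x / e) ?R"
    have "?q < x / e" using that e by (simp add: z0_def e_def field_simps)
    then have y: "?q < y" "y \<le> ?R" "e * y \<le> x" using q e by (auto simp: y_def min_def field_simps)
    have "phi_cdf \<theta> ?q < phi_cdf \<theta> y" using y q by (intro phi_cdf_strict[OF \<theta>0]) auto
    also have "\<dots> = F 0 (e * y)" unfolding e_def using y q by (intro F_initial[symmetric]) auto
    also have "\<dots> \<le> F 0 x" using y by (intro F_mono T0)
    finally show ?thesis by (simp only: sq)
  qed
qed

end

context mfg_flow
begin

text \<open>\<open>G\<close> has to be clamped because it leaves the unit interval outside
  \<open>{- K..K}\<close>. Inside, the mixture differs from \<open>F\<close> by \<eta> times a
  difference of two numbers in the unit interval.\<close>

lemma G_minus_F:
  assumes "t \<in> {0..T}"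
  shows "\<bar>min 1 (max 0 (G t x)) - F t x\<bar> \<le> \<eta>"
proof -
  consider "x < - K" | "x > K" | "x \<in> {- K..K}" by force
  then show ?thesis
  proof cases
    case 1
    then have "G t x < 0" using G_mono[OF assms, of x "- K"] G_K[OF assms] by simp
    then show ?thesis using F_zero[OF assms, of x] 1 \<eta> by simp
  next
    case 2
    then have "G t x > 1" using G_mono[OF assms, of K x] G_K[OF assms] by simp
    then show ?thesis using F_one[OF assms, of x] 2 \<eta> by simp
  next
    case 3
    have g: "0 \<le> G t x" "G t x \<le> 1"
      using G_mono[OF assms, of "- K" x] G_mono[OF assms, of x K] G_K[OF assms] 3
      by (cases "x = - K"; cases "x = K"; force)+
    define k where "k = (x + K) / (2 * K)"
    have k: "0 \<le> k" "k \<le> 1" using 3 K_pos by (auto simp: k_def)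
    have F: "0 \<le> F t x" "F t x \<le> 1"
    proof -
      show "0 \<le> F t x" unfolding F_def by (intro integral_nonneg m_integrable m_nonneg assms)
      show "F t x \<le> 1" unfolding F_def using 3 by (intro mass_le assms) auto
    qed
    have "G t x * (1 + \<eta>) = F t x + \<eta> * k" using \<eta> by (simp add: G_def k_def)
    then have "G t x - F t x = \<eta> * (k - G t x)" by (simp add: algebra_simps)
    then have "\<bar>G t x - F t x\<bar> = \<eta> * \<bar>k - G t x\<bar>" using \<eta> by (simp add: abs_mult)
    also have "\<dots> \<le> \<eta> * 1" using k g \<eta> by (intro mult_left_mono) (auto simp: abs_le_iff)
    finally show ?thesis using g by simp
  qed
qed

text \<open>The substitution x = X(t, s) turns the integral into that of x^2 against the density
  \<open>n\<close>. The part from \<open>m\<close> is at most r^2, and the uniform part adds a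
  multiple of \<eta>.\<close>

lemma second_moment:
  assumes t: "t \<in> {0..T}" and r: "0 \<le> r" "\<And>x. \<bar>x\<bar> > r \<Longrightarrow> m t x = 0"
  shows "integral {0..1} (\<lambda>s. (X t s)\<^sup>2) \<le> r\<^sup>2 + K\<^sup>2 * \<eta>"
proof -
  have nc: "continuous_on S (n t)" for S
    using continuous_on_slices(1)[OF n_cont t] by (rule continuous_on_subset) auto
  define P where "P v = integral {- K..v} (\<lambda>x. x\<^sup>2 * n t x)" for v
  have Pd: "(P has_real_derivative v\<^sup>2 * n t v) (at v within {-K..K})" if "v \<in> {-K..K}" for v
    unfolding P_def using that by (intro integral_has_real_derivative continuous_intros nc) auto
  have Pc: "continuous_on {-K..K} P" using Pd by (rule DERIV_continuous_on)
  have "((\<lambda>s. (X t s)\<^sup>2) has_integral (P (X t 1) - P (X t 0))) {0..1}"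
  proof (rule fundamental_theorem_of_calculus_interior)
    show "continuous_on {0..1} (\<lambda>s. P (X t s))"
      using continuous_on_compose2[OF Pc slice_cont(1)[OF t]] X_bounds[OF t] by blast
    fix s :: real assume s: "s \<in> {0<..<1}"
    have "X t s \<in> {- K<..<K}"
      using s X_mono[OF t, of 0 s] X_mono[OF t, of s 1] X_ends[OF t] G_X[OF t, of s] G_K[OF t]
      by (auto simp: order_le_less)
    then have "(P has_real_derivative (X t s)\<^sup>2 * n t (X t s)) (at (X t s))"
      using Pd[of "X t s"] by (simp add: at_within_Icc_at)
    from DERIV_chain2[OF this X_deriv_s[OF t, of s]]
    show "((\<lambda>s. P (X t s)) has_vector_derivative (X t s)\<^sup>2) (at s)"
      using n_pos[OF t, of "X t s"] by (simp add: has_real_derivative_iff_has_vector_derivative)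
  qed simp
  then have "integral {0..1} (\<lambda>s. (X t s)\<^sup>2) = P K"
    using X_ends[OF t] by (simp add: integral_unique P_def)
  also have "\<dots> \<le> integral {- K..K} (\<lambda>x. r\<^sup>2 * m t x + K * \<eta> / 2)"
    unfolding P_def
  proof (rule integral_le)
    show "(\<lambda>x. x\<^sup>2 * n t x) integrable_on {- K..K}"
      by (intro integrable_continuous_interval continuous_intros nc)
    show "(\<lambda>x. r\<^sup>2 * m t x + K * \<eta> / 2) integrable_on {- K..K}"
      by (intro integrable_continuous_interval continuous_intros m_cont_x t)
    fix x assume x: "x \<in> {- K..K}"
    have "x\<^sup>2 * n t x \<le> x\<^sup>2 * (m t x + \<eta> / (2 * K))"
    proof (rule mult_left_mono)
      show "n t x \<le> m t x + \<eta> / (2 * K)"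
        unfolding n_def using mK_pos[OF t, of x] \<eta> by (simp add: divide_le_eq)
    qed simp
    also have "\<dots> = x\<^sup>2 * m t x + x\<^sup>2 * (\<eta> / (2 * K))" by (simp add: distrib_left)
    also have "x\<^sup>2 * m t x \<le> r\<^sup>2 * m t x"
    proof (cases "\<bar>x\<bar> > r")
      case False
      then have "x\<^sup>2 \<le> r\<^sup>2" using r(1) by (intro abs_le_square_iff[THEN iffD1]) auto
      then show ?thesis using m_nonneg[OF t] by (intro mult_right_mono) auto
    qed (use r(2) in simp)
    also have "x\<^sup>2 * (\<eta> / (2 * K)) \<le> K\<^sup>2 * (\<eta> / (2 * K))"
      using x \<eta> K_pos by (intro mult_right_mono abs_le_square_iff[THEN iffD1]) auto
    also have "\<dots> = K * \<eta> / 2" using K_pos by (simp add: power2_eq_square)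
    finally show "x\<^sup>2 * n t x \<le> r\<^sup>2 * m t x + K * \<eta> / 2" by simp
  qed
  also have "\<dots> = r\<^sup>2 * integral {- K..K} (m t) + K * \<eta> / 2 * (2 * K)"
    using m_integrable[OF t, of "- K" K] K_pos
    by (subst Henstock_Kurzweil_Integration.integral_add) (auto intro!: integrable_on_mult_right)
  also have "\<dots> \<le> r\<^sup>2 * 1 + K\<^sup>2 * \<eta>"
    using mass_le[OF t, of "- K" K] K_pos by (intro add_mono mult_left_mono) (auto simp: power2_eq_square)
  finally show ?thesis by simp
qed

lemma terminal_moment:
  assumes r: "0 \<le> r" "\<And>x. \<bar>x\<bar> > r \<Longrightarrow> m T x = 0"
  shows "integral {0..1} (\<lambda>s. (W T s)\<^sup>2) \<le> 2 * (r\<^sup>2 + K\<^sup>2 * \<eta>) + 2 * (R_alpha \<theta> * (T + \<epsilon>) powr alpha \<theta>)\<^sup>2"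
proof -
  let ?b = "R_alpha \<theta> * (T + \<epsilon>) powr alpha \<theta>"
  have t: "T \<in> {0..T}" using T by simp
  have "integral {0..1} (\<lambda>s. (W T s)\<^sup>2) \<le> integral {0..1} (\<lambda>s. 2 * (X T s)\<^sup>2 + 2 * ?b\<^sup>2)"
  proof (rule integral_le)
    fix s :: real assume s: "s \<in> {0..1}"
    have "\<bar>Z T s\<bar> \<le> \<bar>?b\<bar>"
      using mult_right_mono[OF quantile_bound[OF s], of "(T + \<epsilon>) powr alpha \<theta>"] R_pos
      by (simp add: Z_def abs_mult mult.commute)
    then have "(Z T s)\<^sup>2 \<le> ?b\<^sup>2" by (rule abs_le_square_iff[THEN iffD1])
    moreover have "0 \<le> (X T s + Z T s)\<^sup>2" by simp
    then have "(W T s)\<^sup>2 \<le> 2 * (X T s)\<^sup>2 + 2 * (Z T s)\<^sup>2"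
      by (simp add: W_def power2_eq_square algebra_simps)
    ultimately show "(W T s)\<^sup>2 \<le> 2 * (X T s)\<^sup>2 + 2 * ?b\<^sup>2" by linarith
  qed (intro integrable_continuous_interval continuous_intros slice_cont t)+
  also have "\<dots> = 2 * integral {0..1} (\<lambda>s. (X T s)\<^sup>2) + 2 * ?b\<^sup>2"
    by (subst Henstock_Kurzweil_Integration.integral_add)
      (auto intro!: integrable_continuous_interval continuous_intros slice_cont t)
  also have "\<dots> \<le> 2 * (r\<^sup>2 + K\<^sup>2 * \<eta>) + 2 * ?b\<^sup>2"
    using second_moment[OF t r] by simp
  finally show ?thesis .
qed

end

context mfg_limit
begin

text \<open>The pair \<open>x\<close>, \<open>g\<close> is a regularised quantile function with its
  clamped distribution function; the equivalence between them is all that the later limit needs. The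
  constants of the regularisation have disappeared into the tolerance \<open>e\<close>.\<close>

lemma approx_estimate:
  assumes t: "0 < t" "t < T" and e: "e > 0"
  obtains x g where "continuous_on {0..1} x" "\<And>y. \<bar>g y - F t y\<bar> \<le> e"
    "\<And>s y. s \<in> {0<..<1} \<Longrightarrow> s \<le> g y \<longleftrightarrow> x s \<le> y"
    "integral {0..1} (\<lambda>s. (x s - (t + \<epsilon>) powr alpha \<theta> * phi_quantile \<theta> s)\<^sup>2)
      \<le> (t + \<epsilon>)\<^sup>2 * (2 * (r\<^sup>2 + (R_alpha \<theta> * (T + \<epsilon>) powr alpha \<theta>)\<^sup>2) / (T + \<epsilon>)\<^sup>2 + e)"
proof -
  define h where "h j = inverse (real (Suc j))" for j
  have h: "0 < h j" "h j \<le> 1" for j by (auto simp: h_def inverse_eq_divide)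
  have h0: "h \<longlonglongrightarrow> 0" unfolding h_def by (rule LIMSEQ_inverse_real_of_nat)
  \<comment> \<open>Paired below with \<delta> = \<epsilon> h, so that both \<delta> and \<eta> /
    \<delta> = h / \<epsilon> tend to 0.\<close>
  define \<eta> where "\<eta> j = (h j)\<^sup>2" for j
  have \<eta>: "0 < \<eta> j" "\<eta> j \<le> 1" for j using h[of j] by (auto simp: \<eta>_def power_le_one)
  interpret f: mfg_flow T L A K m p \<theta> \<epsilon> B u ut "\<eta> j" for j by (rule mfg_flow[OF \<eta>])
  have tT: "t \<in> {0..T}" "0 \<in> {0..T}" "T \<in> {0..T}" using t T by auto
  have W0: "(\<lambda>j. integral {0..1} (\<lambda>s. \<bar>f.W j 0 s\<bar>)) \<longlonglongrightarrow> 0"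
  proof (rule integral_dominated_interior[where C="2 * K"])
    show "continuous_on {0..1} (\<lambda>s. \<bar>f.W j 0 s\<bar>)" for j by (intro continuous_intros f.slice_cont tT)
    show "\<bar>\<bar>f.W j 0 s\<bar>\<bar> \<le> 2 * K" if "s \<in> {0..1}" for j s using f.W_bound[OF tT(2) that] by simp
    fix s :: real assume s: "s \<in> {0<..<1}"
    have G0: "(\<lambda>j. f.G j 0 y) \<longlonglongrightarrow> F 0 y" for y
    proof -
      have "(\<lambda>j. (F 0 y + (h j)\<^sup>2 * (y + K) / (2 * K)) / (1 + (h j)\<^sup>2)) \<longlonglongrightarrow> (F 0 y + 0\<^sup>2 * (y + K) / (2 * K)) / (1 + 0\<^sup>2)"
        using K_pos by (intro tendsto_intros h0) auto
      then show ?thesis unfolding f.G_def by (simp add: \<eta>_def)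
    qed
    have "(\<lambda>j. f.X j 0 s) \<longlonglongrightarrow> z0 s"
    proof (rule order_tendstoI)
      fix y assume "y < z0 s"
      then have "F 0 y < s" by (rule F_initial_strict(1)[OF s])
      from order_tendstoD(2)[OF G0 this] show "\<forall>\<^sub>F j in sequentially. y < f.X j 0 s"
      proof eventually_elim
        case (elim j)
        then have "f.G j 0 y < f.G j 0 (f.X j 0 s)" by (simp add: f.G_X[OF tT(2)])
        then show ?case using f.G_mono[OF tT(2)] by (metis linorder_neqE_linordered_idom less_asym less_irrefl)
      qed
    next
      fix y assume "z0 s < y"
      then have "s < F 0 y" by (rule F_initial_strict(2)[OF s])
      from order_tendstoD(1)[OF G0 this] show "\<forall>\<^sub>F j in sequentially. f.X j 0 s < y"
      proof eventually_elim
        case (elim j)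
        then have "f.G j 0 (f.X j 0 s) < f.G j 0 y" by (simp add: f.G_X[OF tT(2)])
        then show ?case using f.G_mono[OF tT(2)] by (metis linorder_neqE_linordered_idom less_asym less_irrefl)
      qed
    qed
    then have "(\<lambda>j. \<bar>f.X j 0 s - z0 s\<bar>) \<longlonglongrightarrow> \<bar>z0 s - z0 s\<bar>" by (intro tendsto_intros)
    then show "(\<lambda>j. \<bar>f.W j 0 s\<bar>) \<longlonglongrightarrow> 0" by (simp add: f.W_def f.Z_def z0_def)
  qed
  define b where "b = R_alpha \<theta> * (T + \<epsilon>) powr alpha \<theta>"
  \<comment> \<open>Neither \<open>speed\<close> nor \<open>C0\<close> depends on \<eta>, so both
    are constants in the limit.\<close>
  define w where "w = f.speed"
  define c where "c = f.C0"
  define err where "err j = 2 * (1 / \<epsilon> * (w + 2 * K / \<epsilon>) * integral {0..1} (\<lambda>s. \<bar>f.W j 0 s\<bar>)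
      + (\<epsilon> * h j / 2 * (2 * K / \<epsilon>\<^sup>2 + w / \<epsilon>)\<^sup>2 + c * h j / \<epsilon>) * T) + 2 * (K\<^sup>2 * (h j)\<^sup>2) / (T + \<epsilon>)\<^sup>2" for j
  have "err \<longlonglongrightarrow> 2 * (1 / \<epsilon> * (w + 2 * K / \<epsilon>) * 0 + (\<epsilon> * 0 / 2 * (2 * K / \<epsilon>\<^sup>2 + w / \<epsilon>)\<^sup>2 + c * 0 / \<epsilon>) * T)
      + 2 * (K\<^sup>2 * 0\<^sup>2) / (T + \<epsilon>)\<^sup>2"
    unfolding err_def using T \<epsilon> by (intro tendsto_intros h0 W0) auto
  then have "err \<longlonglongrightarrow> 0" by simp
  moreover have "\<eta> \<longlonglongrightarrow> 0" unfolding \<eta>_def using tendsto_power[OF h0, of 2] by simp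
  ultimately have "\<forall>\<^sub>F j in sequentially. err j < e \<and> \<eta> j < e"
    using order_tendstoD(2)[OF _ e] eventually_conj by blast
  from eventually_happens'[OF sequentially_bot this]
  obtain j where j: "err j < e" "\<eta> j < e" by blast
  show thesis
  proof (rule that[of "f.X j t" "\<lambda>y. min 1 (max 0 (f.G j t y))"])
    show "continuous_on {0..1} (f.X j t)" by (rule f.slice_cont[OF tT(1)])
    show "\<bar>min 1 (max 0 (f.G j t y)) - F t y\<bar> \<le> e" for y
      using f.G_minus_F[OF tT(1), of j y] j(2) by linarith
    show "s \<le> min 1 (max 0 (f.G j t y)) \<longleftrightarrow> f.X j t s \<le> y" if s: "s \<in> {0<..<1}" for s y
    proof -
      have "s \<le> f.G j t y \<longleftrightarrow> f.X j t s \<le> y"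
        using f.G_X[OF tT(1), of j s] f.G_mono[OF tT(1), of y "f.X j t s" j]
          f.G_mono[OF tT(1), of "f.X j t s" y j] by (metis less_irrefl not_le order_le_less)
      then show ?thesis using s by auto
    qed
    define I where "I = integral {0..1} (\<lambda>s. (f.W j t s)\<^sup>2)"
    have "I / (2 * (t + \<epsilon>)\<^sup>2) \<le> integral {0..1} (\<lambda>s. (f.W j T s)\<^sup>2) / (2 * (T + \<epsilon>)\<^sup>2)
       + 1 / \<epsilon> * (w + 2 * K / \<epsilon>) * integral {0..1} (\<lambda>s. \<bar>f.W j 0 s\<bar>)
       + (\<epsilon> * h j / 2 * (2 * K / \<epsilon>\<^sup>2 + w / \<epsilon>)\<^sup>2 + c * \<eta> j / (\<epsilon> * h j)) * T"
      unfolding w_def c_def I_def by (rule f.decay_regularized) (use t \<epsilon> h[of j] in auto)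
    also have "integral {0..1} (\<lambda>s. (f.W j T s)\<^sup>2) / (2 * (T + \<epsilon>)\<^sup>2) \<le> (2 * (r\<^sup>2 + K\<^sup>2 * \<eta> j) + 2 * b\<^sup>2) / (2 * (T + \<epsilon>)\<^sup>2)"
      using f.terminal_moment[OF r(1) terminal, of j] by (intro divide_right_mono) (auto simp: b_def)
    also have "c * \<eta> j / (\<epsilon> * h j) = c * h j / \<epsilon>"
      using h(1)[of j] by (simp add: \<eta>_def power2_eq_square)
    finally have "I / (2 * (t + \<epsilon>)\<^sup>2) \<le> (2 * (r\<^sup>2 + b\<^sup>2) / (T + \<epsilon>)\<^sup>2 + err j) / 2"
      by (simp add: err_def \<eta>_def add_divide_distrib)
    then have "I / (t + \<epsilon>)\<^sup>2 \<le> 2 * (r\<^sup>2 + b\<^sup>2) / (T + \<epsilon>)\<^sup>2 + err j" by simp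
    then have "I / (t + \<epsilon>)\<^sup>2 \<le> 2 * (r\<^sup>2 + b\<^sup>2) / (T + \<epsilon>)\<^sup>2 + e" using j(1) by linarith
    moreover have "(t + \<epsilon>)\<^sup>2 > 0" using t \<epsilon> by simp
    ultimately have "I \<le> (t + \<epsilon>)\<^sup>2 * (2 * (r\<^sup>2 + b\<^sup>2) / (T + \<epsilon>)\<^sup>2 + e)"
      by (simp add: pos_divide_le_eq mult.commute)
    then show "integral {0..1} (\<lambda>s. (f.X j t s - (t + \<epsilon>) powr alpha \<theta> * phi_quantile \<theta> s)\<^sup>2)
      \<le> (t + \<epsilon>)\<^sup>2 * (2 * (r\<^sup>2 + (R_alpha \<theta> * (T + \<epsilon>) powr alpha \<theta>)\<^sup>2) / (T + \<epsilon>)\<^sup>2 + e)"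
      by (simp add: I_def f.W_def f.Z_def b_def)
  qed
qed

end

section \<open>From an approximate solution to the data of the flow\<close>

lemma hoelder_continuous:
  assumes "\<gamma> > 0" "hoelder_on \<gamma> S f"
  shows "continuous_on S f"
  unfolding continuous_on_def
proof
  fix x assume x: "x \<in> S"
  obtain L where L: "\<And>p q. p \<in> S \<Longrightarrow> q \<in> S \<Longrightarrow> \<bar>f p - f q\<bar> \<le> L * dist p q powr \<gamma>"
    using assms(2) unfolding hoelder_on_def by blast
  have "((\<lambda>y. f y - f x) \<longlongrightarrow> 0) (at x within S)"
  proof (rule Lim_null_comparison)
    show "\<forall>\<^sub>F y in at x within S. norm (f y - f x) \<le> L * dist y x powr \<gamma>"
      unfolding eventually_at_filter by (rule always_eventually) (use L x in auto)
    have "((\<lambda>y. dist y x) \<longlongrightarrow> 0) (at x within S)"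
      using tendsto_dist[OF tendsto_ident_at[of x S] tendsto_const[of x]] by simp
    then have "((\<lambda>y. L * dist y x powr \<gamma>) \<longlongrightarrow> L * 0 powr \<gamma>) (at x within S)"
      using assms(1) by (intro tendsto_mult tendsto_const tendsto_powr') (auto simp: eventually_at_filter)
    then show "((\<lambda>y. L * dist y x powr \<gamma>) \<longlongrightarrow> 0) (at x within S)" by simp
  qed
  then show "(f \<longlongrightarrow> f x) (at x within S)" by (simp add: LIM_zero_iff)
qed

lemma lipschitz_deriv_bound:
  fixes f :: "real \<Rightarrow> real"
  assumes lip: "\<And>y z. \<bar>f y - f z\<bar> \<le> L * \<bar>y - z\<bar>" and d: "(f has_real_derivative d) (at x)"
  shows "\<bar>d\<bar> \<le> L"
proof -
  have "((\<lambda>y. \<bar>(f y - f x) / (y - x)\<bar>) \<longlongrightarrow> \<bar>d\<bar>) (at x)"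
    using d by (intro tendsto_rabs) (simp add: has_field_derivative_iff)
  moreover have "\<forall>\<^sub>F y in at x. \<bar>(f y - f x) / (y - x)\<bar> \<le> L"
    unfolding eventually_at_filter
    by (rule always_eventually) (use lip in \<open>auto simp: divide_le_eq\<close>)
  ultimately show ?thesis by (rule tendsto_upperbound) simp
qed

lemma density_measure_prob:
  assumes "real_distribution (density_measure f)" and [measurable]: "f \<in> borel_measurable borel"
    and "\<And>x. f x \<ge> 0"
  shows "integrable lborel f" "(\<integral>x. f x \<partial>lborel) = 1"
proof -
  interpret real_distribution "density_measure f" by fact
  have "(\<integral>\<^sup>+x. ennreal (f x) \<partial>lborel) = 1"
    using emeasure_space_1 by (simp add: emeasure_density)
  then have "has_bochner_integral lborel f 1"
    using assms by (intro has_bochner_integral_nn_integral) auto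
  then show "integrable lborel f" "(\<integral>x. f x \<partial>lborel) = 1"
    by (auto simp: has_bochner_integral_iff)
qed

lemma cdf_density_measure:
  assumes f: "integrable lborel f" "\<And>x. f x \<ge> 0"
  shows "cdf (density_measure f) y = (LINT x:{..y}|lborel. f x)"
proof -
  have [measurable]: "f \<in> borel_measurable borel" using f(1) by auto
  have "emeasure (density_measure f) {..y} = (\<integral>\<^sup>+x. ennreal (indicator {..y} x * f x) \<partial>lborel)"
    by (subst emeasure_density) (auto intro!: nn_integral_cong simp: indicator_def)
  also have "\<dots> = ennreal (\<integral>x. indicator {..y} x * f x \<partial>lborel)"
    using f integrable_mult_indicator[OF _ f(1), of "{..y}"] by (intro nn_integral_eq_integral) auto
  finally show ?thesis
    unfolding cdf_def measure_def set_lebesgue_integral_def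
    using f(2) by (simp add: Bochner_Integration.integral_nonneg)
qed

lemma hk_integral_le_mass:
  fixes f :: "real \<Rightarrow> real"
  assumes f: "integrable lborel f" "\<And>x. f x \<ge> (0::real)"
  shows "integral {y..z} f \<le> (\<integral>x. f x \<partial>lborel)"
proof -
  have i: "set_integrable lborel {y..z} f"
    unfolding set_integrable_def by (rule integrable_mult_indicator[OF _ f(1)]) simp
  have "integral {y..z} f = (LINT x:{y..z}|lborel. f x)"
    using set_borel_integral_eq_integral(2)[OF i] by simp
  also have "\<dots> \<le> (\<integral>x. f x \<partial>lborel)"
    unfolding set_lebesgue_integral_def using f i[unfolded set_integrable_def]
    by (intro integral_mono) (auto simp: indicator_def)
  finally show ?thesis .
qed

lemma hk_integral_eq_lborel:
  fixes f :: "real \<Rightarrow> real"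
  assumes f: "integrable lborel f" and S: "S \<in> sets borel" and T: "\<And>x. x \<in> S - {y..z} \<Longrightarrow> f x = (0::real)"
    "{y..z} \<subseteq> S"
  shows "integral {y..z} f = (LINT x:S|lborel. f x)"
proof -
  have i: "set_integrable lborel {y..z} f"
    unfolding set_integrable_def by (rule integrable_mult_indicator[OF _ f(1)]) simp
  have "integral {y..z} f = (LINT x:{y..z}|lborel. f x)"
    using set_borel_integral_eq_integral(2)[OF i] by simp
  also have "\<dots> = (LINT x:S|lborel. f x)"
    unfolding set_lebesgue_integral_def using T
    by (intro Bochner_Integration.integral_cong) (auto simp: indicator_def)
  finally show ?thesis .
qed

lemma planning_solution_distribution:
  assumes "planning_solution \<theta> T \<mu>0 \<mu>T u m" "t \<in> {0<..<T}"
  shows "real_distribution (density_measure (m t))"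
  using assms unfolding planning_solution_def weakly_continuous_curve_def
  by (metis atLeastAtMost_iff greaterThanLessThan_iff less_imp_le)

text \<open>The quantities \<open>L\<close>, \<open>K\<close>, \<open>B\<close> chosen in the proof
  may depend on \<epsilon> in any manner. None of them survives in the conclusion, which is why
  \<epsilon> may tend to 0 afterwards.\<close>

lemma approx_solution_estimate:
  assumes T: "T > 0" and \<theta>: "\<theta> \<ge> 1" and \<epsilon>: "\<epsilon> > 0"
    and mT: "\<And>x. mT x \<ge> 0" and r: "r \<ge> 0" "\<And>x. \<bar>x\<bar> > r \<Longrightarrow> mT x = 0"
    and sol: "approx_solution \<theta> T mT C \<epsilon> u m"
    and t: "0 < t" "t < T" and e: "e > 0"
  obtains x g where "continuous_on {0..1} x" "\<And>y. \<bar>g y - cdf (density_measure (m t)) y\<bar> \<le> e"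
    "\<And>s y. s \<in> {0<..<1} \<Longrightarrow> s \<le> g y \<longleftrightarrow> x s \<le> y"
    "integral {0..1} (\<lambda>s. (x s - (t + \<epsilon>) powr alpha \<theta> * phi_quantile \<theta> s)\<^sup>2)
      \<le> (t + \<epsilon>)\<^sup>2 * (2 * (r\<^sup>2 + (R_alpha \<theta> * (T + \<epsilon>) powr alpha \<theta>)\<^sup>2) / (T + \<epsilon>)\<^sup>2 + e)"
proof -
  have \<theta>0: "\<theta> > 0" using \<theta> by simp
  let ?R = "R_alpha \<theta>"
  have R: "?R > 0" by (rule R_alpha(1)[OF \<theta>0])
  note sol = sol[unfolded approx_solution_def]
  have plan: "planning_solution \<theta> T (density_measure (initial_approx \<theta> \<epsilon>)) (density_measure mT) u m"
    and m0: "m 0 = initial_approx \<theta> \<epsilon>" and mT': "m T = mT" using sol by auto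
  note plan' = plan[unfolded planning_solution_def]
  obtain L where Llip: "L-lipschitz_on ({0..T} \<times> UNIV) (\<lambda>(t, x). u t x)" using sol by auto
  obtain \<gamma> where \<gamma>: "\<gamma> > 0" "hoelder_on \<gamma> ({0..T} \<times> UNIV) (\<lambda>(t, x). m t x)" using sol by auto
  have mc: "continuous_on ({0..T} \<times> UNIV) (\<lambda>(t, x). m t x)" by (rule hoelder_continuous[OF \<gamma>])
  have L0: "L \<ge> 0" using Llip by (rule lipschitz_on_nonneg)
  have Ck: "Ck_on 1 ({0<..<T} \<times> UNIV) u" using plan' by blast
  define p where "p = d_space u"
  define ut where "ut = d_time u"
  have pc: "continuous_on ({0<..<T} \<times> UNIV) (\<lambda>(t, x). p t x)"
    and utc: "continuous_on ({0<..<T} \<times> UNIV) (\<lambda>(t, x). ut t x)"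
    using Ck by (auto simp: p_def ut_def)
  have px: "(u t has_real_derivative p t x) (at x)" if "t \<in> {0<..<T}" for t x
    using Ck that by (auto simp: p_def d_space_def field_differentiable_derivI)
  have pt: "((\<lambda>t. u t x) has_real_derivative ut t x) (at t)" if "t \<in> {0<..<T}" for t x
    using Ck that by (auto simp: ut_def d_time_def field_differentiable_derivI)
  have pb: "\<bar>p t x\<bar> \<le> L" if "t \<in> {0<..<T}" for t x
  proof (rule lipschitz_deriv_bound[OF _ px[OF that]])
    show "\<bar>u t y - u t z\<bar> \<le> L * \<bar>y - z\<bar>" for y z
      using lipschitz_onD[OF Llip, of "(t, y)" "(t, z)"] that by (auto simp: dist_Pair_Pair dist_real_def)
  qed
  have nn: "m t x \<ge> 0" if tt: "t \<in> {0..T}" for t x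
  proof -
    consider "t = 0" | "t = T" | "t \<in> {0<..<T}"
      using tt by (metis atLeastAtMost_iff greaterThanLessThan_iff order_le_less)
    then show ?thesis
    proof cases
      case 1
      then show ?thesis by (simp add: m0 initial_approx_def phi_nonneg[OF \<theta>0])
    qed (use mT mT' plan' in auto)
  qed
  have mcx: "continuous_on UNIV (m t)" if "t \<in> {0..T}" for t
    by (rule continuous_on_slices(1)[OF mc that])
  have meas: "m t \<in> borel_measurable borel" if "t \<in> {0..T}" for t
    by (rule borel_measurable_continuous_onI[OF mcx[OF that]])
  have distr: "real_distribution (density_measure (m t))" if "t \<in> {0..T}" for t
  proof -
    obtain \<mu> where \<mu>: "weakly_continuous_curve {0..T} \<mu>" "\<mu> 0 = density_measure (m 0)" "\<mu> T = density_measure (m T)"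
        "\<forall>t\<in>{0<..<T}. \<mu> t = density_measure (m t)"
      using plan' unfolding m0 mT' by auto
    then have "\<mu> t = density_measure (m t)"
      using that by (cases "t = 0"; cases "t = T") auto
    then show ?thesis using \<mu>(1) that unfolding weakly_continuous_curve_def by metis
  qed
  have int: "integrable lborel (m t)" "(\<integral>x. m t x \<partial>lborel) = 1" if "t \<in> {0..T}" for t
    using density_measure_prob[OF distr[OF that] meas[OF that] nn[OF that]] by auto
  define A where "A = ?R * \<epsilon> powr alpha \<theta>"
  have A: "A > 0" using R \<epsilon> by (simp add: A_def)
  \<comment> \<open>Each term meets one requirement: the reach of the mass, the support of the
    self-similar solution up to time T, and the terminal support; the 1 makes the first inequality
    strict.\<close>
  define K where "K = A + L * T + ?R * (T + \<epsilon>) powr alpha \<theta> + r + 1"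
  have Kb: "K > A + L * T" "?R * (T + \<epsilon>) powr alpha \<theta> \<le> K" "r \<le> K"
  proof -
    have "0 \<le> L * T" "0 \<le> ?R * (T + \<epsilon>) powr alpha \<theta>" using L0 T R by auto
    then show "K > A + L * T" "?R * (T + \<epsilon>) powr alpha \<theta> \<le> K" "r \<le> K"
      using A r(1) by (auto simp: K_def)
  qed
  have m0z: "m 0 x = 0" if "\<bar>x\<bar> \<ge> A" for x
  proof -
    have "?R * \<epsilon> powr alpha \<theta> \<le> \<bar>x\<bar>" using that by (simp add: A_def)
    then have "?R \<le> \<bar>\<epsilon> powr (- alpha \<theta>) * x\<bar>"
      using \<epsilon> by (simp add: abs_mult powr_minus field_simps)
    then show ?thesis by (simp add: m0 initial_approx_def phi_zero[OF \<theta>0])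
  qed
  have T0: "0 \<in> {0..T}" using T by simp
  have flow: "mass_flow T L A K m p"
  proof
    show "T > 0" "L \<ge> 0" "A > 0" "K > A + L * T" by (fact T L0 A Kb)+
    show "continuous_on ({0..T} \<times> UNIV) (\<lambda>(t, x). m t x)" by (fact mc)
    show "continuous_on ({0<..<T} \<times> UNIV) (\<lambda>(t, x). p t x)" by (fact pc)
    show "m t x \<ge> 0" if "t \<in> {0..T}" for t x by (rule nn[OF that])
    show "\<bar>p t x\<bar> \<le> L" if "t \<in> {0<..<T}" for t x by (rule pb[OF that])
    have mcT: "continuous_on ({0<..<T} \<times> UNIV) (\<lambda>(t, x). m t x)"
      by (rule continuous_on_subset[OF mc]) auto
    show "integral {y..z} (\<lambda>x. m t1 x - m t0 x) = integral {t0..t1} (\<lambda>t. m t z * p t z - m t y * p t y)"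
      if "0 < t0" "t0 \<le> t1" "t1 < T" "y \<le> z" for t0 t1 y z
    proof (rule continuity_equation_rectangle[OF mcT _ _ that, where w="\<lambda>t x. m t x * p t x"])
      show "continuous_on ({0<..<T} \<times> UNIV) (\<lambda>(t, x). m t x * p t x)"
        using continuous_on_mult[OF mcT pc] by (simp add: split_beta')
      fix \<psi> assume "test_function ({0<..<T} \<times> UNIV) \<psi>"
      then have "(\<integral>(t, x). m t x * (d_time \<psi> t x - d_space u t x * d_space \<psi> t x) \<partial>lborel) = 0"
        using plan' by blast
      then show "(\<integral>(t, x). m t x * d_time \<psi> t x - m t x * p t x * d_space \<psi> t x \<partial>lborel) = 0"
        by (simp add: p_def right_diff_distrib mult.assoc)
    qed
    show "integral {y..z} (m t) \<le> 1" if "t \<in> {0..T}" "y \<le> z" for t y z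
      using hk_integral_le_mass[OF int(1)[OF that(1)] nn[OF that(1)], of y z] int(2)[OF that(1)] by simp
    have "integral {- A..A} (m 0) = (LINT x:UNIV|lborel. m 0 x)"
      by (rule hk_integral_eq_lborel[OF int(1)[OF T0]]) (auto intro: m0z)
    then show "integral {- A..A} (m 0) = 1"
      using int(2)[OF T0] by (simp add: set_lebesgue_integral_def)
  qed
  interpret mass_flow T L A K m p by (rule flow)
  \<comment> \<open>A global bound, because \<open>m\<close> is continuous on a compact rectangle
    and vanishes outside it.\<close>
  obtain B where B: "\<And>t x. t \<in> {0..T} \<Longrightarrow> m t x \<le> B"
  proof -
    have "compact ((\<lambda>(t, x). m t x) ` ({0..T} \<times> {- K..K}))"
      by (intro compact_continuous_image continuous_on_subset[OF mc] compact_Times compact_Icc) auto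
    then obtain B where B: "\<And>t x. t \<in> {0..T} \<Longrightarrow> x \<in> {- K..K} \<Longrightarrow> \<bar>m t x\<bar> \<le> B"
      unfolding compact_eq_bounded_closed bounded_iff by fastforce
    have "m t x \<le> B" if t: "t \<in> {0..T}" for t x
    proof (cases "x \<in> {- K..K}")
      case False
      then have "m t x = 0" by (intro m_support t) auto
      also have "0 \<le> B" using B[OF t, of 0] K_pos by auto
      finally show ?thesis .
    qed (use B[OF t, of x] in auto)
    then show ?thesis by (rule that)
  qed
  have HJ: "- ut t x + 1/2 * (p t x)\<^sup>2 = m t x powr \<theta>" if "t \<in> {0<..<T}" for t x
    using plan' that by (auto simp: p_def ut_def)
  have rT: "m T x = 0" if "\<bar>x\<bar> > r" for x using r(2)[OF that] mT' by simp
  interpret mfg_limit T L A K m p \<theta> \<epsilon> B u ut r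
    by unfold_locales (fact \<theta> \<epsilon> Llip px pt utc HJ B Kb m0 r rT)+
  have tT: "t \<in> {0..T}" using t by auto
  have cdf: "cdf (density_measure (m t)) y = F t y" for y
  proof (cases "y \<ge> - K - 1")
    case True
    have "F t y = (LINT x:{..y}|lborel. m t x)"
      unfolding F_def using True
      by (intro hk_integral_eq_lborel int(1)[OF tT] m_support[OF tT]) (auto simp: abs_if)
    then show ?thesis using cdf_density_measure[OF int(1)[OF tT] nn[OF tT]] by simp
  next
    case False
    have "(LINT x:{..y}|lborel. m t x) = (LINT x:{..y}|lborel. 0)"
      unfolding set_lebesgue_integral_def using False K_pos
      by (intro Bochner_Integration.integral_cong) (auto simp: indicator_def intro!: m_support[OF tT])
    then show ?thesis
      using cdf_density_measure[OF int(1)[OF tT] nn[OF tT]] F_zero[OF tT, of y] False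
      by (simp add: set_lebesgue_integral_def)
  qed
  show thesis
    by (rule approx_estimate[OF t e], rule that, unfold cdf) assumption+
qed


section \<open>Quantile couplings\<close>

abbreviation unit_interval :: "real measure" where
  "unit_interval \<equiv> restrict_space lborel {0<..<1}"

definition quantile :: "real measure \<Rightarrow> real \<Rightarrow> real" where
  "quantile \<mu> \<omega> = Inf {x. \<omega> \<le> cdf \<mu> x}"

text \<open>The pseudo-inverse from Skorohod's theorem, as in \<open>cdf_distribution\<close>. Being
  monotone, it has only countably many discontinuities.\<close>

lemma
  assumes "real_distribution \<mu>"
  shows quantile_le_iff: "\<omega> \<in> {0<..<1} \<Longrightarrow> quantile \<mu> \<omega> \<le> y \<longleftrightarrow> \<omega> \<le> cdf \<mu> y"
    and quantile_measurable: "quantile \<mu> \<in> borel_measurable unit_interval"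
    and distr_quantile: "distr unit_interval borel (quantile \<mu>) = \<mu>"
    and quantile_discontinuities: "countable {\<omega>\<in>{0<..<1}. \<not> isCont (quantile \<mu>) \<omega>}"
proof -
  interpret cdf_distribution \<mu> by (simp add: cdf_distribution_def assms)
  have q: "quantile \<mu> = I" by (auto simp: quantile_def)
  show "\<omega> \<in> {0<..<1} \<Longrightarrow> quantile \<mu> \<omega> \<le> y \<longleftrightarrow> \<omega> \<le> cdf \<mu> y"
    unfolding q using pseudoinverse[of \<omega> y] by simp
  have "borel_measurable (restrict_space lborel {0<..<1::real}) = borel_measurable (restrict_space borel {0<..<1})"
    by (intro measurable_cong_sets) (auto simp: sets_restrict_space)
  then show "quantile \<mu> \<in> borel_measurable unit_interval"
    unfolding q using measurable_CI by simp
  show "distr unit_interval borel (quantile \<mu>) = \<mu>" unfolding q by (rule distr_I_eq_M)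
  show "countable {\<omega>\<in>{0<..<1}. \<not> isCont (quantile \<mu>) \<omega>}"
    unfolding q using mono_on_ctble_discont[OF mono_I]
    by (simp add: at_within_open[of _ "{0 <..< 1}"] cong: conj_cong)
qed

text \<open>The lower bound follows from the equivalences alone. For the upper one a strict
  inequality is missing at level \<omega>; it is gained from a slightly larger level, whose quantile
  is still below \<open>y\<close> because the quantile function is continuous at \<omega>.\<close>

lemma quantile_tendsto:
  assumes \<mu>: "real_distribution \<mu>" and \<omega>: "\<omega> \<in> {0<..<1}" "isCont (quantile \<mu>) \<omega>"
    and g: "\<And>y. (\<lambda>k. g k y) \<longlonglongrightarrow> cdf \<mu> y"
    and x: "\<And>k y. \<omega> \<le> g k y \<longleftrightarrow> x k \<le> y"
  shows "x \<longlonglongrightarrow> quantile \<mu> \<omega>"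
proof (rule order_tendstoI)
  fix y assume "y < quantile \<mu> \<omega>"
  then have "cdf \<mu> y < \<omega>" using quantile_le_iff[OF \<mu> \<omega>(1), of y] by simp
  from order_tendstoD(2)[OF g this] show "\<forall>\<^sub>F k in sequentially. y < x k"
  proof eventually_elim
    case (elim k)
    then show ?case using x[of k y] by simp
  qed
next
  fix y assume "quantile \<mu> \<omega> < y"
  then obtain y' where y': "quantile \<mu> \<omega> < y'" "y' < y" using dense by blast
  have "(quantile \<mu> \<longlongrightarrow> quantile \<mu> \<omega>) (at_right \<omega>)"
    using \<omega>(2) unfolding isCont_def by (rule tendsto_within_subset) auto
  from order_tendstoD(2)[OF this y'(1)]
  have "\<forall>\<^sub>F \<omega>' in at_right \<omega>. quantile \<mu> \<omega>' < y'" .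
  moreover have "\<forall>\<^sub>F \<omega>' in at_right \<omega>. \<omega>' \<in> {\<omega><..<1}"
    using \<omega>(1) by (intro eventually_at_right_real) auto
  ultimately have "\<forall>\<^sub>F \<omega>' in at_right \<omega>. quantile \<mu> \<omega>' < y' \<and> \<omega>' \<in> {\<omega><..<1}"
    by eventually_elim simp
  from eventually_happens'[OF trivial_limit_at_right_real this]
  obtain \<omega>' where \<omega>': "quantile \<mu> \<omega>' < y'" "\<omega> < \<omega>'" "\<omega>' < 1" by auto
  then have "\<omega>' \<le> cdf \<mu> y'"
    using quantile_le_iff[OF \<mu>, of \<omega>' y'] \<omega>(1) by auto
  then have "\<omega> < cdf \<mu> y'" using \<omega>' by simp
  from order_tendstoD(1)[OF g this] show "\<forall>\<^sub>F k in sequentially. x k < y"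
  proof eventually_elim
    case (elim k)
    then have "x k \<le> y'" using x[of k y'] by simp
    then show ?case using y' by simp
  qed
qed

text \<open>Feeding one uniform variable into both functions gives a coupling, and any coupling
  bounds the infimum from above.\<close>

lemma wasserstein2_quantile_le:
  assumes f: "f \<in> borel_measurable unit_interval" "g \<in> borel_measurable unit_interval"
    and c: "c \<ge> 0" "(\<integral>\<^sup>+\<omega>. ennreal ((f \<omega> - g \<omega>)\<^sup>2) \<partial>unit_interval) \<le> ennreal (c\<^sup>2)"
  shows "wasserstein2 (distr unit_interval borel f) (distr unit_interval borel g) \<le> ennreal c"
proof -
  define \<pi> where "\<pi> = distr unit_interval (borel :: (real \<times> real) measure) (\<lambda>\<omega>. (f \<omega>, g \<omega>))"
  have m: "(\<lambda>\<omega>. (f \<omega>, g \<omega>)) \<in> borel_measurable unit_interval"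
    using f by (rule borel_measurable_Pair)
  have "\<pi> \<in> couplings (distr unit_interval borel f) (distr unit_interval borel g)"
  proof -
    have "fst \<in> borel_measurable (borel :: (real \<times> real) measure)" "snd \<in> borel_measurable (borel :: (real \<times> real) measure)"
      by (auto intro!: borel_measurable_continuous_onI continuous_intros)
    from distr_distr[OF this(1) m] distr_distr[OF this(2) m] show ?thesis
      unfolding couplings_def \<pi>_def by (simp add: o_def)
  qed
  then have "(INF \<pi>\<in>couplings (distr unit_interval borel f) (distr unit_interval borel g).
      \<integral>\<^sup>+(x, y). ennreal (\<bar>x - y\<bar>\<^sup>2) \<partial>\<pi>) \<le> (\<integral>\<^sup>+(x, y). ennreal (\<bar>x - y\<bar>\<^sup>2) \<partial>\<pi>)"
    by (rule INF_lower)
  also have "\<dots> = (\<integral>\<^sup>+\<omega>. ennreal ((f \<omega> - g \<omega>)\<^sup>2) \<partial>unit_interval)"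
    unfolding \<pi>_def split_beta' by (subst nn_integral_distr[OF m]) (auto simp: borel_prod[symmetric])
  also note c(2)
  finally have le: "(INF \<pi>\<in>couplings (distr unit_interval borel f) (distr unit_interval borel g).
      \<integral>\<^sup>+(x, y). ennreal (\<bar>x - y\<bar>\<^sup>2) \<partial>\<pi>) \<le> ennreal (c\<^sup>2)" (is "?I \<le> _") .
  then have "?I < \<top>" using ennreal_less_top le_less_trans by blast
  moreover have "enn2real ?I \<le> c\<^sup>2" using enn2real_mono[OF le] by simp
  then have "sqrt (enn2real ?I) \<le> c" using c(1) real_le_lsqrt enn2real_nonneg by metis
  ultimately show ?thesis
    unfolding wasserstein2_def ennreal_sqrt_def by (auto intro: ennreal_leI)
qed

text \<open>By Scheffe's lemma, pointwise convergence of probability densities to a probability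
  density is convergence in L^1.\<close>

lemma cdf_tendsto_of_densities:
  assumes f: "\<And>k. real_distribution (density_measure (f k))" "real_distribution (density_measure h)"
    and m: "\<And>k. f k \<in> borel_measurable borel" "h \<in> borel_measurable borel"
    and nn: "\<And>k x. f k x \<ge> 0" "\<And>x. h x \<ge> 0"
    and lim: "\<And>x. (\<lambda>k. f k x) \<longlonglongrightarrow> h x"
  shows "(\<lambda>k. cdf (density_measure (f k)) y) \<longlonglongrightarrow> cdf (density_measure h) y"
proof -
  note fk = density_measure_prob[OF f(1) m(1) nn(1)] and h = density_measure_prob[OF f(2) m(2) nn(2)]
  have one: "(\<integral>\<^sup>+x. norm (f k x) \<partial>lborel) = 1" "(\<integral>\<^sup>+x. norm (h x) \<partial>lborel) = 1" for k
    using nn_integral_eq_integral[OF fk(1)[of k]] nn_integral_eq_integral[OF h(1)] fk(2)[of k] h(2) nn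
    by auto
  have "(\<lambda>k. \<integral>\<^sup>+x. norm (f k x - h x) \<partial>lborel) \<longlonglongrightarrow> 0"
    by (rule Scheffe_lemma2) (use m h lim one in auto)
  moreover have "(\<integral>\<^sup>+x. norm (f k x - h x) \<partial>lborel) = ennreal (\<integral>x. \<bar>f k x - h x\<bar> \<partial>lborel)" for k
    using fk(1)[of k] h(1) by (subst nn_integral_eq_integral) auto
  ultimately have "(\<lambda>k. ennreal (\<integral>x. \<bar>f k x - h x\<bar> \<partial>lborel)) \<longlonglongrightarrow> ennreal 0" by simp
  then have L1: "(\<lambda>k. \<integral>x. \<bar>f k x - h x\<bar> \<partial>lborel) \<longlonglongrightarrow> 0"
    by (subst (asm) tendsto_ennreal_iff) auto
  have "(\<lambda>k. cdf (density_measure (f k)) y - cdf (density_measure h) y) \<longlonglongrightarrow> 0"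
  proof (rule Lim_null_comparison[OF always_eventually L1], rule allI)
    fix k
    have i: "integrable lborel (\<lambda>x. indicat_real {..y} x * f k x)" "integrable lborel (\<lambda>x. indicat_real {..y} x * h x)"
      using integrable_mult_indicator[OF _ fk(1)[of k], of "{..y}"] integrable_mult_indicator[OF _ h(1), of "{..y}"] by auto
    have "cdf (density_measure (f k)) y - cdf (density_measure h) y
        = (\<integral>x. indicat_real {..y} x * f k x - indicat_real {..y} x * h x \<partial>lborel)"
      unfolding cdf_density_measure[OF fk(1) nn(1)] cdf_density_measure[OF h(1) nn(2)] set_lebesgue_integral_def
      using i by simp
    also have "norm \<dots> \<le> (\<integral>x. \<bar>f k x - h x\<bar> \<partial>lborel)"
      using i fk(1)[of k] h(1)
      by (intro integral_norm_bound[THEN order_trans] integral_mono) (auto simp: indicator_def)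
    finally show "norm (cdf (density_measure (f k)) y - cdf (density_measure h) y) \<le> (\<integral>x. \<bar>f k x - h x\<bar> \<partial>lborel)" .
  qed
  then show ?thesis by (simp add: LIM_zero_iff)
qed

lemma nn_integral_unit_interval:
  assumes "continuous_on {0..1} f" "\<And>s. s \<in> {0..1} \<Longrightarrow> f s \<ge> 0"
  shows "(\<integral>\<^sup>+s. ennreal (f s) \<partial>unit_interval) \<le> ennreal (integral {0..1} f)"
proof -
  have i: "set_integrable lborel {0..1} f"
    unfolding set_integrable_def using assms(1) by (rule borel_integrable_compact[OF compact_Icc])
  have "(\<integral>\<^sup>+s. ennreal (f s) \<partial>unit_interval) = (\<integral>\<^sup>+s. ennreal (f s) * indicator {0<..<1} s \<partial>lborel)"
    by (rule nn_integral_restrict_space) simp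
  also have "\<dots> \<le> (\<integral>\<^sup>+s. ennreal (indicator {0..1} s *\<^sub>R f s) \<partial>lborel)"
    by (intro nn_integral_mono) (auto simp: indicator_def)
  also have "\<dots> = ennreal (LINT s:{0..1}|lborel. f s)"
    unfolding set_lebesgue_integral_def using assms(2)
    by (intro nn_integral_eq_integral i[unfolded set_integrable_def]) (auto simp: indicator_def)
  also have "(LINT s:{0..1}|lborel. f s) = integral {0..1} f"
    by (rule set_borel_integral_eq_integral(2)[OF i])
  finally show ?thesis .
qed

lemma continuous_measurable_unit_interval:
  assumes "continuous_on {0..1} f"
  shows "f \<in> borel_measurable unit_interval"
proof -
  have "continuous_on {0<..<1} f" using assms by (rule continuous_on_subset) auto
  then have "f \<in> borel_measurable (restrict_space borel {0<..<1})"
    by (rule borel_measurable_continuous_on_restrict)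
  moreover have "borel_measurable (restrict_space lborel {0<..<1::real}) = borel_measurable (restrict_space borel {0<..<1})"
    by (intro measurable_cong_sets) (auto simp: sets_restrict_space)
  ultimately show ?thesis by simp
qed

text \<open>The equivalence of s \<le> cdf y with quantile s \<le> y determines a quantile. So
  \<open>phi_quantile\<close>, an inverse on the compact support, agrees with the generalised
  inverse on the open unit interval.\<close>

lemma density_measure_phi:
  assumes \<theta>: "\<theta> > 0"
  shows "density_measure (phi \<theta>) = distr unit_interval borel (phi_quantile \<theta>)"
proof -
  let ?R = "R_alpha \<theta>"
  have R: "?R > 0" by (rule R_alpha(1)[OF \<theta>])
  have int: "integrable lborel (phi \<theta>)"
    unfolding phi_def by (rule integrable_profile[OF \<theta> R])
  have [measurable]: "phi \<theta> \<in> borel_measurable borel" using int by auto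
  have "emeasure (density_measure (phi \<theta>)) UNIV = 1"
    using nn_integral_eq_integral[OF int] phi_nonneg[OF \<theta>] R_alpha(2)[OF \<theta>]
    by (simp add: emeasure_density)
  then have \<mu>: "real_distribution (density_measure (phi \<theta>))"
  proof -
    assume 1: "emeasure (density_measure (phi \<theta>)) UNIV = 1"
    interpret prob_space "density_measure (phi \<theta>)" by (rule prob_spaceI) (simp only: space_density space_lborel space_borel 1)
    show ?thesis by unfold_locales (simp only: sets_density sets_lborel)
  qed
  have cdf: "cdf (density_measure (phi \<theta>)) y = phi_cdf \<theta> y" if "y \<ge> - ?R" for y
    unfolding cdf_density_measure[OF int phi_nonneg[OF \<theta>]] phi_cdf_def
    using that by (intro hk_integral_eq_lborel[symmetric] int phi_zero[OF \<theta>]) (auto simp: abs_if)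
  interpret real_distribution "density_measure (phi \<theta>)" by (rule \<mu>)
  have le: "s \<le> cdf (density_measure (phi \<theta>)) y \<longleftrightarrow> phi_quantile \<theta> s \<le> y" if s: "s \<in> {0<..<1}" for s y
  proof -
    have q: "\<bar>phi_quantile \<theta> s\<bar> < ?R" and qs: "phi_cdf \<theta> (phi_quantile \<theta> s) = s"
      using phi_quantile_inside[OF \<theta> s] phi_cdf_quantile[OF \<theta>, of s] s by auto
    have c: "cdf (density_measure (phi \<theta>)) (phi_quantile \<theta> s) = s" using cdf q qs by auto
    show ?thesis
    proof
      assume "phi_quantile \<theta> s \<le> y"
      then show "s \<le> cdf (density_measure (phi \<theta>)) y" using cdf_nondecreasing c by metis
    next
      assume *: "s \<le> cdf (density_measure (phi \<theta>)) y"
      show "phi_quantile \<theta> s \<le> y"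
      proof (rule ccontr)
        assume "\<not> phi_quantile \<theta> s \<le> y"
        \<comment> \<open>Raising \<open>y\<close> to at least \<open>- ?R\<close> reaches the range
          where the distribution function is \<open>phi_cdf\<close>, without passing the
          quantile.\<close>
        then have y: "max y (- ?R) < phi_quantile \<theta> s" using q by auto
        have "cdf (density_measure (phi \<theta>)) y \<le> cdf (density_measure (phi \<theta>)) (max y (- ?R))"
          by (rule cdf_nondecreasing) simp
        also have "\<dots> = phi_cdf \<theta> (max y (- ?R))" by (rule cdf) simp
        also have "\<dots> < phi_cdf \<theta> (phi_quantile \<theta> s)"
          using y q by (intro phi_cdf_strict[OF \<theta>]) auto
        finally show False using * qs by simp
      qed
    qed
  qed
  have eq: "quantile (density_measure (phi \<theta>)) s = phi_quantile \<theta> s" if "s \<in> {0<..<1}" for s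
    using quantile_le_iff[OF \<mu> that] le[OF that] by (metis order_antisym order_refl)
  have "density_measure (phi \<theta>) = distr unit_interval borel (quantile (density_measure (phi \<theta>)))"
    by (rule distr_quantile[OF \<mu>, symmetric])
  also have "\<dots> = distr unit_interval borel (phi_quantile \<theta>)"
    by (rule distr_cong) (auto simp: space_restrict_space eq)
  finally show ?thesis .
qed

section \<open>Dilation of densities, and the limit of vanishing \<epsilon>\<close>

lemma density_measure_dilate:
  assumes [measurable]: "f \<in> borel_measurable borel" and c: "c > 0" and nn: "\<And>x. f x \<ge> 0"
  shows "density_measure (\<lambda>x. c * f (c * x)) = distr (density_measure f) borel (\<lambda>x. x / c)"
proof (rule measure_eqI)
  fix A assume "A \<in> sets (density_measure (\<lambda>x. c * f (c * x)))"
  then have [measurable]: "A \<in> sets borel" by simp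
  have [measurable]: "(\<lambda>x. x / c) -` A \<in> sets borel"
    by (rule measurable_sets_borel[where M=borel]) auto
  have "emeasure (distr (density_measure f) borel (\<lambda>x. x / c)) A
      = emeasure (density_measure f) ((\<lambda>x. x / c) -` A)"
    by (subst emeasure_distr) auto
  also have "\<dots> = (\<integral>\<^sup>+x. ennreal (f x) * indicator A (x / c) \<partial>lborel)"
    by (subst emeasure_density) (auto intro!: nn_integral_cong simp: indicator_def measurable_sets_borel)
  also have "\<dots> = \<bar>c\<bar> * (\<integral>\<^sup>+x. ennreal (f (0 + c * x)) * indicator A ((0 + c * x) / c) \<partial>lborel)"
    using c by (intro nn_integral_real_affine) auto
  also have "\<dots> = (\<integral>\<^sup>+x. ennreal (c * f (c * x)) * indicator A x \<partial>lborel)"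
    using c nn by (subst nn_integral_cmult[symmetric]) (auto simp: ennreal_mult mult.assoc)
  also have "\<dots> = emeasure (density_measure (\<lambda>x. c * f (c * x))) A"
    by (subst emeasure_density) auto
  finally show "emeasure (density_measure (\<lambda>x. c * f (c * x))) A
      = emeasure (distr (density_measure f) borel (\<lambda>x. x / c)) A" by simp
qed simp

text \<open>The regularised quantiles converge at every continuity point of the limiting quantile
  function, hence almost everywhere; Fatou's lemma carries the bound over.\<close>

lemma limit_estimate:
  assumes T: "T > 0" and \<theta>: "\<theta> \<ge> 1" and mT: "\<And>x. mT x \<ge> 0"
    and r: "r \<ge> 0" "\<And>x. \<bar>x\<bar> > r \<Longrightarrow> mT x = 0"
    and plan: "planning_solution \<theta> T \<mu>0 \<mu>T u m"
    and approx: "\<And>k. approx_solution \<theta> T mT C (\<epsilon> k) (U k) (M k)"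
    and \<epsilon>: "\<And>k. \<epsilon> k > 0" "\<epsilon> \<longlonglongrightarrow> 0"
    and lim: "\<And>t x. t \<in> {0<..<T} \<Longrightarrow> (\<lambda>k. M k t x) \<longlonglongrightarrow> m t x"
    and t: "0 < t" "t < T"
  shows "(\<integral>\<^sup>+\<omega>. ennreal ((quantile (density_measure (m t)) \<omega> - t powr alpha \<theta> * phi_quantile \<theta> \<omega>)\<^sup>2) \<partial>unit_interval)
    \<le> ennreal (t\<^sup>2 * (2 * (r\<^sup>2 + (R_alpha \<theta> * T powr alpha \<theta>)\<^sup>2) / T\<^sup>2))"
proof -
  have \<theta>0: "\<theta> > 0" using \<theta> by simp
  have tT: "t \<in> {0<..<T}" using t by simp
  let ?\<alpha> = "alpha \<theta>" and ?R = "R_alpha \<theta>" and ?q = "phi_quantile \<theta>"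
  define \<mu> where "\<mu> = density_measure (m t)"
  \<comment> \<open>A tolerance vanishing along the sequence: a diagonal choice that merges the
    removal of the regularisation with the limit in \<epsilon>.\<close>
  define e where "e k = inverse (real (Suc k))" for k
  have e: "e k > 0" for k by (simp add: e_def)
  have e0: "e \<longlonglongrightarrow> 0" unfolding e_def by (rule LIMSEQ_inverse_real_of_nat)
  define b where "b k = (t + \<epsilon> k)\<^sup>2 * (2 * (r\<^sup>2 + (?R * (T + \<epsilon> k) powr ?\<alpha>)\<^sup>2) / (T + \<epsilon> k)\<^sup>2 + e k)" for k
  have regular: "continuous_on UNIV (h t)" "\<And>x. h t x \<ge> 0"
    if "planning_solution \<theta> T \<nu>0 \<nu>T v h" for \<nu>0 \<nu>T v h
    using that tT continuous_on_slices(1)[of "{0<..<T}" UNIV h t] unfolding planning_solution_def by auto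
  have planM: "planning_solution \<theta> T (density_measure (initial_approx \<theta> (\<epsilon> k))) (density_measure mT) (U k) (M k)" for k
    using approx[of k] by (simp add: approx_solution_def)
  have \<mu>: "real_distribution \<mu>"
    unfolding \<mu>_def by (rule planning_solution_distribution[OF plan tT])
  have cdf: "(\<lambda>k. cdf (density_measure (M k t)) y) \<longlonglongrightarrow> cdf \<mu> y" for y
    unfolding \<mu>_def
    by (intro cdf_tendsto_of_densities planning_solution_distribution[OF plan tT]
        planning_solution_distribution[OF planM tT] borel_measurable_continuous_onI
        regular[OF plan] regular[OF planM] lim[OF tT])
  define P where "P k x g \<longleftrightarrow> continuous_on {0..1} x \<and> (\<forall>y. \<bar>g y - cdf (density_measure (M k t)) y\<bar> \<le> e k) \<and>
     (\<forall>s\<in>{0<..<1}. \<forall>y. s \<le> g y \<longleftrightarrow> x s \<le> y) \<and>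
     integral {0..1} (\<lambda>s. (x s - (t + \<epsilon> k) powr ?\<alpha> * ?q s)\<^sup>2) \<le> b k" for k x g
  have "\<exists>x g. P k x g" for k
    unfolding P_def b_def
  proof (rule approx_solution_estimate[OF T \<theta> \<epsilon>(1)[of k] mT r approx t e[of k]], goal_cases)
    case (2 x g)
    show ?case by (rule exI[of _ x], rule exI[of _ g], intro conjI ballI allI 2)
  qed
  then obtain x g where "P k (x k) (g k)" for k by metis
  then have x: "\<And>k. continuous_on {0..1} (x k)"
    and g: "\<And>k y. \<bar>g k y - cdf (density_measure (M k t)) y\<bar> \<le> e k"
    and xg: "\<And>k s y. s \<in> {0<..<1} \<Longrightarrow> s \<le> g k y \<longleftrightarrow> x k s \<le> y"
    and xb: "\<And>k. integral {0..1} (\<lambda>s. (x k s - (t + \<epsilon> k) powr ?\<alpha> * ?q s)\<^sup>2) \<le> b k"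
    unfolding P_def by blast+
  have glim: "(\<lambda>k. g k y) \<longlonglongrightarrow> cdf \<mu> y" for y
  proof -
    have "(\<lambda>k. g k y - cdf (density_measure (M k t)) y) \<longlonglongrightarrow> 0"
      by (rule Lim_null_comparison[OF always_eventually e0]) (use g in auto)
    from tendsto_add[OF this cdf[of y]] show ?thesis by simp
  qed
  define f where "f k s = ennreal ((x k s - (t + \<epsilon> k) powr ?\<alpha> * ?q s)\<^sup>2)" for k s
  define f0 where "f0 s = ennreal ((quantile \<mu> s - t powr ?\<alpha> * ?q s)\<^sup>2)" for s
  have fc: "continuous_on {0..1} (\<lambda>s. (x k s - (t + \<epsilon> k) powr ?\<alpha> * ?q s)\<^sup>2)" for k
    by (intro continuous_intros x phi_quantile_cont[OF \<theta>0])
  have fm: "f k \<in> borel_measurable unit_interval" for k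
    unfolding f_def[abs_def] using continuous_measurable_unit_interval[OF fc] by measurable
  have "AE s in unit_interval. (\<lambda>k. f k s) \<longlonglongrightarrow> f0 s"
  proof (rule AE_I')
    let ?D = "{s\<in>{0<..<1}. \<not> isCont (quantile \<mu>) s}"
    have c: "countable ?D" by (rule quantile_discontinuities[OF \<mu>])
    show "?D \<in> null_sets unit_interval"
    proof (rule null_setsI)
      show "emeasure unit_interval ?D = 0"
        using emeasure_lborel_countable[OF c] by (subst emeasure_restrict_space) auto
      show "?D \<in> sets unit_interval"
        using c by (auto simp: sets_restrict_space image_iff intro!: bexI[of _ ?D] countable_imp_null_set_lborel)
    qed
    show "{s \<in> space unit_interval. \<not> (\<lambda>k. f k s) \<longlonglongrightarrow> f0 s} \<subseteq> ?D"
    proof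
      fix s assume s: "s \<in> {s \<in> space unit_interval. \<not> (\<lambda>k. f k s) \<longlonglongrightarrow> f0 s}"
      then have s01: "s \<in> {0<..<1}" by (simp add: space_restrict_space)
      have "\<not> isCont (quantile \<mu>) s"
      proof
        assume "isCont (quantile \<mu>) s"
        from quantile_tendsto[OF \<mu> s01 this glim xg[OF s01]]
        have xl: "(\<lambda>k. x k s) \<longlonglongrightarrow> quantile \<mu> s" .
        have "(\<lambda>k. (x k s - (t + \<epsilon> k) powr ?\<alpha> * ?q s)\<^sup>2) \<longlonglongrightarrow> (quantile \<mu> s - (t + 0) powr ?\<alpha> * ?q s)\<^sup>2"
          using t by (intro tendsto_intros xl \<epsilon>) auto
        then have "(\<lambda>k. f k s) \<longlonglongrightarrow> f0 s" unfolding f_def f0_def by (intro tendsto_ennrealI) simp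
        then show False using s by simp
      qed
      then show "s \<in> ?D" using s01 by simp
    qed
  qed
  then have "(\<integral>\<^sup>+s. f0 s \<partial>unit_interval) = (\<integral>\<^sup>+s. liminf (\<lambda>k. f k s) \<partial>unit_interval)"
    by (intro nn_integral_cong_AE) (auto elim!: eventually_mono simp: lim_imp_Liminf)
  also have "\<dots> \<le> liminf (\<lambda>k. \<integral>\<^sup>+s. f k s \<partial>unit_interval)"
    by (rule nn_integral_liminf[OF fm])
  also have "\<dots> \<le> liminf (\<lambda>k. ennreal (b k))"
  proof (rule Liminf_mono[OF always_eventually], rule allI)
    fix k
    have "(\<integral>\<^sup>+s. f k s \<partial>unit_interval) \<le> ennreal (integral {0..1} (\<lambda>s. (x k s - (t + \<epsilon> k) powr ?\<alpha> * ?q s)\<^sup>2))"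
      unfolding f_def by (rule nn_integral_unit_interval[OF fc]) simp
    also have "\<dots> \<le> ennreal (b k)" by (rule ennreal_leI[OF xb])
    finally show "(\<integral>\<^sup>+s. f k s \<partial>unit_interval) \<le> ennreal (b k)" .
  qed
  also have "\<dots> = ennreal (t\<^sup>2 * (2 * (r\<^sup>2 + (?R * T powr ?\<alpha>)\<^sup>2) / T\<^sup>2))"
  proof (rule lim_imp_Liminf)
    have "b \<longlonglongrightarrow> (t + 0)\<^sup>2 * (2 * (r\<^sup>2 + (?R * (T + 0) powr ?\<alpha>)\<^sup>2) / (T + 0)\<^sup>2 + 0)"
      unfolding b_def using T by (intro tendsto_intros \<epsilon> e0) auto
    then show "(\<lambda>k. ennreal (b k)) \<longlonglongrightarrow> ennreal (t\<^sup>2 * (2 * (r\<^sup>2 + (?R * T powr ?\<alpha>)\<^sup>2) / T\<^sup>2))"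
      by (intro tendsto_ennrealI) simp
  qed simp
  finally show ?thesis unfolding f0_def \<mu>_def .
qed

theorem lemma3p8:
  fixes T \<theta> \<kappa> :: real and mT :: "real \<Rightarrow> real"
    and u m :: "real \<Rightarrow> real \<Rightarrow> real"
  assumes "T > 0" and "\<theta> > 2" and "\<kappa> = 1 - 2 * alpha \<theta>"
    and "terminal_density \<theta> mT"
    and "constructed_solution \<theta> T mT u m"
  shows "\<exists>C>0. \<forall>\<tau><ln T.
    wasserstein2 (density_measure (rescaled \<theta> m \<tau>)) (density_measure (phi \<theta>))
      \<le> ennreal (C * exp (\<kappa> * \<tau>))"
proof -
  have T: "T > 0" and \<theta>: "\<theta> \<ge> 1" "\<theta> > 0" using assms by auto
  let ?\<alpha> = "alpha \<theta>" and ?R = "R_alpha \<theta>" and ?q = "phi_quantile \<theta>"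
  obtain a b where mT: "\<And>x. mT x \<ge> 0" and ab: "\<And>x. x \<notin> {a..b} \<Longrightarrow> mT x = 0"
    using assms(4) unfolding terminal_density_def by blast
  define r where "r = max \<bar>a\<bar> \<bar>b\<bar>"
  have r: "r \<ge> 0" "\<And>x. \<bar>x\<bar> > r \<Longrightarrow> mT x = 0"
  proof -
    show "mT x = 0" if "\<bar>x\<bar> > r" for x using that by (intro ab) (auto simp: r_def)
  qed (simp add: r_def)
  have plan: "planning_solution \<theta> T (return borel 0) (density_measure mT) u m"
    using assms(5) by (simp add: constructed_solution_def)
  obtain U M C0 \<epsilon> where approx: "\<And>\<epsilon>. \<epsilon> \<in> {0<..<1} \<Longrightarrow> approx_solution \<theta> T mT C0 \<epsilon> (U \<epsilon>) (M \<epsilon>)"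
    and \<epsilon>: "\<And>k. \<epsilon> k \<in> {0<..<1}" "\<epsilon> \<longlonglongrightarrow> 0"
    and unif: "\<And>K. compact K \<Longrightarrow> K \<subseteq> {0<..<T} \<times> UNIV \<Longrightarrow>
        uniform_limit K (\<lambda>k (t, x). M (\<epsilon> k) t x) (\<lambda>(t, x). m t x) sequentially"
    using assms(5) unfolding constructed_solution_def by (elim conjE exE) (rule that, auto)
  have lim: "(\<lambda>k. M (\<epsilon> k) t x) \<longlonglongrightarrow> m t x" if "t \<in> {0<..<T}" for t x
    using tendsto_uniform_limitI[OF unif[of "{(t, x)}"], of "(t, x)"] that by simp
  \<comment> \<open>Bounds the distance at time T divided by T, by way of (x - z)^2 \<le> 2 x^2 + 2
    z^2 with radii \<open>r\<close> and R T^\<alpha>.\<close>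
  define D where "D = sqrt (2 * (r\<^sup>2 + (?R * T powr ?\<alpha>)\<^sup>2) / T\<^sup>2)"
  have D: "D \<ge> 0" "D\<^sup>2 = 2 * (r\<^sup>2 + (?R * T powr ?\<alpha>)\<^sup>2) / T\<^sup>2" by (auto simp: D_def)
  \<comment> \<open>The summand 1 makes the constant positive without deciding whether
    \<open>D\<close> is.\<close>
  have main: "wasserstein2 (density_measure (rescaled \<theta> m \<tau>)) (density_measure (phi \<theta>))
      \<le> ennreal ((D * T powr ?\<alpha> + 1) * exp (\<kappa> * \<tau>))" if \<tau>: "\<tau> < ln T" for \<tau>
  proof -
    define t where "t = exp \<tau>"
    have "exp \<tau> < exp (ln T)" using \<tau> by (simp only: exp_less_cancel_iff)
    then have t: "0 < t" "t < T" using T by (simp_all add: t_def)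
    then have tT: "t \<in> {0<..<T}" by simp
    define s where "s = t powr ?\<alpha>"
    have s: "s > 0" using t by (simp add: s_def)
    define \<mu> where "\<mu> = density_measure (m t)"
    have \<mu>: "real_distribution \<mu>"
      unfolding \<mu>_def by (rule planning_solution_distribution[OF plan tT])
    have mc: "continuous_on UNIV (m t)" and nn: "\<And>x. m t x \<ge> 0"
      using plan tT continuous_on_slices(1)[of "{0<..<T}" UNIV m t] unfolding planning_solution_def by auto
    have qm: "quantile \<mu> \<in> borel_measurable unit_interval" by (rule quantile_measurable[OF \<mu>])
    have "density_measure (rescaled \<theta> m \<tau>) = density_measure (\<lambda>x. s * m t (s * x))"
      by (simp add: rescaled_def Let_def t_def s_def)
    also have "\<dots> = distr \<mu> borel (\<lambda>x. x / s)"
      unfolding \<mu>_def by (intro density_measure_dilate borel_measurable_continuous_onI mc s nn)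
    also have "\<dots> = distr (distr unit_interval borel (quantile \<mu>)) borel (\<lambda>x. x / s)"
      by (simp only: distr_quantile[OF \<mu>])
    also have "\<dots> = distr unit_interval borel (\<lambda>\<omega>. quantile \<mu> \<omega> / s)"
      using qm by (subst distr_distr) (auto simp: o_def)
    finally have resc: "density_measure (rescaled \<theta> m \<tau>) = distr unit_interval borel (\<lambda>\<omega>. quantile \<mu> \<omega> / s)" .
    have est: "(\<integral>\<^sup>+\<omega>. ennreal ((quantile \<mu> \<omega> - s * ?q \<omega>)\<^sup>2) \<partial>unit_interval) \<le> ennreal (t\<^sup>2 * D\<^sup>2)"
      unfolding \<mu>_def s_def D(2)
      by (rule limit_estimate[OF T \<theta>(1) mT r plan approx[OF \<epsilon>(1)] _ \<epsilon>(2) lim t]) (use \<epsilon>(1) in auto)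
    have qc: "?q \<in> borel_measurable unit_interval"
      by (rule continuous_measurable_unit_interval[OF phi_quantile_cont[OF \<theta>(2)]])
    have "(\<integral>\<^sup>+\<omega>. ennreal ((quantile \<mu> \<omega> / s - ?q \<omega>)\<^sup>2) \<partial>unit_interval)
        = (\<integral>\<^sup>+\<omega>. ennreal (1 / s\<^sup>2) * ennreal ((quantile \<mu> \<omega> - s * ?q \<omega>)\<^sup>2) \<partial>unit_interval)"
    proof (intro nn_integral_cong)
      fix \<omega>
      have eq: "(quantile \<mu> \<omega> / s - ?q \<omega>)\<^sup>2 = 1 / s\<^sup>2 * (quantile \<mu> \<omega> - s * ?q \<omega>)\<^sup>2"
        using s by (simp add: field_simps power2_eq_square)
      show "ennreal ((quantile \<mu> \<omega> / s - ?q \<omega>)\<^sup>2) = ennreal (1 / s\<^sup>2) * ennreal ((quantile \<mu> \<omega> - s * ?q \<omega>)\<^sup>2)"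
        unfolding eq by (rule ennreal_mult) simp_all
    qed
    also have "\<dots> = ennreal (1 / s\<^sup>2) * (\<integral>\<^sup>+\<omega>. ennreal ((quantile \<mu> \<omega> - s * ?q \<omega>)\<^sup>2) \<partial>unit_interval)"
      by (intro nn_integral_cmult measurable_compose[OF _ measurable_ennreal] borel_measurable_power
          borel_measurable_diff borel_measurable_times borel_measurable_const qm qc)
    also have "\<dots> \<le> ennreal (1 / s\<^sup>2) * ennreal (t\<^sup>2 * D\<^sup>2)"
      by (intro mult_left_mono est) simp
    also have "\<dots> = ennreal ((D * (t / s))\<^sup>2)"
      by (simp add: ennreal_mult[symmetric] power_mult_distrib power_divide mult_ac)
    finally have "wasserstein2 (density_measure (rescaled \<theta> m \<tau>)) (density_measure (phi \<theta>)) \<le> ennreal (D * (t / s))"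
      unfolding resc density_measure_phi[OF \<theta>(2)] using D(1) t s
      by (intro wasserstein2_quantile_le borel_measurable_divide borel_measurable_const qm qc) auto
    also have "D * (t / s) \<le> (D * T powr ?\<alpha> + 1) * exp (\<kappa> * \<tau>)"
    proof -
      have tp: "t powr c = exp (c * \<tau>)" for c by (simp add: t_def powr_def)
      have "t / s = t powr (1 - ?\<alpha>)" using t by (simp add: s_def powr_diff)
      \<comment> \<open>Since 1 - \<alpha> = \<alpha> + \<kappa>, the surplus power t^\<alpha> is
        bounded by T^\<alpha> and enters the constant.\<close>
      also have "\<dots> = t powr ?\<alpha> * t powr \<kappa>" by (simp add: assms(3) flip: powr_add)
      also have "\<dots> \<le> T powr ?\<alpha> * t powr \<kappa>"
        using t alpha_bounds[OF \<theta>(2)] by (intro mult_right_mono powr_mono2) auto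
      finally have "D * (t / s) \<le> D * (T powr ?\<alpha> * exp (\<kappa> * \<tau>))"
        using D(1) tp[of \<kappa>] by (intro mult_left_mono) auto
      also have "\<dots> \<le> (D * T powr ?\<alpha> + 1) * exp (\<kappa> * \<tau>)" by (simp add: algebra_simps)
      finally show ?thesis .
    qed
    finally show ?thesis by (simp add: ennreal_leI)
  qed
  have "D * T powr ?\<alpha> + 1 > 0" using D(1) by (intro add_nonneg_pos) auto
  with main show ?thesis by blast
qed

end
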